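(* Let $0<A\le B$ and let $V(x)=V^{\rm Hahn}(x;A,B)$, $\rho^0(x)\equiv1$ on $[0,1]$. The minimizer $\mu^c_{\min}$ of the constrained variational problem described in the context, and its Lagrange multiplier $\ell_c$, are given as follows. (1) If $0<c<c_A$ (void-band-void): for $\alpha\le x\le\beta$, $$\frac{d\mu^c_{\min}}{dx}(x)=\frac1{\pi c}\left[\arctan(k_2T(x))+\arctan(k_3T(x))-\arctan(k_1T(x))-\arctan(k_4T(x))\right],$$ $d\mu^c_{\min}/dx\equiv0$ for $0\le x\le\alpha$ and for $\beta\le x\le1$, and $$\ell_c=(\beta-\alpha)\left\{[\log(\beta-\alpha)-1]K^{(1)}-2\log(2)K^{(2)}+2K^{(3)}\right\}+\varphi(\beta)$$ with $(\sigma_1,\sigma_2,\sigma_3,\sigma_4)=(1,-1,-1,1)$ in the formulas for $K^{(i)}$ below. (2) If $c_A<c<c_B$ (saturated-band-void): for $\alpha\le x\le\beta$, $$\frac{d\mu^c_{\min}}{dx}(x)=\frac1{\pi c}\left[\arctan(k_2T(x))+\arctan(k_3T(x))-\arctan(k_1T(x))+\arctan(k_4T(x))\right],$$ $d\mu^c_{\min}/dx\equiv1/c$ for $0\le x\le\alpha$, $d\mu^c_{\min}/dx\equiv0$ for $\beta\le x\le1$, and $$\ell_c=(\beta-\alpha)\left\{[\log(\beta-\alpha)-1]K^{(1)}-2\log(2)K^{(2)}+2K^{(3)}\right\}+\varphi(\beta)+2(\beta-\alpha)\log(\beta-\alpha)+2\alpha-2\beta\log\beta$$ with $(\sigma_1,\sigma_2,\sigma_3,\sigma_4)=(1,-1,-1,-1)$.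 (3) If $c_B<c<1$ (saturated-band-saturated): for $\alpha\le x\le\beta$, $$\frac{d\mu^c_{\min}}{dx}(x)=\frac1c+\frac1{\pi c}\left[\arctan(k_3T(x))+\arctan(k_4T(x))-\arctan(k_1T(x))-\arctan(k_2T(x))\right],$$ $d\mu^c_{\min}/dx\equiv1/c$ for $0\le x\le\alpha$ and for $\beta\le x\le1$, and $$\ell_c=(\beta-\alpha)\left\{[\log(\beta-\alpha)-1]K^{(1)}-2\log(2)K^{(2)}+2K^{(3)}\right\}+\varphi(\beta)+2-2\beta\log\beta-2(1-\beta)\log(1-\beta)$$ with $(\sigma_1,\sigma_2,\sigma_3,\sigma_4)=(1,1,-1,-1)$. Here $$K^{(1)}=\sum_{i=1}^4\sigma_i\frac{k_i}{1+k_i},\qquad K^{(2)}=\sum_{i=1}^4\sigma_i\frac{k_i}{1-k_i^2},\qquad K^{(3)}=\sum_{i=1}^4\sigma_i\frac{\log(1+k_i)}{1-k_i^2}.$$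
   Context: $V^{\rm Hahn}(x;A,B)=A\log A+(B+1)\log(B+1)-(A+x)\log(A+x)-(B+1-x)\log(B+1-x)$. **Variational problem** (with $[a,b]=[0,1]$, $\rho^0\equiv1$, $c\in(0,1)$): the external field is $\varphi(x)=V(x)+\int_0^1\log|x-y|\,dy$; $\mu^c_{\min}$ is the unique minimizer of $E_c[\mu]=c\int_0^1\int_0^1\log\frac1{|x-y|}d\mu(x)d\mu(y)+\int_0^1\varphi\,d\mu$ over Borel probability measures on $[0,1]$ satisfying $0\le\mu(\mathcal B)\le\frac1c|\mathcal B|$ for all Borel $\mathcal B\subset[0,1]$ ($|\mathcal B|$ Lebesgue measure). The Lagrange multiplier $\ell_c$ is the real constant such that $\frac{\delta E_c}{\delta\mu}(x):=-2c\int_0^1\log|x-y|\,d\mu^c_{\min}(y)+\varphi(x)$ equals $\ell_c$ in the band (the interval where $0<d\mu^c_{\min}/dx<1/c$), exceeds $\ell_c$ in voids (density $0$) and is less than $\ell_c$ in saturated regions (density $1/c$). **Constants.** $c_A=\frac{-(A+B)+\sqrt{(A+B)^2+4A}}2$, $c_B=\frac{-(A+B)+\sqrt{(A+B)^2+4B}}2$ (so $0<c_A\le c_B<1$). $D=c(1-c)(A+c)(B+c)(A+B+c)(A+B+c+1)$, $\alpha=\frac{(B-A+2)c^2+(A+B)(B-A+2)c+A(A+B)-2\sqrt D}{(A+B+2c)^2}$, $\beta=\frac{(B-A+2)c^2+(A+B)(B-A+2)c+A(A+B)+2\sqrt D}{(A+B+2c)^2}$. $T(x)=\sqrt{\frac{\beta-x}{x-\alpha}}$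 for $\alpha<x<\beta$. $k_1=\sqrt{\frac{1+B-\alpha}{1+B-\beta}}$, $k_2=\sqrt{\frac{1-\alpha}{1-\beta}}$, $k_3=\sqrt{\frac{A+\alpha}{A+\beta}}$, $k_4=\sqrt{\frac\alpha\beta}$. *)

theory Defs
  imports "HOL-Probability.Probability"
begin
definition unit_lborel :: "real measure" where
  "unit_lborel = restrict_space lborel {0..1}"

definition ext_field :: "(real \<Rightarrow> real) \<Rightarrow> real \<Rightarrow> real" where
  "ext_field V x = V x + (\<integral>y. ln \<bar>x - y\<bar> \<partial>unit_lborel)"

text \<open>In the integrands below, \<open>ln \<bar>x - y\<bar>\<close> and \<open>ln (1 / \<bar>x - y\<bar>)\<close> get the value \<open>0\<close> at
  \<open>x = y\<close> (since \<open>ln 0 = 0\<close> and \<open>1 / 0 = 0\<close>) instead of an infinite one. This is harmless: an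
  admissible measure has a bounded density, so it has no atoms and all integrals converge absolutely.\<close>

definition admissible :: "real \<Rightarrow> real measure \<Rightarrow> bool" where
  "admissible c \<mu> \<longleftrightarrow>
     sets \<mu> = sets unit_lborel \<and> prob_space \<mu> \<and>
     (\<forall>S\<in>sets \<mu>. measure \<mu> S \<le> 1 / c * measure lborel S)"

definition energy :: "(real \<Rightarrow> real) \<Rightarrow> real \<Rightarrow> real measure \<Rightarrow> real" where
  "energy V c \<mu> =
     c * (\<integral>x. (\<integral>y. ln (1 / \<bar>x - y\<bar>) \<partial>\<mu>) \<partial>\<mu>) + (\<integral>x. ext_field V x \<partial>\<mu>)"

definition is_minimizer :: "(real \<Rightarrow> real) \<Rightarrow> real \<Rightarrow> real measure \<Rightarrow> bool" where
  "is_minimizer V c \<mu> \<longleftrightarrow>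
     admissible c \<mu> \<and> (\<forall>\<nu>. admissible c \<nu> \<longrightarrow> energy V c \<mu> \<le> energy V c \<nu>)"

definition is_unique_minimizer :: "(real \<Rightarrow> real) \<Rightarrow> real \<Rightarrow> real measure \<Rightarrow> bool" where
  "is_unique_minimizer V c \<mu> \<longleftrightarrow>
     is_minimizer V c \<mu> \<and> (\<forall>\<nu>. is_minimizer V c \<nu> \<longrightarrow> \<nu> = \<mu>)"

text \<open>The density \<open>d\<mu>/dx\<close>, which is only meaningful almost everywhere. Admissible measures are
  absolutely continuous, hence determined by it.\<close>

definition dens :: "real measure \<Rightarrow> real \<Rightarrow> real" where
  "dens \<mu> x = enn2real (RN_deriv unit_lborel \<mu> x)"

definition var_deriv :: "(real \<Rightarrow> real) \<Rightarrow> real \<Rightarrow> real measure \<Rightarrow> real \<Rightarrow> real" where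
  "var_deriv V c \<mu> x = -2 * c * (\<integral>y. ln \<bar>x - y\<bar> \<partial>\<mu>) + ext_field V x"

definition open_subinterval :: "real set \<Rightarrow> bool" where
  "open_subinterval J \<longleftrightarrow> is_interval J \<and> openin (top_of_set {0..1}) J"

text \<open>Bands, voids and saturated regions are the maximal relatively open subintervals of \<open>[0,1]\<close> on
  which the stated density condition holds. Since the conditions on \<open>l\<close> are pointwise, they can be
  imposed on all such subintervals, maximal or not.\<close>

definition is_multiplier :: "(real \<Rightarrow> real) \<Rightarrow> real \<Rightarrow> real measure \<Rightarrow> real \<Rightarrow> bool" where
  "is_multiplier V c \<mu> l \<longleftrightarrow>
     (\<forall>J. open_subinterval J \<longrightarrow>
        ((AE x in unit_lborel. x \<in> J \<longrightarrow> 0 < dens \<mu> x \<and> dens \<mu> x < 1 / c) \<longrightarrow>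
           (\<forall>x\<in>J. var_deriv V c \<mu> x = l)) \<and>
        ((AE x in unit_lborel. x \<in> J \<longrightarrow> dens \<mu> x = 0) \<longrightarrow>
           (\<forall>x\<in>J. var_deriv V c \<mu> x > l)) \<and>
        ((AE x in unit_lborel. x \<in> J \<longrightarrow> dens \<mu> x = 1 / c) \<longrightarrow>
           (\<forall>x\<in>J. var_deriv V c \<mu> x < l)))"

definition V_Hahn :: "real \<Rightarrow> real \<Rightarrow> real \<Rightarrow> real" where
  "V_Hahn A B x = A * ln A + (B + 1) * ln (B + 1)
     - (A + x) * ln (A + x) - (B + 1 - x) * ln (B + 1 - x)"

definition cA :: "real \<Rightarrow> real \<Rightarrow> real" where
  "cA A B = (- (A + B) + sqrt ((A + B)\<^sup>2 + 4 * A)) / 2"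

definition cB :: "real \<Rightarrow> real \<Rightarrow> real" where
  "cB A B = (- (A + B) + sqrt ((A + B)\<^sup>2 + 4 * B)) / 2"

definition hahn_D :: "real \<Rightarrow> real \<Rightarrow> real \<Rightarrow> real" where
  "hahn_D A B c = c * (1 - c) * (A + c) * (B + c) * (A + B + c) * (A + B + c + 1)"

definition hahn_alpha :: "real \<Rightarrow> real \<Rightarrow> real \<Rightarrow> real" where
  "hahn_alpha A B c =
     ((B - A + 2) * c\<^sup>2 + (A + B) * (B - A + 2) * c + A * (A + B) - 2 * sqrt (hahn_D A B c))
       / (A + B + 2 * c)\<^sup>2"

definition hahn_beta :: "real \<Rightarrow> real \<Rightarrow> real \<Rightarrow> real" where
  "hahn_beta A B c =
     ((B - A + 2) * c\<^sup>2 + (A + B) * (B - A + 2) * c + A * (A + B) + 2 * sqrt (hahn_D A B c))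
       / (A + B + 2 * c)\<^sup>2"

definition hahn_T :: "real \<Rightarrow> real \<Rightarrow> real \<Rightarrow> real \<Rightarrow> real" where
  "hahn_T A B c x = sqrt ((hahn_beta A B c - x) / (x - hahn_alpha A B c))"

definition hahn_k1 :: "real \<Rightarrow> real \<Rightarrow> real \<Rightarrow> real" where
  "hahn_k1 A B c = sqrt ((1 + B - hahn_alpha A B c) / (1 + B - hahn_beta A B c))"

definition hahn_k2 :: "real \<Rightarrow> real \<Rightarrow> real \<Rightarrow> real" where
  "hahn_k2 A B c = sqrt ((1 - hahn_alpha A B c) / (1 - hahn_beta A B c))"

definition hahn_k3 :: "real \<Rightarrow> real \<Rightarrow> real \<Rightarrow> real" where
  "hahn_k3 A B c = sqrt ((A + hahn_alpha A B c) / (A + hahn_beta A B c))"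

definition hahn_k4 :: "real \<Rightarrow> real \<Rightarrow> real \<Rightarrow> real" where
  "hahn_k4 A B c = sqrt (hahn_alpha A B c / hahn_beta A B c)"

definition signed_sum ::
  "(real \<Rightarrow> real) \<Rightarrow> real \<Rightarrow> real \<Rightarrow> real \<Rightarrow> real \<times> real \<times> real \<times> real \<Rightarrow> real" where
  "signed_sum g A B c = (\<lambda>(s1, s2, s3, s4).
     s1 * g (hahn_k1 A B c) + s2 * g (hahn_k2 A B c) + s3 * g (hahn_k3 A B c) + s4 * g (hahn_k4 A B c))"

definition hahn_K1 :: "real \<Rightarrow> real \<Rightarrow> real \<Rightarrow> real \<times> real \<times> real \<times> real \<Rightarrow> real" where
  "hahn_K1 = signed_sum (\<lambda>k. k / (1 + k))"

definition hahn_K2 :: "real \<Rightarrow> real \<Rightarrow> real \<Rightarrow> real \<times> real \<times> real \<times> real \<Rightarrow> real" where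
  "hahn_K2 = signed_sum (\<lambda>k. k / (1 - k\<^sup>2))"

definition hahn_K3 :: "real \<Rightarrow> real \<Rightarrow> real \<Rightarrow> real \<times> real \<times> real \<times> real \<Rightarrow> real" where
  "hahn_K3 = signed_sum (\<lambda>k. ln (1 + k) / (1 - k\<^sup>2))"

text \<open>The part of the multiplier formula that has the same form in all three cases.\<close>

definition hahn_ell :: "real \<Rightarrow> real \<Rightarrow> real \<Rightarrow> real \<times> real \<times> real \<times> real \<Rightarrow> real" where
  "hahn_ell A B c \<sigma> = (let \<alpha> = hahn_alpha A B c; \<beta> = hahn_beta A B c in
     (\<beta> - \<alpha>) * ((ln (\<beta> - \<alpha>) - 1) * hahn_K1 A B c \<sigma> - 2 * ln 2 * hahn_K2 A B c \<sigma> + 2 * hahn_K3 A B c \<sigma>)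
       + ext_field (V_Hahn A B) \<beta>)"

end

theory Submission
  imports Defs "HOL-Real_Asymp.Real_Asymp"
begin

text \<open>The energy is strictly convex: a bounded mean-zero density \<open>h\<close> satisfies
  \<open>- \<integral>\<integral> ln \<bar>x - y\<bar> h(x) h(y) \<ge> \<integral> H\<^sup>2\<close> with \<open>H\<close> the primitive of \<open>h\<close>, because \<open>- ln \<bar>x - y\<bar>\<close> is, up to terms that
  vanish on mean-zero densities, a superposition of Gram kernels of indicator functions. Hence a density whose variational
  derivative \<open>G\<close> satisfies the (in)equalities with some constant is the unique minimizer.

  Each profile \<open>arctan (k T)\<close> with \<open>k\<^sup>2 = (p - \<alpha>) / (p - \<beta>)\<close> is the layer-cake representation of the balayage of
  a point mass at \<open>p\<close> onto the band, so \<open>G'\<close> is a signed sum over \<open>p \<in> {1 + B, 1, - A, 0}\<close> of Green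
  functions of the complement of the band, minus their values at infinity. The two endpoint equations say that the values at infinity cancel and that
  the total mass is \<open>1\<close>. Then \<open>G' = 0\<close> on the band, and outside of it the sign of \<open>G'\<close> is that of an odd cubic
  polynomial with known roots.\<close>

section \<open>Lebesgue measure on intervals and the primitive of the logarithm\<close>

text \<open>\<open>band_point\<close> sends a uniform angle in [0, pi/2] to the band so that the
  measure of the angles with image above y is \<open>arctan (k * T)\<close> at y. Masses and
  potentials thus become quarter-period integrals of quotients of quadratic forms in cosine and
  sine, or of their logarithms, and these have closed forms. The obstacle is the logarithmic pole.
  Potentials are never differentiated: \<open>G\<close> is expressed by the continuous primitive
  \<open>ln_prim\<close>, and G' enters through increments of \<open>G\<close>, by Fubini. Since the
  poles go to minus infinity, integrands are bounded above, and gauge integrals found from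
  primitives can be read as Lebesgue integrals. The radicals are tamed by the fact that at each of
  the four points both distances to the ends of the band are squares; the endpoint equations then
  shrink to a monomial and a polynomial identity. The multiplier is evaluated at \<beta> because
  \<beta> - \<open>band_point\<close> is a constant multiple of v = cos^2 / (cos^2 + k^2 sin^2); the
  integrals of v and v ln v are the origin of the terms in K^(1), K^(2), K^(3).\<close>

abbreviation lborel_Icc :: "real \<Rightarrow> real \<Rightarrow> real measure" where
  "lborel_Icc a b \<equiv> restrict_space lborel {a..b}"

lemma measurable_lborel_Icc [measurable (raw)]:
  "f \<in> borel \<rightarrow>\<^sub>M N \<Longrightarrow> f \<in> lborel_Icc a b \<rightarrow>\<^sub>M N"
  by (rule measurable_restrict_space1) simp

lemma space_lborel_Icc [simp]: "space (lborel_Icc a b) = {a..b}"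
  by (simp add: space_restrict_space)

lemma finite_measure_lborel_Icc: "finite_measure (lborel_Icc a b)"
  by (rule finite_measureI) (cases "a \<le> b"; simp add: emeasure_restrict_space)

lemma AE_lborel_Icc_iff: "(AE x in lborel_Icc a b. P x) \<longleftrightarrow> (AE x in lborel. x \<in> {a..b} \<longrightarrow> P x)"
  by (subst AE_restrict_space_iff) auto

lemma AE_lborel_Icc_not_in_finite: "finite S \<Longrightarrow> AE x in lborel_Icc a b. x \<notin> S"
  unfolding AE_lborel_Icc_iff
  by (rule AE_mp[OF AE_not_in[OF finite_imp_null_set_lborel[of S]]]) auto

lemma integrable_lborel_Icc_iff:
  fixes f :: "real \<Rightarrow> real"
  shows "integrable (lborel_Icc a b) f \<longleftrightarrow> set_integrable lborel {a..b} f"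
  by (simp add: integrable_restrict_space set_integrable_def)

lemma integral_lborel_Icc:
  fixes f :: "real \<Rightarrow> real"
  shows "(\<integral>x. f x \<partial>lborel_Icc a b) = (LINT x:{a..b}|lborel. f x)"
  by (simp add: integral_restrict_space set_lebesgue_integral_def)

lemma integrable_lborel_Icc_bounded:
  fixes f :: "real \<Rightarrow> real"
  assumes "f \<in> borel_measurable (lborel_Icc a b)" and "\<And>x. x \<in> {a..b} \<Longrightarrow> \<bar>f x\<bar> \<le> C"
  shows "integrable (lborel_Icc a b) f"
proof -
  interpret finite_measure "lborel_Icc a b" by (rule finite_measure_lborel_Icc)
  show ?thesis
    by (rule integrable_const_bound[of _ C]) (use assms in \<open>auto intro!: AE_I2\<close>)
qed

lemma integral_lborel_Icc_const:
  "a \<le> b \<Longrightarrow> (\<integral>x. (k::real) \<partial>lborel_Icc a b) = (b - a) * k"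
  by (simp add: measure_restrict_space)

lemma has_integral_lborel_Icc:
  fixes f :: "real \<Rightarrow> real"
  assumes "integrable (lborel_Icc a b) f"
  shows "(f has_integral (\<integral>x. f x \<partial>lborel_Icc a b)) {a..b}"
  using assms set_borel_integral_eq_integral[of "{a..b}" f]
  by (simp add: integrable_lborel_Icc_iff integral_lborel_Icc has_integral_integral)

lemma integral_lborel_Icc_eq:
  fixes f :: "real \<Rightarrow> real"
  assumes "integrable (lborel_Icc a b) f" "(f has_integral I) {a..b}"
  shows "(\<integral>x. f x \<partial>lborel_Icc a b) = I"
  using has_integral_unique[OF has_integral_lborel_Icc[OF assms(1)] assms(2)] .

text \<open>\<open>C - f\<close> is nonnegative, and a nonnegative gauge integrable function is
  absolutely integrable. This carries integrals found from primitives over to Lebesgue integrals of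
  integrands with logarithmic poles, which are bounded on one side only.\<close>

lemma lborel_Icc_has_integral_bounded_above:
  fixes f :: "real \<Rightarrow> real"
  assumes "f \<in> borel_measurable borel" "(f has_integral I) {a..b}"
    and "\<And>x. x \<in> {a..b} \<Longrightarrow> f x \<le> C"
  shows "integrable (lborel_Icc a b) f" "(\<integral>x. f x \<partial>lborel_Icc a b) = I"
proof -
  have "(\<lambda>x. C - f x) absolutely_integrable_on {a..b}"
    by (rule nonnegative_absolutely_integrable_1)
      (use assms in \<open>auto intro: integrable_diff has_integral_integrable\<close>)
  then have "set_integrable lborel {a..b} (\<lambda>x. C - f x)"
    using assms(1) by (simp add: set_integrable_def integrable_completion)
  then have "integrable (lborel_Icc a b) (\<lambda>x. C - f x)"
    by (simp add: integrable_lborel_Icc_iff)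
  from Bochner_Integration.integrable_diff[OF integrable_lborel_Icc_bounded[of "\<lambda>_. C" a b "\<bar>C\<bar>"] this]
  show *: "integrable (lborel_Icc a b) f" by simp
  show "(\<integral>x. f x \<partial>lborel_Icc a b) = I"
    by (rule integral_lborel_Icc_eq[OF * assms(2)])
qed

lemma integral_lborel_Icc_FTC:
  fixes f F :: "real \<Rightarrow> real"
  assumes "a \<le> b" "finite S" "continuous_on {a..b} F" "f \<in> borel_measurable borel"
    and "\<And>x. x \<in> {a<..<b} - S \<Longrightarrow> (F has_real_derivative f x) (at x)"
    and "\<And>x. x \<in> {a..b} \<Longrightarrow> f x \<le> C"
  shows "integrable (lborel_Icc a b) f" "(\<integral>x. f x \<partial>lborel_Icc a b) = F b - F a"
proof -
  have "(f has_integral (F b - F a)) {a..b}"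
    using assms by (intro fundamental_theorem_of_calculus_interior_strong[of S])
      (auto simp: has_real_derivative_iff_has_vector_derivative[symmetric])
  from lborel_Icc_has_integral_bounded_above[OF assms(4) this, of C] assms(6)
  show "integrable (lborel_Icc a b) f" "(\<integral>x. f x \<partial>lborel_Icc a b) = F b - F a" by auto
qed

text \<open>A primitive of the logarithm of the absolute value on either side of its pole. Because
  \<open>ln 0 = 0\<close> it takes the value 0 at 0, which is also its limit, so the fundamental
  theorem applies across the pole.\<close>

definition ln_prim :: "real \<Rightarrow> real" where
  "ln_prim u = u * ln \<bar>u\<bar> - u"

lemma ln_prim_minus [simp]: "ln_prim (- u) = - ln_prim u"
  by (simp add: ln_prim_def)

lemma ln_prim_0 [simp]: "ln_prim 0 = 0"
  by (simp add: ln_prim_def)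

text \<open>The squared form has no absolute value, so derivative rules and asymptotic expansions
  apply to it directly; at 0 both sides take the default value 0.\<close>

lemma ln_abs_eq: "ln \<bar>u\<bar> = ln (u\<^sup>2) / 2" for u :: real
  using ln_realpow[of "\<bar>u\<bar>" 2] by (cases "u = 0") simp_all

lemma DERIV_ln_prim:
  assumes "u \<noteq> 0"
  shows "(ln_prim has_real_derivative ln \<bar>u\<bar>) (at u)"
proof -
  have "ln_prim = (\<lambda>u. u * (ln (u\<^sup>2) / 2) - u)"
    by (auto simp: ln_prim_def fun_eq_iff ln_abs_eq)
  moreover have "((\<lambda>u. u * (ln (u\<^sup>2) / 2) - u) has_real_derivative ln \<bar>u\<bar>) (at u)"
    using assms by (auto intro!: derivative_eq_intros simp: ln_abs_eq field_simps power2_eq_square zero_less_mult_iff neq_iff)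
  ultimately show ?thesis by simp
qed

lemma isCont_ln_prim: "isCont ln_prim u"
proof (cases "u = 0")
  case False
  then show ?thesis using DERIV_ln_prim DERIV_isCont by blast
next
  case True
  have "((\<lambda>u::real. u * (ln (u\<^sup>2) / 2)) \<longlongrightarrow> 0) (at 0)"
    by real_asymp
  then have "((\<lambda>u::real. u * ln \<bar>u\<bar>) \<longlongrightarrow> 0) (at 0)"
    by (simp add: ln_abs_eq)
  then have "((\<lambda>u::real. u * ln \<bar>u\<bar> - u) \<longlongrightarrow> 0 - 0) (at 0)"
    by (intro tendsto_diff) auto
  then show ?thesis using True by (simp add: isCont_def ln_prim_def[abs_def])
qed

lemma continuous_on_ln_prim [continuous_intros]:
  "continuous_on S f \<Longrightarrow> continuous_on S (\<lambda>x. ln_prim (f x))"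
  using continuous_on_compose2[of UNIV ln_prim S f] isCont_ln_prim
  by (auto simp: continuous_on_eq_continuous_at)

lemma borel_measurable_ln_prim [measurable]: "ln_prim \<in> borel_measurable borel"
  by (rule borel_measurable_continuous_onI) (intro continuous_intros)

lemma ln_abs_diff_integral:
  fixes x a b :: real
  assumes "a \<le> b"
  shows "integrable (lborel_Icc a b) (\<lambda>y. ln \<bar>x - y\<bar>)"
    and "(\<integral>y. ln \<bar>x - y\<bar> \<partial>lborel_Icc a b) = ln_prim (x - a) - ln_prim (x - b)"
proof -
  have der: "((\<lambda>y. - ln_prim (x - y)) has_real_derivative ln \<bar>x - y\<bar>) (at y)" if "y \<noteq> x" for y
  proof -
    have "((\<lambda>y. x - y) has_real_derivative - 1) (at y)"
      by (auto intro!: derivative_eq_intros)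
    from DERIV_minus[OF DERIV_chain2[OF DERIV_ln_prim this]] show ?thesis
      using that by simp
  qed
  \<comment> \<open>The bound is one-sided, from ln u \<le> u - 1; at y = x the default value 0
    satisfies it as well.\<close>
  have bnd: "ln \<bar>x - y\<bar> \<le> \<bar>x - a\<bar> + \<bar>x - b\<bar>" if "y \<in> {a..b}" for y
    using that ln_le_minus_one[of "\<bar>x - y\<bar>"] by (cases "x = y") auto
  note * = integral_lborel_Icc_FTC[OF assms, of "{x}" "\<lambda>y. - ln_prim (x - y)"
      "\<lambda>y. ln \<bar>x - y\<bar>" "\<bar>x - a\<bar> + \<bar>x - b\<bar>"]
  show "integrable (lborel_Icc a b) (\<lambda>y. ln \<bar>x - y\<bar>)"
    by (rule *) (auto intro!: continuous_intros der bnd)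
  have "(\<integral>y. ln \<bar>x - y\<bar> \<partial>lborel_Icc a b) = - ln_prim (x - b) - (- ln_prim (x - a))"
    by (rule *) (auto intro!: continuous_intros der bnd)
  then show "(\<integral>y. ln \<bar>x - y\<bar> \<partial>lborel_Icc a b) = ln_prim (x - a) - ln_prim (x - b)" by simp
qed

section \<open>Trigonometric integrals\<close>

lemma weighted_cos_sin_pos:
  fixes a b :: real
  assumes "a > 0" "b > 0"
  shows "a * (cos t)\<^sup>2 + b * (sin t)\<^sup>2 > 0"
proof (cases "cos t = 0")
  case True
  then show ?thesis using assms sin_cos_squared_add[of t] by simp
next
  case False
  then show ?thesis using assms by (intro add_pos_nonneg) auto
qed

text \<open>A primitive of \<open>a b / (a\<^sup>2 cos\<^sup>2 + b\<^sup>2 sin\<^sup>2)\<close> that, unlike \<open>arctan (b / a * tan t)\<close>, is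
  smooth across \<open>pi / 2\<close>.\<close>

lemma DERIV_arctan_scaled_tan:
  fixes a b :: real
  assumes "a > 0" "b > 0"
  shows "((\<lambda>t. t + arctan ((b - a) * sin t * cos t / (a * (cos t)\<^sup>2 + b * (sin t)\<^sup>2)))
    has_real_derivative a * b / (a\<^sup>2 * (cos t)\<^sup>2 + b\<^sup>2 * (sin t)\<^sup>2)) (at t)"
proof -
  define C S where "C = cos t" and "S = sin t"
  define N where "N = a * C\<^sup>2 + b * S\<^sup>2"
  define Q where "Q = a\<^sup>2 * C\<^sup>2 + b\<^sup>2 * S\<^sup>2"
  have cs: "C\<^sup>2 = 1 - S\<^sup>2" by (simp add: C_def S_def cos_squared_eq)
  have N: "N > 0" and Q: "Q > 0"
    using weighted_cos_sin_pos[of a b t] weighted_cos_sin_pos[of "a\<^sup>2" "b\<^sup>2" t] assms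
    by (simp_all add: N_def Q_def C_def S_def)
  have NQ: "N\<^sup>2 + ((b - a) * S * C)\<^sup>2 = Q"
  proof -
    have "N\<^sup>2 + ((b - a) * S * C)\<^sup>2 = Q * (C\<^sup>2 + S\<^sup>2)"
      unfolding N_def Q_def by algebra
    then show ?thesis by (simp add: C_def S_def)
  qed
  define q' where "q' = ((b - a) * (C\<^sup>2 - S\<^sup>2) * N - (b - a) * S * C * (2 * (b - a) * S * C)) / N\<^sup>2"
  have num: "((\<lambda>t. (b - a) * sin t * cos t) has_real_derivative (b - a) * (C\<^sup>2 - S\<^sup>2)) (at t)"
    unfolding C_def S_def by (rule derivative_eq_intros refl | simp add: power2_eq_square algebra_simps)+
  have den: "((\<lambda>t. a * (cos t)\<^sup>2 + b * (sin t)\<^sup>2) has_real_derivative 2 * (b - a) * S * C) (at t)"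
    unfolding C_def S_def by (rule derivative_eq_intros refl | simp add: algebra_simps)+
  have "((\<lambda>t. (b - a) * sin t * cos t / (a * (cos t)\<^sup>2 + b * (sin t)\<^sup>2)) has_real_derivative q') (at t)"
    using DERIV_divide[OF num den] N by (simp add: q'_def N_def C_def S_def power2_eq_square)
  from DERIV_add[OF DERIV_ident DERIV_chain2[OF DERIV_arctan this]]
  have "((\<lambda>t. t + arctan ((b - a) * sin t * cos t / (a * (cos t)\<^sup>2 + b * (sin t)\<^sup>2)))
    has_real_derivative 1 + q' * inverse (1 + ((b - a) * S * C / N)\<^sup>2)) (at t)"
    by (simp add: N_def C_def S_def mult.commute)
  moreover have "1 + q' * inverse (1 + ((b - a) * S * C / N)\<^sup>2) = a * b / Q"
  proof -
    have "1 + ((b - a) * S * C / N)\<^sup>2 = (N\<^sup>2 + ((b - a) * S * C)\<^sup>2) / N\<^sup>2"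
      using N by (simp add: power_divide add_divide_distrib)
    then have "1 + q' * inverse (1 + ((b - a) * S * C / N)\<^sup>2) = 1 + (q' * N\<^sup>2) / Q"
      unfolding NQ by simp
    also have "q' * N\<^sup>2 = (b - a) * (a * C\<^sup>2 - b * S\<^sup>2)"
    proof -
      have "q' * N\<^sup>2 = (b - a) * (C\<^sup>2 - S\<^sup>2) * N - (b - a) * S * C * (2 * (b - a) * S * C)"
        using N by (simp add: q'_def)
      also have "\<dots> = (b - a) * (a * C\<^sup>2 - b * S\<^sup>2)"
        using cs unfolding N_def by algebra
      finally show ?thesis .
    qed
    also have "1 + (b - a) * (a * C\<^sup>2 - b * S\<^sup>2) / Q = (Q + (b - a) * (a * C\<^sup>2 - b * S\<^sup>2)) / Q"
      using Q by (simp add: field_simps)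
    also have "Q + (b - a) * (a * C\<^sup>2 - b * S\<^sup>2) = a * b"
      using cs unfolding Q_def by algebra
    finally show ?thesis .
  qed
  ultimately show ?thesis by (simp add: Q_def C_def S_def)
qed

lemma has_integral_inverse_cos_sin:
  fixes a b :: real
  assumes "a > 0" "b > 0"
  shows "((\<lambda>t. 1 / (a\<^sup>2 * (cos t)\<^sup>2 + b\<^sup>2 * (sin t)\<^sup>2)) has_integral pi / (2 * a * b)) {0..pi / 2}"
proof -
  define F where "F t = t + arctan ((b - a) * sin t * cos t / (a * (cos t)\<^sup>2 + b * (sin t)\<^sup>2))" for t
  have "((\<lambda>t. a * b / (a\<^sup>2 * (cos t)\<^sup>2 + b\<^sup>2 * (sin t)\<^sup>2)) has_integral F (pi / 2) - F 0) {0..pi / 2}"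
  proof (rule fundamental_theorem_of_calculus)
    fix t
    show "(F has_vector_derivative a * b / (a\<^sup>2 * (cos t)\<^sup>2 + b\<^sup>2 * (sin t)\<^sup>2)) (at t within {0..pi / 2})"
      unfolding has_real_derivative_iff_has_vector_derivative[symmetric] F_def
      by (rule has_field_derivative_at_within[OF DERIV_arctan_scaled_tan[OF assms]])
  qed simp
  note has_integral_mult_right[OF this, of "1 / (a * b)"]
  moreover have "1 / (a * b) * (F (pi / 2) - F 0) = pi / (2 * a * b)"
    by (simp add: F_def)
  moreover have "1 / (a * b) * (a * b / x) = 1 / x" for x :: real
    using assms by simp
  ultimately show ?thesis by (simp only:)
qed

text \<open>The numerator is affine in the denominator Q, as Q - b^2 = (a^2 - b^2) cos^2, which
  reduces the integral to that of 1 / Q. For a = b this degenerates and the denominator is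
  constant.\<close>

lemma has_integral_cos2_div_cos_sin:
  fixes a b :: real
  assumes "a > 0" "b > 0"
  shows "((\<lambda>t. (cos t)\<^sup>2 / (a\<^sup>2 * (cos t)\<^sup>2 + b\<^sup>2 * (sin t)\<^sup>2)) has_integral pi / (2 * a * (a + b))) {0..pi / 2}"
proof (cases "a = b")
  case True
  have "((\<lambda>t. (cos t)\<^sup>2) has_integral (pi / 2 + sin (pi / 2) * cos (pi / 2)) / 2 - (0 + sin 0 * cos 0) / 2) {0..pi / 2}"
    by (rule fundamental_theorem_of_calculus)
      (auto simp flip: has_real_derivative_iff_has_vector_derivative
        intro!: derivative_eq_intros simp: sin_squared_eq power2_eq_square[symmetric])
  from has_integral_mult_right[OF this, of "1 / a\<^sup>2"] have
    "((\<lambda>t. (cos t)\<^sup>2 / a\<^sup>2) has_integral pi / (2 * a * (a + b))) {0..pi / 2}"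
    using assms by (simp add: True field_simps power2_eq_square)
  moreover have "a\<^sup>2 * (cos t)\<^sup>2 + b\<^sup>2 * (sin t)\<^sup>2 = a\<^sup>2" for t
    using True by (simp flip: distrib_left)
  ultimately show ?thesis by simp
next
  case False
  then have ab: "a\<^sup>2 \<noteq> b\<^sup>2" using assms by (simp add: power2_eq_iff)
  have "((\<lambda>t. 1 / (a\<^sup>2 - b\<^sup>2) * (1 - b\<^sup>2 * (1 / (a\<^sup>2 * (cos t)\<^sup>2 + b\<^sup>2 * (sin t)\<^sup>2)))) has_integral
     1 / (a\<^sup>2 - b\<^sup>2) * ((pi / 2 - 0) *\<^sub>R 1 - b\<^sup>2 * (pi / (2 * a * b)))) {0..pi / 2}"
    using has_integral_const_real[of "1::real" 0 "pi / 2"]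
    by (intro has_integral_mult_right has_integral_diff has_integral_inverse_cos_sin assms) simp
  moreover have "1 / (a\<^sup>2 - b\<^sup>2) * ((pi / 2 - 0) *\<^sub>R 1 - b\<^sup>2 * (pi / (2 * a * b))) = pi / (2 * a * (a + b))"
  proof -
    have "(pi / 2 - 0) *\<^sub>R 1 - b\<^sup>2 * (pi / (2 * a * b)) = (a - b) * (pi / (2 * a))"
      using assms by (simp add: field_simps power2_eq_square)
    moreover have "a\<^sup>2 - b\<^sup>2 = (a - b) * (a + b)" by (simp add: power2_eq_square algebra_simps)
    ultimately show ?thesis using assms False by simp
  qed
  moreover have "1 / (a\<^sup>2 - b\<^sup>2) * (1 - b\<^sup>2 * (1 / (a\<^sup>2 * (cos t)\<^sup>2 + b\<^sup>2 * (sin t)\<^sup>2))) =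
     (cos t)\<^sup>2 / (a\<^sup>2 * (cos t)\<^sup>2 + b\<^sup>2 * (sin t)\<^sup>2)" for t
  proof -
    define Q where "Q = a\<^sup>2 * (cos t)\<^sup>2 + b\<^sup>2 * (sin t)\<^sup>2"
    have "Q > 0" unfolding Q_def using assms by (intro weighted_cos_sin_pos) auto
    moreover have "Q - b\<^sup>2 = (a\<^sup>2 - b\<^sup>2) * (cos t)\<^sup>2"
      unfolding Q_def by (simp add: sin_squared_eq algebra_simps)
    moreover have "1 / (a\<^sup>2 - b\<^sup>2) * (1 - b\<^sup>2 * (1 / Q)) = (Q - b\<^sup>2) / ((a\<^sup>2 - b\<^sup>2) * Q)"
      using \<open>Q > 0\<close> by (simp add: diff_divide_distrib)
    ultimately show ?thesis
      unfolding Q_def[symmetric] using ab by simp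
  qed
  ultimately show ?thesis by simp
qed

text \<open>Differentiation in \<open>a\<close> under the integral gives pi / (a + b) by the
  preceding cosine integral. The constant of integration is read off at a = b, where the integrand
  is constant.\<close>

lemma has_integral_ln_cos_sin:
  fixes a b :: real
  assumes "a > 0" "b > 0"
  shows "((\<lambda>t. ln (a\<^sup>2 * (cos t)\<^sup>2 + b\<^sup>2 * (sin t)\<^sup>2)) has_integral pi * ln ((a + b) / 2)) {0..pi / 2}"
proof -
  define J where "J a = integral {0..pi / 2} (\<lambda>t. ln (a\<^sup>2 * (cos t)\<^sup>2 + b\<^sup>2 * (sin t)\<^sup>2))" for a
  note pos = weighted_cos_sin_pos[of "x\<^sup>2" "b\<^sup>2" for x]
  have intg: "(\<lambda>t. ln (x\<^sup>2 * (cos t)\<^sup>2 + b\<^sup>2 * (sin t)\<^sup>2)) integrable_on {0..pi / 2}" if "x > 0" for x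
    using pos[of x] that assms
    by (intro integrable_continuous_real continuous_intros) (auto simp: less_imp_neq[symmetric])
  have J': "(J has_real_derivative pi / (x + b)) (at x within {0<..})" if "x > 0" for x
  proof -
    have "(J has_real_derivative integral (cbox 0 (pi / 2))
       (\<lambda>t. 2 * x * (cos t)\<^sup>2 / (x\<^sup>2 * (cos t)\<^sup>2 + b\<^sup>2 * (sin t)\<^sup>2))) (at x within {0<..})"
      unfolding J_def[abs_def] box_real(2)[symmetric]
    proof (rule leibniz_rule_field_derivative)
      fix y t :: real assume "y \<in> {0<..}"
      then have "y\<^sup>2 * (cos t)\<^sup>2 + b\<^sup>2 * (sin t)\<^sup>2 > 0" using pos[of y t] assms by simp
      then show "((\<lambda>x. ln (x\<^sup>2 * (cos t)\<^sup>2 + b\<^sup>2 * (sin t)\<^sup>2)) has_real_derivative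
          2 * y * (cos t)\<^sup>2 / (y\<^sup>2 * (cos t)\<^sup>2 + b\<^sup>2 * (sin t)\<^sup>2)) (at y within {0<..})"
        by (auto intro!: derivative_eq_intros simp: field_simps)
    next
      show "continuous_on ({0<..} \<times> cbox 0 (pi / 2))
         (\<lambda>(x, t). 2 * x * (cos t)\<^sup>2 / (x\<^sup>2 * (cos t)\<^sup>2 + b\<^sup>2 * (sin t)\<^sup>2))"
        unfolding case_prod_beta using pos assms
        by (intro continuous_intros) (auto simp: less_imp_neq[symmetric])
    qed (use that intg in auto)
    also have "integral (cbox 0 (pi / 2)) (\<lambda>t. 2 * x * (cos t)\<^sup>2 / (x\<^sup>2 * (cos t)\<^sup>2 + b\<^sup>2 * (sin t)\<^sup>2))
       = pi / (x + b)"
      using integral_unique[OF has_integral_mult_right[OF has_integral_cos2_div_cos_sin[of x b], of "2 * x"]]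
        that assms by (simp add: mult.assoc)
    finally show ?thesis .
  qed
  have "\<exists>K. \<forall>x\<in>{0<..}. J x - pi * ln ((x + b) / 2) = K"
  proof (rule has_field_derivative_zero_constant)
    fix x :: real assume x: "x \<in> {0<..}"
    have "((\<lambda>x. J x - pi * ln ((x + b) / 2)) has_real_derivative pi / (x + b) - pi * (1 / (x + b))) (at x within {0<..})"
      using x assms by (intro DERIV_diff J' DERIV_cmult) (auto intro!: derivative_eq_intros simp: divide_simps)
    then show "((\<lambda>x. J x - pi * ln ((x + b) / 2)) has_real_derivative 0) (at x within {0<..})" by simp
  qed auto
  then have "J a - pi * ln ((a + b) / 2) = J b - pi * ln ((b + b) / 2)"
    using assms by (metis greaterThan_iff)
  moreover have "J b = pi * ln b"
  proof -
    have "b\<^sup>2 * (cos t)\<^sup>2 + b\<^sup>2 * (sin t)\<^sup>2 = b\<^sup>2" for t :: real by (simp flip: distrib_left)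
    then show ?thesis using assms by (simp add: J_def ln_realpow)
  qed
  ultimately show ?thesis using intg[of a] assms by (simp add: has_integral_integral J_def)
qed

lemma lborel_Icc_integral_continuous:
  fixes f :: "real \<Rightarrow> real"
  assumes "continuous_on {a..b} f" "(f has_integral I) {a..b}"
  shows "integrable (lborel_Icc a b) f" "(\<integral>x. f x \<partial>lborel_Icc a b) = I"
proof -
  show *: "integrable (lborel_Icc a b) f"
    using borel_integrable_atLeastAtMost'[OF assms(1)] by (simp add: integrable_lborel_Icc_iff)
  show "(\<integral>x. f x \<partial>lborel_Icc a b) = I" by (rule integral_lborel_Icc_eq[OF * assms(2)])
qed

section \<open>The log-sine integral and the logarithm of an indefinite form\<close>

lemma sin_ge_half:
  fixes t :: real
  assumes "0 \<le> t" "t \<le> pi / 2"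
  shows "t / 2 \<le> sin t"
proof (cases "t = 0")
  case False
  then have "0 < t / 2" using assms by simp
  \<comment> \<open>The mean value theorem gives sin (t/2) \<ge> (t/2) cos (t/2); multiplied by 2
    cos (t/2) this becomes sin t \<ge> (t/2) (1 + cos t).\<close>
  then obtain z where z: "0 < z" "z < t / 2" "sin (t / 2) - sin 0 = (t / 2 - 0) * cos z"
    using MVT2[of 0 "t / 2" sin cos] by (auto intro!: derivative_eq_intros)
  have "cos (t / 2) \<le> cos z" using z assms by (intro cos_monotone_0_pi_le) auto
  then have s: "t / 2 * cos (t / 2) \<le> sin (t / 2)" using z assms by (simp add: mult_left_mono)
  have c: "cos (t / 2) \<ge> 0" using assms by (intro cos_ge_zero) auto
  have "t / 2 \<le> t / 2 * (1 + cos t)"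
    using assms cos_ge_zero[of t] by (simp add: mult_le_cancel_left1)
  also have "\<dots> = 2 * (t / 2 * cos (t / 2)) * cos (t / 2)"
    using cos_double_cos[of "t / 2"] by (simp add: power2_eq_square algebra_simps)
  also have "\<dots> \<le> 2 * sin (t / 2) * cos (t / 2)" using s c by (intro mult_right_mono) auto
  also have "\<dots> = sin t" using sin_double[of "t / 2"] by simp
  finally show ?thesis .
qed simp

lemma has_integral_shift_Icc:
  fixes f :: "real \<Rightarrow> real"
  assumes "(f has_integral i) {a..b}"
  shows "((\<lambda>x. f (x + c)) has_integral i) {a - c..b - c}"
  using has_integral_affinity[of f i a b 1 c] assms by (simp add: image_add_atLeastAtMost' diff_conv_add_uminus del: add_uminus_conv_diff)

lemma has_integral_reflect_Icc:
  fixes f :: "real \<Rightarrow> real"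
  assumes "(f has_integral i) {a..b}"
  shows "((\<lambda>x. f (c - x)) has_integral i) {c - b..c - a}"
proof -
  have "((\<lambda>x. f (- x)) has_integral i) {- b..- a}" using assms by simp
  from has_integral_shift_Icc[OF this, of "- c"] show ?thesis by simp
qed

lemma integrable_on_ln_abs_sin: "(\<lambda>t. ln \<bar>sin t\<bar>) integrable_on {0..pi / 2}"
proof -
  \<comment> \<open>Since t / 2 \<le> sin t, the function ln 2 - ln t dominates the absolute value
    of ln (sin t).\<close>
  have "integrable (lborel_Icc 0 (pi / 2)) (\<lambda>t. ln 2 - ln \<bar>0 - t\<bar>)"
    by (intro Bochner_Integration.integrable_diff ln_abs_diff_integral
        integrable_lborel_Icc_bounded[of _ _ _ "ln 2"]) auto
  then have "integrable (lborel_Icc 0 (pi / 2)) (\<lambda>t. ln \<bar>sin t\<bar>)"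
  proof (rule Bochner_Integration.integrable_bound)
    show "AE t in lborel_Icc 0 (pi / 2). norm (ln \<bar>sin t\<bar>) \<le> norm (ln 2 - ln \<bar>0 - t\<bar>)"
    proof (rule AE_I2)
      fix t :: real assume "t \<in> space (lborel_Icc 0 (pi / 2))"
      then have t: "0 \<le> t" "t \<le> pi / 2" by auto
      show "norm (ln \<bar>sin t\<bar>) \<le> norm (ln 2 - ln \<bar>0 - t\<bar>)"
      proof (cases "t = 0")
        case False
        then have "t / 2 > 0" using t by simp
        moreover from this have "ln (t / 2) \<le> ln (sin t)" using sin_ge_half[OF t] by (subst ln_le_cancel_iff) auto
        moreover have "ln (sin t) \<le> 0" using sin_ge_half[OF t] \<open>t / 2 > 0\<close> by simp
        moreover have "ln (t / 2) = ln t - ln 2" using \<open>t / 2 > 0\<close> by (simp add: ln_div)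
        moreover have "\<bar>sin t\<bar> = sin t" using sin_ge_half[OF t] \<open>t / 2 > 0\<close> by simp
        ultimately show ?thesis by simp
      qed simp
    qed
  qed simp
  then show ?thesis using has_integral_lborel_Icc has_integral_integrable by blast
qed

text \<open>The integrand has period pi and is symmetric about pi / 2, so a window of length pi has
  twice the integral over a quarter, wherever it is placed.\<close>

lemma has_integral_ln_abs_sin_Icc:
  assumes "0 \<le> x" "x \<le> pi / 2"
  defines "I \<equiv> integral {0..pi / 2} (\<lambda>t. ln \<bar>sin t\<bar>)"
  shows "((\<lambda>t. ln \<bar>sin t\<bar>) has_integral 2 * I) {x - pi / 2..x + pi / 2}"
proof -
  let ?f = "\<lambda>t::real. ln \<bar>sin t\<bar>"
  have f0: "(?f has_integral I) {0..pi / 2}"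
    unfolding I_def by (rule integrable_integral[OF integrable_on_ln_abs_sin])
  have f1: "(?f has_integral I) {pi / 2..pi}"
    using has_integral_reflect_Icc[OF f0, of pi] by simp
  have f2: "(?f has_integral 2 * I) {0..pi}"
    using has_integral_combine[OF _ _ f0 f1] by simp
  have "?f integrable_on {0..x + pi / 2}" "?f integrable_on {x + pi / 2..pi}"
    using f2 assms by (auto intro: integrable_on_subinterval[OF has_integral_integrable[OF f2]])
  then obtain u v where u: "(?f has_integral u) {0..x + pi / 2}" and v: "(?f has_integral v) {x + pi / 2..pi}"
    by (auto simp: integrable_on_def)
  have "2 * I = u + v"
    using has_integral_unique[OF f2 has_integral_combine[OF _ _ u v]] assms by simp
  moreover have "(?f has_integral v) {x - pi / 2..0}"
    using has_integral_shift_Icc[OF v, of pi] by (simp add: field_simps)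
  then have "(?f has_integral (v + u)) {x - pi / 2..x + pi / 2}"
    using has_integral_combine[OF _ _ _ u, of "x - pi / 2"] assms by simp
  ultimately show ?thesis by (simp add: add.commute)
qed

text \<open>With \<open>(a, b) = r (sin \<omega>, cos \<omega>)\<close> the argument factors as
  \<open>r\<^sup>2 sin (\<omega> + t) sin (\<omega> - t)\<close>, and the two factors together run through one period of
  \<open>ln \<bar>sin\<bar>\<close>.\<close>

lemma has_integral_ln_abs_cos_sin_aux:
  fixes a b :: real
  assumes "a > 0" "b > 0"
  defines "I \<equiv> integral {0..pi / 2} (\<lambda>t. ln \<bar>sin t\<bar>)"
  shows "((\<lambda>t. ln \<bar>a\<^sup>2 * (cos t)\<^sup>2 - b\<^sup>2 * (sin t)\<^sup>2\<bar>) has_integral pi / 2 * ln (a\<^sup>2 + b\<^sup>2) + 2 * I) {0..pi / 2}"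
proof -
  define r where "r = sqrt (a\<^sup>2 + b\<^sup>2)"
  have r2: "r\<^sup>2 = a\<^sup>2 + b\<^sup>2" and r: "r > 0" using assms by (auto simp: r_def intro: add_pos_pos)
  define \<omega> where "\<omega> = arctan (a / b)"
  have \<omega>: "0 < \<omega>" "\<omega> < pi / 2" using assms arctan_ubound by (auto simp: \<omega>_def)
  have sq: "sqrt (1 + (a / b)\<^sup>2) = r / b"
  proof -
    have "1 + (a / b)\<^sup>2 = (a\<^sup>2 + b\<^sup>2) / b\<^sup>2" using assms by (simp add: field_simps)
    then show ?thesis using assms by (simp add: r_def real_sqrt_divide)
  qed
  have a: "a = r * sin \<omega>" and b: "b = r * cos \<omega>"
    unfolding \<omega>_def sin_arctan cos_arctan sq using assms r by auto
  let ?f = "\<lambda>t::real. ln \<bar>sin t\<bar>"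
  have "(?f has_integral 2 * I) {\<omega> - pi / 2..\<omega> + pi / 2}"
    unfolding I_def using has_integral_ln_abs_sin_Icc[of \<omega>] \<omega> by simp
  moreover have "?f integrable_on {\<omega> - pi / 2..\<omega>}" "?f integrable_on {\<omega>..\<omega> + pi / 2}"
    using calculation by (auto intro: integrable_on_subinterval)
  then obtain u v where u: "(?f has_integral u) {\<omega> - pi / 2..\<omega>}" and v: "(?f has_integral v) {\<omega>..\<omega> + pi / 2}"
    by (auto simp: integrable_on_def)
  ultimately have uv: "u + v = 2 * I"
    using has_integral_unique[OF _ has_integral_combine[OF _ _ u v]] by simp
  have "((\<lambda>t. ?f (\<omega> - t)) has_integral u) {0..pi / 2}"
    using has_integral_reflect_Icc[OF u, of \<omega>] by simp
  moreover have "((\<lambda>t. ?f (t + \<omega>)) has_integral v) {0..pi / 2}"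
    using has_integral_shift_Icc[OF v, of \<omega>] by simp
  moreover have "((\<lambda>t. ln (r\<^sup>2)) has_integral pi / 2 * ln (r\<^sup>2)) {0..pi / 2}"
    using has_integral_const_real[of "ln (r\<^sup>2)" 0 "pi / 2"] by simp
  ultimately have "((\<lambda>t. ln (r\<^sup>2) + (?f (\<omega> - t) + ?f (t + \<omega>))) has_integral pi / 2 * ln (r\<^sup>2) + (u + v)) {0..pi / 2}"
    by (intro has_integral_add)
  then have "((\<lambda>t. ln \<bar>a\<^sup>2 * (cos t)\<^sup>2 - b\<^sup>2 * (sin t)\<^sup>2\<bar>) has_integral pi / 2 * ln (r\<^sup>2) + (u + v)) {0..pi / 2}"
  \<comment> \<open>At t = \<omega> the factor sin (\<omega> - t) vanishes and, with
    \<open>ln 0 = 0\<close>, the logarithm of the product need not be the sum of the logarithms;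
    this single point is dropped.\<close>
  proof (rule has_integral_spike_finite[of "{\<omega>}", rotated 2])
    fix t assume t: "t \<in> {0..pi / 2} - {\<omega>}"
    have "sin (t + \<omega>) > 0" using t \<omega> by (intro sin_gt_zero) auto
    moreover have "sin (\<omega> - t) \<noteq> 0"
    proof (cases "t < \<omega>")
      case True
      then show ?thesis using t \<omega> sin_gt_zero[of "\<omega> - t"] by simp
    next
      case False
      then show ?thesis using t \<omega> sin_gt_zero[of "t - \<omega>"] sin_minus[of "\<omega> - t"] by simp
    qed
    moreover have "a\<^sup>2 * (cos t)\<^sup>2 - b\<^sup>2 * (sin t)\<^sup>2 = r\<^sup>2 * (sin (\<omega> - t) * sin (t + \<omega>))"
      unfolding a b sin_diff sin_add by (simp add: power2_eq_square algebra_simps)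
    ultimately show "ln \<bar>a\<^sup>2 * (cos t)\<^sup>2 - b\<^sup>2 * (sin t)\<^sup>2\<bar> = ln (r\<^sup>2) + (?f (\<omega> - t) + ?f (t + \<omega>))"
      using r by (simp add: abs_mult ln_mult)
  qed simp
  then show ?thesis by (simp add: uv r2)
qed

text \<open>For a = b = 1 the previous lemma integrates the logarithm of |cos (2 t)|, and the
  substitution u = 2 t - pi / 2 shows that this is the unknown integral I again. Hence I = pi / 2 *
  ln 2 + 2 I.\<close>

lemma integral_ln_abs_sin: "integral {0..pi / 2} (\<lambda>t. ln \<bar>sin t\<bar>) = - (pi / 2 * ln 2)"
proof -
  let ?f = "\<lambda>t::real. ln \<bar>sin t\<bar>" and ?I = "integral {0..pi / 2} (\<lambda>t. ln \<bar>sin t\<bar>)"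
  have "((\<lambda>t. ?f (2 * t + (- pi / 2))) has_integral ?I) {0..pi / 2}"
  proof -
    have "(?f has_integral 2 * ?I) (cbox (- pi / 2) (pi / 2))"
      using has_integral_ln_abs_sin_Icc[of 0] by simp
    from has_integral_affinity[OF this, of 2 "- pi / 2"]
    have "((\<lambda>t. ?f (2 * t + (- pi / 2))) has_integral ?I) ((\<lambda>x. 1 / 2 * x + pi / 4) ` {- pi / 2..pi / 2})"
      by simp
    also have "(\<lambda>x. 1 / 2 * x + pi / 4) ` {- pi / 2..pi / 2} = {0..pi / 2}"
      using image_affinity_atLeastAtMost[of "1 / 2" "pi / 4" "- pi / 2" "pi / 2"] by simp
    finally show ?thesis .
  qed
  moreover have "?f (2 * t + (- pi / 2)) = ln \<bar>1\<^sup>2 * (cos t)\<^sup>2 - 1\<^sup>2 * (sin t)\<^sup>2\<bar>" for t :: real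
    using sin_cos_eq[of "2 * t"] cos_double[of t] abs_minus_commute[of "(sin t)\<^sup>2" "(cos t)\<^sup>2"]
    by (simp add: sin_diff)
  ultimately have "((\<lambda>t. ln \<bar>1\<^sup>2 * (cos t)\<^sup>2 - 1\<^sup>2 * (sin t)\<^sup>2\<bar>) has_integral ?I) {0..pi / 2}"
    by simp
  from has_integral_unique[OF this has_integral_ln_abs_cos_sin_aux[of 1 1]]
  show ?thesis by simp
qed

lemma has_integral_ln_abs_cos_sin:
  fixes a b :: real
  assumes "a > 0" "b > 0"
  shows "((\<lambda>t. ln \<bar>a\<^sup>2 * (cos t)\<^sup>2 - b\<^sup>2 * (sin t)\<^sup>2\<bar>) has_integral pi / 2 * ln ((a\<^sup>2 + b\<^sup>2) / 4)) {0..pi / 2}"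
proof -
  have pos: "a\<^sup>2 + b\<^sup>2 > 0" using assms by (intro add_pos_pos) auto
  have "ln ((a\<^sup>2 + b\<^sup>2) / 4) = ln (a\<^sup>2 + b\<^sup>2) - ln 4"
    using pos by (simp add: ln_divide_pos)
  also have "ln (4::real) = 2 * ln 2" using ln_realpow[of 2 2] by simp
  finally have *: "pi / 2 * ln ((a\<^sup>2 + b\<^sup>2) / 4) = pi / 2 * ln (a\<^sup>2 + b\<^sup>2) + 2 * (- (pi / 2 * ln 2))"
    by (simp add: right_diff_distrib)
  show ?thesis using has_integral_ln_abs_cos_sin_aux[OF assms] by (simp only: * integral_ln_abs_sin)
qed

section \<open>Quarter-period integrals as Lebesgue integrals\<close>

abbreviation quarter :: "real measure" where
  "quarter \<equiv> lborel_Icc 0 (pi / 2)"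

lemma quarter_ln_cos_sin_sum:
  fixes a b :: real
  assumes "a > 0" "b > 0"
  shows "integrable quarter (\<lambda>t. ln (a * (cos t)\<^sup>2 + b * (sin t)\<^sup>2))"
    and "(\<integral>t. ln (a * (cos t)\<^sup>2 + b * (sin t)\<^sup>2) \<partial>quarter) = pi * ln ((sqrt a + sqrt b) / 2)"
proof -
  have "continuous_on {0..pi / 2} (\<lambda>t. ln (a * (cos t)\<^sup>2 + b * (sin t)\<^sup>2))"
    using weighted_cos_sin_pos[OF assms] by (intro continuous_intros) (auto simp: less_imp_neq[symmetric])
  moreover have "((\<lambda>t. ln (a * (cos t)\<^sup>2 + b * (sin t)\<^sup>2)) has_integral pi * ln ((sqrt a + sqrt b) / 2)) {0..pi / 2}"
    using has_integral_ln_cos_sin[of "sqrt a" "sqrt b"] assms by simp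
  ultimately show "integrable quarter (\<lambda>t. ln (a * (cos t)\<^sup>2 + b * (sin t)\<^sup>2))"
    and "(\<integral>t. ln (a * (cos t)\<^sup>2 + b * (sin t)\<^sup>2) \<partial>quarter) = pi * ln ((sqrt a + sqrt b) / 2)"
    by (fact lborel_Icc_integral_continuous)+
qed

lemma quarter_ln_cos_sin_diff:
  fixes a b :: real
  assumes "a > 0" "b > 0"
  shows "integrable quarter (\<lambda>t. ln \<bar>a * (cos t)\<^sup>2 - b * (sin t)\<^sup>2\<bar>)"
    and "(\<integral>t. ln \<bar>a * (cos t)\<^sup>2 - b * (sin t)\<^sup>2\<bar> \<partial>quarter) = pi / 2 * ln ((a + b) / 4)"
proof -
  have *: "((\<lambda>t. ln \<bar>a * (cos t)\<^sup>2 - b * (sin t)\<^sup>2\<bar>) has_integral pi / 2 * ln ((a + b) / 4)) {0..pi / 2}"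
    using has_integral_ln_abs_cos_sin[of "sqrt a" "sqrt b"] assms by simp
  have bnd: "ln \<bar>a * (cos t)\<^sup>2 - b * (sin t)\<^sup>2\<bar> \<le> a + b" for t :: real
  proof (cases "a * (cos t)\<^sup>2 - b * (sin t)\<^sup>2 = 0")
    case True
    then show ?thesis using assms by (simp only:) simp
  next
    case False
    have "a * (cos t)\<^sup>2 \<le> a * 1" "b * (sin t)\<^sup>2 \<le> b * 1"
      using assms by (intro mult_left_mono; simp add: abs_square_le_1)+
    moreover have "0 \<le> a * (cos t)\<^sup>2" "0 \<le> b * (sin t)\<^sup>2" using assms by auto
    ultimately have "\<bar>a * (cos t)\<^sup>2 - b * (sin t)\<^sup>2\<bar> \<le> a + b" by linarith
    then show ?thesis using ln_le_minus_one[of "\<bar>a * (cos t)\<^sup>2 - b * (sin t)\<^sup>2\<bar>"] False by linarith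
  qed
  show "integrable quarter (\<lambda>t. ln \<bar>a * (cos t)\<^sup>2 - b * (sin t)\<^sup>2\<bar>)"
    by (rule lborel_Icc_has_integral_bounded_above(1)[OF _ * bnd]) measurable
  show "(\<integral>t. ln \<bar>a * (cos t)\<^sup>2 - b * (sin t)\<^sup>2\<bar> \<partial>quarter) = pi / 2 * ln ((a + b) / 4)"
    by (rule lborel_Icc_has_integral_bounded_above(2)[OF _ * bnd]) measurable
qed

lemma quarter_ln_cos2:
  "integrable quarter (\<lambda>t. ln ((cos t)\<^sup>2))" "(\<integral>t. ln ((cos t)\<^sup>2) \<partial>quarter) = - (pi * ln 2)"
proof -
  have "((\<lambda>t. ln \<bar>sin t\<bar>) has_integral - (pi / 2 * ln 2)) {0..pi / 2}"
    using integrable_integral[OF integrable_on_ln_abs_sin] by (simp add: integral_ln_abs_sin)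
  from has_integral_mult_right[OF has_integral_reflect_Icc[OF this, of "pi / 2"], of 2]
  have *: "((\<lambda>t. ln ((cos t)\<^sup>2)) has_integral - (pi * ln 2)) {0..pi / 2}"
    by (simp add: sin_diff ln_abs_eq)
  have bnd: "ln ((cos t)\<^sup>2) \<le> 0" for t :: real
    by (cases "cos t = 0") (simp_all add: abs_square_le_1)
  show "integrable quarter (\<lambda>t. ln ((cos t)\<^sup>2))"
    by (rule lborel_Icc_has_integral_bounded_above(1)[OF _ * bnd]) measurable
  show "(\<integral>t. ln ((cos t)\<^sup>2) \<partial>quarter) = - (pi * ln 2)"
    by (rule lborel_Icc_has_integral_bounded_above(2)[OF _ * bnd]) measurable
qed

lemma quarter_cos2_weight:
  fixes k :: real
  assumes "k > 0"
  defines "v \<equiv> \<lambda>t. (cos t)\<^sup>2 / ((cos t)\<^sup>2 + k\<^sup>2 * (sin t)\<^sup>2)"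
  shows "(\<integral>t. v t \<partial>quarter) = pi / 2 / (1 + k)"
proof (rule lborel_Icc_integral_continuous)
  have pos: "(cos t)\<^sup>2 + k\<^sup>2 * (sin t)\<^sup>2 > 0" for t :: real
    using weighted_cos_sin_pos[of 1 "k\<^sup>2" t] assms by simp
  show "continuous_on {0..pi / 2} v"
    unfolding v_def using pos by (intro continuous_intros) (auto simp: less_imp_neq[symmetric])
  show "(v has_integral pi / 2 / (1 + k)) {0..pi / 2}"
    unfolding v_def using has_integral_cos2_div_cos_sin[of 1 k] assms by (simp add: mult.commute)
qed

text \<open>The substitution \<open>tan \<phi> = k tan t\<close> turns \<open>(cos t)\<^sup>2 / Q t\<close> into \<open>(cos \<phi>)\<^sup>2\<close>.\<close>

lemma quarter_ln_weight_div:
  fixes k :: real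
  assumes "k > 0"
  defines "Q \<equiv> \<lambda>t. (cos t)\<^sup>2 + k\<^sup>2 * (sin t)\<^sup>2"
  shows "integrable quarter (\<lambda>t. ln ((cos t)\<^sup>2 / Q t) * (k / Q t))"
    and "(\<integral>t. ln ((cos t)\<^sup>2 / Q t) * (k / Q t) \<partial>quarter) = - (pi * ln 2)"
proof -
  define q where "q t = (k - 1) * sin t * cos t / ((cos t)\<^sup>2 + k * (sin t)\<^sup>2)" for t
  \<comment> \<open>This is the substituted angle, in the form that stays smooth at pi / 2; it maps
    the quarter period onto itself.\<close>
  define g where "g t = t + arctan (q t)" for t
  have Q: "Q t > 0" for t
    using weighted_cos_sin_pos[of 1 "k\<^sup>2" t] assms by simp
  have g': "(g has_real_derivative k / Q t) (at t)" for t
    using DERIV_arctan_scaled_tan[of 1 k t] assms by (simp add: g_def[abs_def] q_def Q_def)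
  have cos_g: "(cos (g t))\<^sup>2 = (cos t)\<^sup>2 / Q t" for t
  proof -
    define N where "N = (cos t)\<^sup>2 + k * (sin t)\<^sup>2"
    have N: "N > 0" using weighted_cos_sin_pos[of 1 k t] assms by (simp add: N_def)
    have "N\<^sup>2 + ((k - 1) * sin t * cos t)\<^sup>2 = Q t * ((cos t)\<^sup>2 + (sin t)\<^sup>2)"
      unfolding N_def Q_def by algebra
    then have NQ: "N\<^sup>2 + ((k - 1) * sin t * cos t)\<^sup>2 = Q t" by simp
    have "1 + (q t)\<^sup>2 = (N\<^sup>2 + ((k - 1) * sin t * cos t)\<^sup>2) / N\<^sup>2"
      using N unfolding q_def N_def[symmetric] by (simp add: power_divide add_divide_distrib)
    then have q2: "1 + (q t)\<^sup>2 = Q t / N\<^sup>2" by (simp only: NQ)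
    have "cos (g t) = (cos t - sin t * q t) / sqrt (1 + (q t)\<^sup>2)"
      by (simp add: g_def cos_add cos_arctan sin_arctan diff_divide_distrib)
    also have "cos t - sin t * q t = (N - (k - 1) * (sin t)\<^sup>2) * cos t / N"
      using N unfolding q_def N_def[symmetric] by (simp add: field_simps power2_eq_square)
    also have "N - (k - 1) * (sin t)\<^sup>2 = 1"
      using sin_cos_squared_add[of t] by (simp add: N_def algebra_simps)
    finally have "cos (g t) = cos t / N / sqrt (1 + (q t)\<^sup>2)" by simp
    moreover have "1 + (q t)\<^sup>2 > 0" by (simp add: add_pos_nonneg)
    ultimately have "(cos (g t))\<^sup>2 = (cos t)\<^sup>2 / N\<^sup>2 / (1 + (q t)\<^sup>2)"
      by (simp add: power_divide power_mult_distrib)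
    then show ?thesis unfolding q2 using N Q by simp
  qed
  have g0: "g 0 = 0" "g (pi / 2) = pi / 2" by (simp_all add: g_def q_def)
  have "set_integrable lborel {g 0..g (pi / 2)} (\<lambda>t. ln ((cos t)\<^sup>2))"
    using quarter_ln_cos2(1) by (simp add: integrable_lborel_Icc_iff g0)
  note sub = integral_substitution[OF this g']
  have cont: "continuous_on {0..pi / 2} (\<lambda>t. k / Q t)"
    using Q unfolding Q_def by (intro continuous_intros) (auto simp: less_imp_neq[symmetric])
  show "integrable quarter (\<lambda>t. ln ((cos t)\<^sup>2 / Q t) * (k / Q t))"
    using sub(1)[OF cont] Q assms by (simp add: integrable_lborel_Icc_iff cos_g less_imp_le)
  have "(LINT x|lborel. ln ((cos x)\<^sup>2) * indicator {g 0..g (pi / 2)} x) =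
     (LINT x|lborel. ln ((cos (g x))\<^sup>2) * (k / Q x) * indicator {0..pi / 2} x)"
    using sub(2)[OF cont] Q assms by (simp add: less_imp_le)
  then show "(\<integral>t. ln ((cos t)\<^sup>2 / Q t) * (k / Q t) \<partial>quarter) = - (pi * ln 2)"
    using quarter_ln_cos2(2)
    by (simp add: integral_lborel_Icc set_lebesgue_integral_def cos_g g0 mult.commute)
qed

text \<open>With Q the denominator of v, Q - k^2 = (1 - k^2) cos^2 gives v = (1 - k * (k / Q)) / (1
  - k^2). The integral splits into that of ln v, a difference of known logarithmic integrals, and
  that of ln v * (k / Q), known by substitution. At k = 1 this decomposition breaks down.\<close>

lemma quarter_weight_ln_weight:
  fixes k :: real
  assumes "k > 0" "k \<noteq> 1"
  defines "v \<equiv> \<lambda>t. (cos t)\<^sup>2 / ((cos t)\<^sup>2 + k\<^sup>2 * (sin t)\<^sup>2)"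
  shows "integrable quarter (\<lambda>t. v t * ln (v t))"
    and "(\<integral>t. v t * ln (v t) \<partial>quarter) = pi / 2 * ((2 * k * ln 2 - 2 * ln (1 + k)) / (1 - k\<^sup>2))"
proof -
  define Q where "Q t = (cos t)\<^sup>2 + k\<^sup>2 * (sin t)\<^sup>2" for t
  have Q: "Q t > 0" for t
    using weighted_cos_sin_pos[of 1 "k\<^sup>2" t] assms by (simp add: Q_def)
  have k2: "1 - k\<^sup>2 \<noteq> 0" using assms by (simp add: power2_eq_1_iff)
  have AE_cos: "AE t in quarter. cos t \<noteq> 0"
  proof (rule AE_mp[OF AE_lborel_Icc_not_in_finite[of "{pi / 2}"]], simp, intro AE_I2 impI)
    fix t assume "t \<in> space quarter" "t \<notin> {pi / 2}"
    then show "cos t \<noteq> 0" using cos_gt_zero_pi[of t] by auto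
  qed
  note i1 = quarter_ln_cos2 and i2 = quarter_ln_cos_sin_sum[of 1 "k\<^sup>2", simplified, folded Q_def]
  have "ln ((cos t)\<^sup>2) - ln (Q t) = ln (v t)" if "cos t \<noteq> 0" for t
    using that Q[of t] by (simp add: v_def Q_def ln_divide_pos)
  then have ln_v: "AE t in quarter. ln ((cos t)\<^sup>2) - ln (Q t) = ln (v t)"
    using AE_cos by (auto elim: AE_mp intro: AE_I2)
  have *: "integrable quarter (\<lambda>t. ln (v t))"
    "(\<integral>t. ln (v t) \<partial>quarter) = - (pi * ln 2) - pi * ln ((1 + k) / 2)"
  proof -
    have d: "integrable quarter (\<lambda>t. ln ((cos t)\<^sup>2) - ln (Q t))"
      using i1 i2 assms by (intro Bochner_Integration.integrable_diff) auto
    have "(\<integral>t. ln ((cos t)\<^sup>2) - ln (Q t) \<partial>quarter) = - (pi * ln 2) - pi * ln ((1 + k) / 2)"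
      using i1 i2 assms by (subst Bochner_Integration.integral_diff) auto
    moreover have "(\<integral>t. ln ((cos t)\<^sup>2) - ln (Q t) \<partial>quarter) = (\<integral>t. ln (v t) \<partial>quarter)"
      using ln_v unfolding v_def Q_def by (intro integral_cong_AE) simp_all
    ultimately show "(\<integral>t. ln (v t) \<partial>quarter) = - (pi * ln 2) - pi * ln ((1 + k) / 2)" by simp
    show "integrable quarter (\<lambda>t. ln (v t))"
      using d ln_v unfolding v_def Q_def by (intro integrable_cong_AE_imp[OF d[unfolded Q_def]]) simp_all
  qed
  note w = quarter_ln_weight_div[OF assms(1), folded Q_def]
  have eq: "1 / (1 - k\<^sup>2) * (ln (v t) - k * (ln ((cos t)\<^sup>2 / Q t) * (k / Q t))) = v t * ln (v t)" for t
  proof -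
    have "Q t - k\<^sup>2 = (1 - k\<^sup>2) * (cos t)\<^sup>2"
      unfolding Q_def by (simp add: sin_squared_eq algebra_simps)
    then have "v t = (Q t - k\<^sup>2) / ((1 - k\<^sup>2) * Q t)" using k2 by (simp add: v_def Q_def)
    also have "\<dots> = 1 / (1 - k\<^sup>2) * (1 - k * (k / Q t))"
      using Q[of t] by (simp add: diff_divide_distrib power2_eq_square)
    finally have "v t * ln (v t) = 1 / (1 - k\<^sup>2) * (1 - k * (k / Q t)) * ln (v t)" by simp
    then show ?thesis by (simp add: v_def Q_def algebra_simps)
  qed
  have "integrable quarter (\<lambda>t. 1 / (1 - k\<^sup>2) * (ln (v t) - k * (ln ((cos t)\<^sup>2 / Q t) * (k / Q t))))"
    by (intro integrable_mult_right Bochner_Integration.integrable_diff * w)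
  then show "integrable quarter (\<lambda>t. v t * ln (v t))" by (simp only: eq)
  have "(\<integral>t. 1 / (1 - k\<^sup>2) * (ln (v t) - k * (ln ((cos t)\<^sup>2 / Q t) * (k / Q t))) \<partial>quarter)
      = 1 / (1 - k\<^sup>2) * ((- (pi * ln 2) - pi * ln ((1 + k) / 2)) - k * (- (pi * ln 2)))"
    by (simp only: integral_mult_right_zero Bochner_Integration.integral_diff[OF *(1) integrable_mult_right[OF w(1)]]
        *(2) w(2))
  then have "(\<integral>t. v t * ln (v t) \<partial>quarter)
      = 1 / (1 - k\<^sup>2) * ((- (pi * ln 2) - pi * ln ((1 + k) / 2)) - k * (- (pi * ln 2)))"
    by (simp only: eq)
  also have "ln ((1 + k) / 2) = ln (1 + k) - ln 2" using assms by (intro ln_divide_pos) auto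
  finally show "(\<integral>t. v t * ln (v t) \<partial>quarter) = pi / 2 * ((2 * k * ln 2 - 2 * ln (1 + k)) / (1 - k\<^sup>2))"
    by (simp add: algebra_simps add_divide_distrib diff_divide_distrib)
qed

section \<open>Positivity of the logarithmic energy\<close>

lemma measurable_fst_lborel_Icc [measurable]: "fst \<in> lborel_Icc a b \<Otimes>\<^sub>M N \<rightarrow>\<^sub>M borel"
  by (rule measurable_compose[OF measurable_fst measurable_lborel_Icc[of "\<lambda>x. x"]]) simp

lemma measurable_snd_lborel_Icc [measurable]: "snd \<in> N \<Otimes>\<^sub>M lborel_Icc a b \<rightarrow>\<^sub>M borel"
  by (rule measurable_compose[OF measurable_snd measurable_lborel_Icc[of "\<lambda>x. x"]]) simp

text \<open>The logarithm is at most some constant K on the product, so K - ln is nonnegative and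
  Fubini's criterion asks for its inner integral alone, which \<open>ln_prim\<close> gives
  explicitly and boundedly. The first factor is general so that the lemma serves both the unit
  square and the angle parametrization of the band.\<close>

lemma integrable_ln_abs_diff_pair:
  fixes g :: "'a \<Rightarrow> real"
  assumes "finite_measure N" and [measurable]: "g \<in> borel_measurable N"
    and g: "\<And>w. w \<in> space N \<Longrightarrow> \<bar>g w\<bar> \<le> R" and cd: "c \<le> d"
  shows "integrable (N \<Otimes>\<^sub>M lborel_Icc c d) (\<lambda>(w, y). ln \<bar>g w - y\<bar>)"
proof -
  interpret N: finite_measure N by fact
  interpret L: finite_measure "lborel_Icc c d" by (rule finite_measure_lborel_Icc)
  interpret P: pair_sigma_finite N "lborel_Icc c d" ..
  interpret PF: finite_measure "N \<Otimes>\<^sub>M lborel_Icc c d"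
    by (rule finite_measure_pair_measure) unfold_locales
  define K where "K = R + \<bar>c\<bar> + \<bar>d\<bar>"
  have K: "ln \<bar>g w - y\<bar> \<le> K" if "w \<in> space N" "y \<in> {c..d}" for w y
    using that g[of w] ln_le_minus_one[of "\<bar>g w - y\<bar>"] by (cases "g w = y") (auto simp: K_def)
  have int: "integrable (lborel_Icc c d) (\<lambda>y. K - ln \<bar>x - y\<bar>)" for x
    by (intro Bochner_Integration.integrable_diff ln_abs_diff_integral cd
        integrable_lborel_Icc_bounded[of _ _ _ "\<bar>K\<bar>"]) auto
  have "integrable (N \<Otimes>\<^sub>M lborel_Icc c d) (\<lambda>(w, y). K - ln \<bar>g w - y\<bar>)"
  proof (rule P.Fubini_integrable)
    have bnd: "bounded (ln_prim ` {-(R + \<bar>c\<bar> + \<bar>d\<bar>)..R + \<bar>c\<bar> + \<bar>d\<bar>})"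
      by (intro compact_imp_bounded compact_continuous_image continuous_intros) auto
    then obtain B where "\<forall>u\<in>{-(R + \<bar>c\<bar> + \<bar>d\<bar>)..R + \<bar>c\<bar> + \<bar>d\<bar>}. \<bar>ln_prim u\<bar> \<le> B"
      by (auto simp: bounded_iff)
    then have B: "\<bar>ln_prim u\<bar> \<le> B" if "\<bar>u\<bar> \<le> R + \<bar>c\<bar> + \<bar>d\<bar>" for u
      using that by (auto simp: abs_le_iff)
    have "integrable N (\<lambda>w. K * (d - c) - (ln_prim (g w - c) - ln_prim (g w - d)))"
    proof (rule N.integrable_const_bound[of _ "\<bar>K * (d - c)\<bar> + 2 * B"])
      show "AE w in N. norm (K * (d - c) - (ln_prim (g w - c) - ln_prim (g w - d))) \<le> \<bar>K * (d - c)\<bar> + 2 * B"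
      proof (rule AE_I2)
        fix w assume "w \<in> space N"
        then have "\<bar>ln_prim (g w - c)\<bar> \<le> B" "\<bar>ln_prim (g w - d)\<bar> \<le> B"
          using g[of w] by (auto intro!: B)
        then show "norm (K * (d - c) - (ln_prim (g w - c) - ln_prim (g w - d))) \<le> \<bar>K * (d - c)\<bar> + 2 * B"
          unfolding real_norm_def by linarith
      qed
    qed measurable
    moreover have "(\<integral>y. norm (case (w, y) of (w, y) \<Rightarrow> K - ln \<bar>g w - y\<bar>) \<partial>lborel_Icc c d)
        = K * (d - c) - (ln_prim (g w - c) - ln_prim (g w - d))" if "w \<in> space N" for w
    proof -
      have "(\<integral>y. norm (case (w, y) of (w, y) \<Rightarrow> K - ln \<bar>g w - y\<bar>) \<partial>lborel_Icc c d)
          = (\<integral>y. K - ln \<bar>g w - y\<bar> \<partial>lborel_Icc c d)"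
        by (rule Bochner_Integration.integral_cong) (use K[OF that] in auto)
      also have "\<dots> = K * (d - c) - (ln_prim (g w - c) - ln_prim (g w - d))"
        using cd integrable_lborel_Icc_bounded[of "\<lambda>_. K" c d "\<bar>K\<bar>"]
        by (subst Bochner_Integration.integral_diff)
          (auto simp: ln_abs_diff_integral integral_lborel_Icc_const simp del: lebesgue_integral_const)
      finally show ?thesis .
    qed
    ultimately show "integrable N (\<lambda>w. \<integral>y. norm (case (w, y) of (w, y) \<Rightarrow> K - ln \<bar>g w - y\<bar>) \<partial>lborel_Icc c d)"
      by (subst Bochner_Integration.integrable_cong[OF refl]) auto
    show "(\<lambda>(w, y). K - ln \<bar>g w - y\<bar>) \<in> borel_measurable (N \<Otimes>\<^sub>M lborel_Icc c d)"
      unfolding case_prod_beta by measurable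
  qed (use int in auto)
  from Bochner_Integration.integrable_diff[OF PF.integrable_const[of K] this]
  show ?thesis by (simp add: case_prod_beta')
qed

section \<open>Gram kernels on the unit square\<close>

abbreviation unit_square :: "(real \<times> real) measure" where
  "unit_square \<equiv> lborel_Icc 0 1 \<Otimes>\<^sub>M lborel_Icc 0 1"

lemma finite_measure_unit_square: "finite_measure unit_square"
  by (intro finite_measure_pair_measure finite_measure_lborel_Icc)

lemma integrable_unit_square_bounded:
  fixes f :: "real \<times> real \<Rightarrow> real"
  assumes "f \<in> borel_measurable unit_square" "\<And>p. p \<in> space unit_square \<Longrightarrow> \<bar>f p\<bar> \<le> C"
  shows "integrable unit_square f"
proof -
  interpret finite_measure unit_square by (rule finite_measure_unit_square)
  show ?thesis
    by (rule integrable_const_bound[of _ C]) (use assms in \<open>auto intro: AE_I2\<close>)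
qed

lemma integrable_mult_bounded:
  fixes f g :: "'a \<Rightarrow> real"
  assumes "integrable M f" "g \<in> borel_measurable M" "\<And>x. x \<in> space M \<Longrightarrow> \<bar>g x\<bar> \<le> C"
  shows "integrable M (\<lambda>x. f x * g x)"
proof (rule Bochner_Integration.integrable_bound)
  show "integrable M (\<lambda>x. C * f x)" using assms(1) by simp
  show "AE x in M. norm (f x * g x) \<le> norm (C * f x)"
  proof (rule AE_I2)
    fix x assume "x \<in> space M"
    then have "\<bar>g x\<bar> \<le> \<bar>C\<bar>" using assms(3)[of x] by linarith
    then show "norm (f x * g x) \<le> norm (C * f x)"
      using mult_right_mono[OF _ abs_ge_zero[of "f x"], of "\<bar>g x\<bar>" "\<bar>C\<bar>"]
      by (simp add: abs_mult mult.commute)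
  qed
  show "(\<lambda>x. f x * g x) \<in> borel_measurable M" using assms by auto
qed

lemma integral_unit_square_prod:
  fixes f g :: "real \<Rightarrow> real"
  assumes "integrable unit_square (\<lambda>(x, y). f x * g y)"
  shows "(\<integral>(x, y). f x * g y \<partial>unit_square) = (\<integral>x. f x \<partial>lborel_Icc 0 1) * (\<integral>y. g y \<partial>lborel_Icc 0 1)"
proof -
  interpret L: finite_measure "lborel_Icc 0 1" by (rule finite_measure_lborel_Icc)
  interpret P: pair_sigma_finite "lborel_Icc 0 1" "lborel_Icc 0 1" ..
  show ?thesis using P.integral_fst'[OF assms] by simp
qed

text \<open>Fubini turns the quadratic form of a Gram kernel into an integral of squares. As \<psi>
  is nonnegative, the kernel itself controls the integrals of absolute values. \<open>N\<close> is
  merely sigma-finite so that the whole real line can serve as index set.\<close>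

lemma gram_kernel_integral:
  fixes \<psi> :: "real \<Rightarrow> 'w \<Rightarrow> real" and h :: "real \<Rightarrow> real" and K :: "real \<times> real \<Rightarrow> real"
  assumes "sigma_finite_measure N"
    and [measurable]: "case_prod \<psi> \<in> borel_measurable (borel \<Otimes>\<^sub>M N)" and \<psi>: "\<And>x w. 0 \<le> \<psi> x w"
    and int: "\<And>x y. x \<in> {0..1} \<Longrightarrow> y \<in> {0..1} \<Longrightarrow> integrable N (\<lambda>w. \<psi> x w * \<psi> y w)"
    and K: "\<And>x y. x \<in> {0..1} \<Longrightarrow> y \<in> {0..1} \<Longrightarrow> (\<integral>w. \<psi> x w * \<psi> y w \<partial>N) = K (x, y)"
    and K_int: "integrable unit_square K"
    and h[measurable]: "h \<in> borel_measurable borel" and hC: "\<And>x. \<bar>h x\<bar> \<le> C"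
  shows "(\<integral>(x, y). K (x, y) * (h x * h y) \<partial>unit_square) = (\<integral>w. (\<integral>x. \<psi> x w * h x \<partial>lborel_Icc 0 1)\<^sup>2 \<partial>N)"
proof -
  interpret N: sigma_finite_measure N by fact
  interpret L: finite_measure "lborel_Icc 0 1" by (rule finite_measure_lborel_Icc)
  interpret LL: finite_measure unit_square by (rule finite_measure_unit_square)
  interpret P: pair_sigma_finite "lborel_Icc 0 1" "lborel_Icc 0 1" ..
  interpret Q: pair_sigma_finite unit_square N ..
  define F where "F p w = \<psi> (fst p) w * \<psi> (snd p) w * (h (fst p) * h (snd p))" for p w
  have m1: "(\<lambda>q. \<psi> (fst (fst q)) (snd q)) \<in> borel_measurable (unit_square \<Otimes>\<^sub>M N)"
    and m2: "(\<lambda>q. \<psi> (snd (fst q)) (snd q)) \<in> borel_measurable (unit_square \<Otimes>\<^sub>M N)"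
    using measurable_compose[OF measurable_Pair[OF measurable_compose[OF measurable_fst measurable_fst_lborel_Icc] measurable_snd] assms(2)]
      measurable_compose[OF measurable_Pair[OF measurable_compose[OF measurable_fst measurable_snd_lborel_Icc] measurable_snd] assms(2)]
    by simp_all
  have F: "case_prod F \<in> borel_measurable (unit_square \<Otimes>\<^sub>M N)"
  proof -
    have "(\<lambda>q. h (fst (fst q)) * h (snd (fst q))) \<in> borel_measurable (unit_square \<Otimes>\<^sub>M N)"
      using measurable_compose[OF measurable_compose[OF measurable_fst measurable_fst_lborel_Icc] h]
        measurable_compose[OF measurable_compose[OF measurable_fst measurable_snd_lborel_Icc] h]
      by (rule borel_measurable_times)
    from borel_measurable_times[OF borel_measurable_times[OF m1 m2] this] show ?thesis
      by (simp add: F_def case_prod_beta')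
  qed
  have hC2: "\<bar>h x * h y\<bar> \<le> C * C" for x y
    using hC[of x] hC[of y] unfolding abs_mult by (intro mult_mono) auto
  have Fint: "integrable (unit_square \<Otimes>\<^sub>M N) (case_prod F)"
  proof (rule Q.Fubini_integrable[OF F])
    have "(\<integral>w. norm (F p w) \<partial>N) = K p * \<bar>h (fst p) * h (snd p)\<bar>" if "p \<in> space unit_square" for p
      using that K[of "fst p" "snd p"] \<psi>
      by (auto simp: F_def abs_mult space_pair_measure simp flip: mult.assoc)
    moreover have "integrable unit_square (\<lambda>p. K p * \<bar>h (fst p) * h (snd p)\<bar>)"
      by (rule integrable_mult_bounded[OF K_int, of _ "C * C"]) (use hC2 in auto)
    ultimately show "integrable unit_square (\<lambda>p. \<integral>w. norm (case (p, w) of (p, w) \<Rightarrow> F p w) \<partial>N)"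
      by (subst Bochner_Integration.integrable_cong[OF refl]) auto
    show "AE p in unit_square. integrable N (\<lambda>w. case (p, w) of (p, w) \<Rightarrow> F p w)"
      by (rule AE_I2) (auto simp: F_def space_pair_measure intro!: integrable_mult_left int)
  qed
  have "(\<integral>(x, y). K (x, y) * (h x * h y) \<partial>unit_square) = (\<integral>p. (\<integral>w. F p w \<partial>N) \<partial>unit_square)"
    by (rule Bochner_Integration.integral_cong) (auto simp: F_def space_pair_measure K)
  also have "\<dots> = (\<integral>w. (\<integral>p. F p w \<partial>unit_square) \<partial>N)"
    using Q.Fubini_integral[OF Fint] by simp
  also have "\<dots> = (\<integral>w. (\<integral>x. \<psi> x w * h x \<partial>lborel_Icc 0 1)\<^sup>2 \<partial>N)"
  proof (rule integral_cong_AE)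
    \<comment> \<open>Fubini gives integrability over the square for almost every w, and the product
      formula for the double integral is applied there.\<close>
    have "AE w in N. integrable unit_square (\<lambda>p. F p w)"
      using Q.AE_integrable_snd[OF Fint] by simp
    then show "AE w in N. (\<integral>p. F p w \<partial>unit_square) = (\<integral>x. \<psi> x w * h x \<partial>lborel_Icc 0 1)\<^sup>2"
    proof (rule AE_mp, intro AE_I2 impI)
      fix w assume *: "integrable unit_square (\<lambda>p. F p w)"
      have eq: "F p w = (case p of (x, y) \<Rightarrow> (\<psi> x w * h x) * (\<psi> y w * h y))" for p
        by (simp add: F_def case_prod_beta)
      show "(\<integral>p. F p w \<partial>unit_square) = (\<integral>x. \<psi> x w * h x \<partial>lborel_Icc 0 1)\<^sup>2"
        using integral_unit_square_prod[OF *[unfolded eq]] by (simp add: eq power2_eq_square)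
    qed
    show "(\<lambda>w. \<integral>p. F p w \<partial>unit_square) \<in> borel_measurable N"
      using measurable_pair_swap[OF F] by (intro LL.borel_measurable_lebesgue_integral) (simp add: case_prod_beta')
    show "(\<lambda>w. (\<integral>x. \<psi> x w * h x \<partial>lborel_Icc 0 1)\<^sup>2) \<in> borel_measurable N"
    proof -
      have "(\<lambda>q. \<psi> (snd q) (fst q)) \<in> borel_measurable (N \<Otimes>\<^sub>M lborel_Icc 0 1)"
        using measurable_compose[OF measurable_Pair[OF measurable_snd_lborel_Icc measurable_fst] assms(2)] by simp
      from borel_measurable_times[OF this measurable_compose[OF measurable_snd_lborel_Icc h]]
      have "(\<lambda>q. \<psi> (snd q) (fst q) * h (snd q)) \<in> borel_measurable (N \<Otimes>\<^sub>M lborel_Icc 0 1)" .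
      then have "(\<lambda>w. \<integral>x. \<psi> x w * h x \<partial>lborel_Icc 0 1) \<in> borel_measurable N"
        by (intro L.borel_measurable_lebesgue_integral) (simp add: case_prod_beta)
      then show ?thesis by simp
    qed
  qed
  finally show ?thesis .
qed

text \<open>\<open>1 - max x y = \<integral> [x \<le> z] [y \<le> z] dz\<close>.\<close>

lemma gram_max:
  fixes h :: "real \<Rightarrow> real"
  assumes "h \<in> borel_measurable borel" "\<And>x. \<bar>h x\<bar> \<le> C"
  shows "(\<integral>(x, y). (1 - max x y) * (h x * h y) \<partial>unit_square)
    = (\<integral>z. (\<integral>x. indicator {..z} x * h x \<partial>lborel_Icc 0 1)\<^sup>2 \<partial>lborel_Icc 0 1)"
proof -
  have *: "(\<lambda>w. indicator {..w} x * indicator {..w} y :: real) = indicator {max x y..}" for x y :: real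
    by (auto simp: indicator_def fun_eq_iff)
  interpret L: finite_measure "lborel_Icc 0 1" by (rule finite_measure_lborel_Icc)
  have meas: "(\<lambda>(x, w). indicator {..w} x :: real) \<in> borel_measurable (borel \<Otimes>\<^sub>M lborel_Icc 0 1)"
  proof -
    have "(\<lambda>(x, w). indicator {..w} x :: real) = (\<lambda>q. if fst q \<le> snd q then 1 else 0)"
      by (auto simp: indicator_def fun_eq_iff)
    also have "\<dots> \<in> borel_measurable (borel \<Otimes>\<^sub>M lborel_Icc 0 1)" by measurable
    finally show ?thesis .
  qed
  have int: "(\<integral>w. indicator {max x y..} w \<partial>lborel_Icc 0 1) = 1 - max x y"
    if "x \<in> {0..1}" "y \<in> {0..1}" for x y :: real
  proof -
    have "{max x y..} \<inter> {0..1} = {max x y..1}" using that by auto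
    then show ?thesis using that by (simp add: measure_restrict_space)
  qed
  have "integrable unit_square (\<lambda>(x, y). 1 - max x y)"
  proof (rule integrable_unit_square_bounded[of _ 1])
    show "(\<lambda>(x, y). 1 - max x y) \<in> borel_measurable unit_square"
      unfolding case_prod_beta by measurable
  qed (auto simp: space_pair_measure)
  from gram_kernel_integral[OF L.sigma_finite_measure_axioms meas _ _ _ this assms, unfolded *, simplified case_prod_conv, OF _ _ int]
  show ?thesis by (simp add: integrable_lborel_Icc_bounded[of _ _ _ 1])
qed

text \<open>\<open>max 0 (2 r - \<bar>x - y\<bar>)\<close> is the length of the overlap of the intervals of radius \<open>r\<close>
  around \<open>x\<close> and \<open>y\<close>.\<close>

lemma gram_overlap:
  fixes h :: "real \<Rightarrow> real"
  assumes "h \<in> borel_measurable borel" "\<And>x. \<bar>h x\<bar> \<le> C" "r > 0"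
  shows "(\<integral>(x, y). max 0 (2 * r - \<bar>x - y\<bar>) * (h x * h y) \<partial>unit_square) \<ge> 0"
proof -
  have *: "(\<lambda>w. indicator {x - r<..<x + r} w * indicator {y - r<..<y + r} w :: real)
      = indicator {max x y - r<..<min x y + r}" for x y :: real
    by (auto simp: indicator_def fun_eq_iff)
  have meas: "(\<lambda>(x, w). indicator {x - r<..<x + r} w :: real) \<in> borel_measurable (borel \<Otimes>\<^sub>M lborel)"
  proof -
    have "(\<lambda>(x, w). indicator {x - r<..<x + r} w :: real) = (\<lambda>q. if fst q - r < snd q \<and> snd q < fst q + r then 1 else 0)"
      by (auto simp: indicator_def fun_eq_iff)
    also have "\<dots> \<in> borel_measurable (borel \<Otimes>\<^sub>M lborel)" by measurable
    finally show ?thesis .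
  qed
  have int: "(\<integral>w. indicator {max x y - r<..<min x y + r} w \<partial>lborel) = max 0 (2 * r - \<bar>x - y\<bar>)"
    for x y :: real
  proof -
    have "min x y + r - (max x y - r) = 2 * r - \<bar>x - y\<bar>" by (auto simp: max_def min_def)
    then show ?thesis by (cases "max x y - r \<le> min x y + r") auto
  qed
  have intg: "integrable lborel (indicator {max x y - r<..<min x y + r} :: real \<Rightarrow> real)" for x y :: real
    by (cases "max x y - r \<le> min x y + r") (auto intro!: integrable_real_indicator)
  have "integrable unit_square (\<lambda>(x, y). max 0 (2 * r - \<bar>x - y\<bar>))"
  proof (rule integrable_unit_square_bounded[of _ "2 * r"])
    show "(\<lambda>(x, y). max 0 (2 * r - \<bar>x - y\<bar>)) \<in> borel_measurable unit_square"
      unfolding case_prod_beta by measurable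
  qed (use assms in \<open>auto simp: space_pair_measure\<close>)
  from gram_kernel_integral[OF lborel.sigma_finite_measure_axioms meas _ _ _ this assms(1,2),
      unfolded *, simplified case_prod_conv, OF _ intg int]
  show ?thesis by simp
qed

text \<open>The weight 1 / r^2 makes overlap lengths add up to a logarithm: up to the affine
  remainder 2 ln 2 - 2 + u, the function - 2 ln u is a positive superposition of the kernels of
  \<open>gram_overlap\<close>.\<close>

lemma overlap_integral:
  fixes u :: real
  assumes "0 < u" "u \<le> 1"
  shows "integrable (lborel_Icc 0 1) (\<lambda>r. max 0 (2 * r - u) / r\<^sup>2)"
    and "(\<integral>r. max 0 (2 * r - u) / r\<^sup>2 \<partial>lborel_Icc 0 1) = 2 * ln 2 - 2 * ln u - 2 + u"
proof -
  \<comment> \<open>The \<open>max\<close> freezes the primitive 2 ln r + u / r below the threshold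
    u / 2, where the integrand vanishes; this keeps it continuous down to r = 0.\<close>
  define F where "F r = 2 * ln (max r (u / 2)) + u / max r (u / 2)" for r
  have cont: "continuous_on {0..1} F"
    unfolding F_def using assms by (intro continuous_intros) (auto simp: max_def)
  have der: "(F has_real_derivative max 0 (2 * r - u) / r\<^sup>2) (at r)" if "r \<in> {0<..<1} - {u / 2}" for r
  proof (cases "r < u / 2")
    case True
    have "((\<lambda>_. F 0) has_real_derivative 0) (at r)" by simp
    then have "(F has_real_derivative 0) (at r)"
      by (rule has_field_derivative_transform_within_open[of _ _ _ "{..<u / 2}"])
        (use True assms in \<open>auto simp: F_def max_def\<close>)
    then show ?thesis using True by simp
  next
    case False
    have "((\<lambda>r. 2 * ln r + u / r) has_real_derivative (2 * r - u) / r\<^sup>2) (at r)"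
      using that by (auto intro!: derivative_eq_intros simp: field_simps power2_eq_square)
    then have "(F has_real_derivative (2 * r - u) / r\<^sup>2) (at r)"
      by (rule has_field_derivative_transform_within_open[of _ _ _ "{u / 2<..}"])
        (use False that in \<open>auto simp: F_def max_def\<close>)
    then show ?thesis using False by simp
  qed
  have bnd: "max 0 (2 * r - u) / r\<^sup>2 \<le> 4 / u" if "r \<in> {0..1}" for r
  proof (cases "r \<le> u / 2")
    case False
    then have r: "r > 0" using assms by simp
    have "(2 * r - u) / r\<^sup>2 \<le> 2 * r / r\<^sup>2" using assms by (intro divide_right_mono) auto
    also have "\<dots> = 2 / r" using r by (simp add: power2_eq_square)
    also have "\<dots> \<le> 2 / (u / 2)" using False assms by (intro divide_left_mono) auto
    finally show ?thesis using False by simp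
  qed (use assms in auto)
  note * = integral_lborel_Icc_FTC[of 0 1 "{u / 2}" F "\<lambda>r. max 0 (2 * r - u) / r\<^sup>2" "4 / u", OF _ _ cont _ der bnd]
  show "integrable (lborel_Icc 0 1) (\<lambda>r. max 0 (2 * r - u) / r\<^sup>2)"
    by (rule *) auto
  have "(\<integral>r. max 0 (2 * r - u) / r\<^sup>2 \<partial>lborel_Icc 0 1) = F 1 - F 0"
    by (rule *) auto
  also have "\<dots> = 2 * ln 2 - 2 * ln u - 2 + u"
    using assms by (simp add: F_def max_def ln_divide_pos)
  finally show "(\<integral>r. max 0 (2 * r - u) / r\<^sup>2 \<partial>lborel_Icc 0 1) = 2 * ln 2 - 2 * ln u - 2 + u" .
qed

lemma AE_unit_square_neq: "AE p in unit_square. fst p \<noteq> snd p"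
proof -
  interpret L: finite_measure "lborel_Icc 0 1" by (rule finite_measure_lborel_Icc)
  interpret P: pair_sigma_finite "lborel_Icc 0 1" "lborel_Icc 0 1" ..
  have "AE y in lborel_Icc 0 1. x \<noteq> y" for x :: real
    using AE_lborel_Icc_not_in_finite[of "{x}" 0 1] by (simp add: eq_commute)
  moreover have "{p \<in> space unit_square. fst p \<noteq> snd p} \<in> sets unit_square" by measurable
  ultimately show ?thesis by (intro P.AE_pair_measure) auto
qed

text \<open>Since |x - y| = 2 max x y - x - y, the overlap integral gives off the diagonal - ln |x -
  y| = T / 2 + (1 - max x y) + R with T the superposition of overlap kernels and R = (x + y) / 2 -
  ln 2. The form of T is nonnegative, that of R vanishes because R is a sum of functions of one
  variable and \<open>h\<close> has mean zero, and the middle kernel contributes the squared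
  primitive.\<close>

lemma log_energy_ge:
  fixes h :: "real \<Rightarrow> real"
  assumes h[measurable]: "h \<in> borel_measurable borel" and hC: "\<And>x. \<bar>h x\<bar> \<le> C"
    and mean: "(\<integral>x. h x \<partial>lborel_Icc 0 1) = 0"
  shows "(\<integral>z. (\<integral>x. indicator {..z} x * h x \<partial>lborel_Icc 0 1)\<^sup>2 \<partial>lborel_Icc 0 1)
    \<le> (\<integral>(x, y). - ln \<bar>x - y\<bar> * (h x * h y) \<partial>unit_square)"
proof -
  interpret L: finite_measure "lborel_Icc 0 1" by (rule finite_measure_lborel_Icc)
  interpret LL: finite_measure unit_square by (rule finite_measure_unit_square)
  interpret Q: pair_sigma_finite unit_square "lborel_Icc 0 1" ..
  define H where "H p = h (fst p) * h (snd p)" for p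
  have H[measurable]: "H \<in> borel_measurable unit_square" unfolding H_def by measurable
  have HC: "\<bar>H p\<bar> \<le> C * C" for p
    using hC[of "fst p"] hC[of "snd p"] unfolding H_def abs_mult by (intro mult_mono) auto
  define G where "G p r = max 0 (2 * r - \<bar>fst p - snd p\<bar>) / r\<^sup>2" for p :: "real \<times> real" and r
  have G: "(\<lambda>q. G (fst q) (snd q)) \<in> borel_measurable (unit_square \<Otimes>\<^sub>M lborel_Icc 0 1)"
  proof -
    have [measurable]: "(\<lambda>q. fst (fst q)) \<in> borel_measurable (unit_square \<Otimes>\<^sub>M lborel_Icc 0 1)"
      "(\<lambda>q. snd (fst q)) \<in> borel_measurable (unit_square \<Otimes>\<^sub>M lborel_Icc 0 1)"
      using measurable_compose[OF measurable_fst measurable_fst_lborel_Icc]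
        measurable_compose[OF measurable_fst measurable_snd_lborel_Icc] by blast+
    show ?thesis unfolding G_def by measurable
  qed
  define T where "T p = (\<integral>r. G p r \<partial>lborel_Icc 0 1)" for p
  define E where "E p = 2 * ln 2 - 2 * ln \<bar>fst p - snd p\<bar> - 2 + \<bar>fst p - snd p\<bar>" for p :: "real \<times> real"
  have diff: "0 < \<bar>fst p - snd p\<bar>" "\<bar>fst p - snd p\<bar> \<le> 1"
    if "p \<in> space unit_square" "fst p \<noteq> snd p" for p
    using that by (auto simp: space_pair_measure)
  have AE_T: "AE p in unit_square. T p = E p"
    using AE_unit_square_neq by (rule AE_mp)
      (intro AE_I2 impI, simp only: T_def G_def E_def, intro overlap_integral(2) diff)
  have AE_G: "AE p in unit_square. integrable (lborel_Icc 0 1) (G p)"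
    using AE_unit_square_neq by (rule AE_mp)
      (intro AE_I2 impI, simp only: G_def[abs_def], intro overlap_integral(1) diff)
  have ln_int: "integrable unit_square (\<lambda>p. ln \<bar>fst p - snd p\<bar>)"
    using integrable_ln_abs_diff_pair[OF finite_measure_lborel_Icc, of "\<lambda>x. x" 0 1 1 0 1]
    by (simp add: case_prod_beta')
  have E_int: "integrable unit_square E"
    unfolding E_def
    by (intro Bochner_Integration.integrable_add Bochner_Integration.integrable_diff
        integrable_mult_right ln_int integrable_unit_square_bounded[of _ 1] LL.integrable_const)
      (auto simp: space_pair_measure)
  have T_meas: "T \<in> borel_measurable unit_square"
    unfolding T_def using G by (intro L.borel_measurable_lebesgue_integral) (simp add: case_prod_beta')
  have T_int: "integrable unit_square T"
    by (rule integrable_cong_AE_imp[OF E_int T_meas]) (use AE_T in \<open>auto simp: eq_commute\<close>)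
  have F_int: "integrable (unit_square \<Otimes>\<^sub>M lborel_Icc 0 1) (\<lambda>(p, r). G p r * H p)"
  proof (rule Q.Fubini_integrable)
    show "(\<lambda>(p, r). G p r * H p) \<in> borel_measurable (unit_square \<Otimes>\<^sub>M lborel_Icc 0 1)"
      using borel_measurable_times[OF G measurable_compose[OF measurable_fst H]] by (simp add: case_prod_beta')
    have "integrable unit_square (\<lambda>p. T p * \<bar>H p\<bar>)"
      by (rule integrable_mult_bounded[OF T_int, of _ "C * C"]) (use HC in auto)
    moreover have "(\<integral>r. norm (case (p, r) of (p, r) \<Rightarrow> G p r * H p) \<partial>lborel_Icc 0 1) = T p * \<bar>H p\<bar>" for p
    proof -
      have "norm (case (p, r) of (p, r) \<Rightarrow> G p r * H p) = G p r * \<bar>H p\<bar>" for r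
        by (simp add: abs_mult G_def)
      then show ?thesis by (simp add: T_def)
    qed
    ultimately show "integrable unit_square (\<lambda>p. \<integral>r. norm (case (p, r) of (p, r) \<Rightarrow> G p r * H p) \<partial>lborel_Icc 0 1)"
      by simp
    show "AE p in unit_square. integrable (lborel_Icc 0 1) (\<lambda>r. case (p, r) of (p, r) \<Rightarrow> G p r * H p)"
      using AE_G by (rule AE_mp) (auto intro!: AE_I2 integrable_mult_left)
  qed
  have "(\<integral>p. T p * H p \<partial>unit_square) = (\<integral>p. (\<integral>r. G p r * H p \<partial>lborel_Icc 0 1) \<partial>unit_square)"
    by (simp add: T_def)
  also have "\<dots> = (\<integral>r. (\<integral>p. G p r * H p \<partial>unit_square) \<partial>lborel_Icc 0 1)"
    using Q.Fubini_integral[OF F_int] by simp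
  also have "\<dots> \<ge> 0"
  proof (rule Bochner_Integration.integral_nonneg)
    fix r assume "r \<in> space (lborel_Icc 0 1)"
    \<comment> \<open>At r = 0 the weight 1 / r^2 is 0 by convention; \<open>gram_overlap\<close>
      covers r > 0.\<close>
    then have "r = 0 \<or> r > 0" by auto
    moreover have "(\<integral>p. G p r * H p \<partial>unit_square)
        = (\<integral>(x, y). max 0 (2 * r - \<bar>x - y\<bar>) * (h x * h y) \<partial>unit_square) / r\<^sup>2"
      by (simp add: G_def H_def case_prod_beta' flip: integral_divide_zero)
    ultimately show "(\<integral>p. G p r * H p \<partial>unit_square) \<ge> 0"
      using gram_overlap[OF h hC] by auto
  qed
  finally have T_nonneg: "(\<integral>p. T p * H p \<partial>unit_square) \<ge> 0" .
  define R where "R p = (fst p + snd p) / 2 - ln 2" for p :: "real \<times> real"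
  have R_int: "integrable unit_square (\<lambda>p. R p * H p)"
  proof (rule integrable_mult_bounded[OF _ H HC])
    show "integrable unit_square R"
      unfolding R_def by (intro Bochner_Integration.integrable_diff LL.integrable_const
          integrable_unit_square_bounded[of _ 1]) (auto simp: space_pair_measure)
  qed
  have R0: "(\<integral>p. R p * H p \<partial>unit_square) = 0"
  proof -
    have i: "integrable unit_square (\<lambda>(x, y). ((x / 2 - ln 2) * h x) * h y)"
      "integrable unit_square (\<lambda>(x, y). h x * (y / 2 * h y))"
    proof -
      have "integrable unit_square (\<lambda>p. (fst p / 2 - ln 2) * H p)"
        by (rule integrable_mult_bounded[OF _ H HC]) (intro Bochner_Integration.integrable_diff LL.integrable_const
          integrable_unit_square_bounded[of _ 1]; auto simp: space_pair_measure)
      then show "integrable unit_square (\<lambda>(x, y). ((x / 2 - ln 2) * h x) * h y)"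
        by (simp add: case_prod_beta' H_def mult.assoc)
      have "integrable unit_square (\<lambda>p. snd p / 2 * H p)"
        by (rule integrable_mult_bounded[OF _ H HC])
          (intro integrable_unit_square_bounded[of _ 1]; auto simp: space_pair_measure)
      then show "integrable unit_square (\<lambda>(x, y). h x * (y / 2 * h y))"
        by (simp add: case_prod_beta' H_def mult.left_commute)
    qed
    have "(\<integral>p. R p * H p \<partial>unit_square)
      = (\<integral>p. (case p of (x, y) \<Rightarrow> ((x / 2 - ln 2) * h x) * h y) + (case p of (x, y) \<Rightarrow> h x * (y / 2 * h y)) \<partial>unit_square)"
      by (rule Bochner_Integration.integral_cong) (auto simp: R_def H_def algebra_simps add_divide_distrib)
    also have "\<dots> = 0"
      by (simp only: Bochner_Integration.integral_add[OF i] integral_unit_square_prod[OF i(1)]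
          integral_unit_square_prod[OF i(2)] mean mult_zero_left mult_zero_right add_0_right)
    finally show ?thesis .
  qed
  have M_int: "integrable unit_square (\<lambda>p. (1 - max (fst p) (snd p)) * H p)"
    by (rule integrable_mult_bounded[OF _ H HC])
      (intro integrable_unit_square_bounded[of _ 1]; auto simp: space_pair_measure)
  have TH_int: "integrable unit_square (\<lambda>p. 1 / 2 * (T p * H p))"
    by (intro integrable_mult_right integrable_mult_bounded[OF T_int H HC])
  have "(\<integral>(x, y). - ln \<bar>x - y\<bar> * (h x * h y) \<partial>unit_square)
    = (\<integral>p. 1 / 2 * (T p * H p) + ((1 - max (fst p) (snd p)) * H p + R p * H p) \<partial>unit_square)"
  proof (rule integral_cong_AE)
    show "(\<lambda>(x, y). - ln \<bar>x - y\<bar> * (h x * h y)) \<in> borel_measurable unit_square"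
      unfolding case_prod_beta' by measurable
    show "(\<lambda>p. 1 / 2 * (T p * H p) + ((1 - max (fst p) (snd p)) * H p + R p * H p)) \<in> borel_measurable unit_square"
      using TH_int M_int R_int by (intro borel_measurable_add) auto
    show "AE p in unit_square. (case p of (x, y) \<Rightarrow> - ln \<bar>x - y\<bar> * (h x * h y))
      = 1 / 2 * (T p * H p) + ((1 - max (fst p) (snd p)) * H p + R p * H p)"
      using AE_T
    proof (rule AE_mp, intro AE_I2 impI)
      fix p assume "T p = E p"
      moreover have "\<bar>fst p - snd p\<bar> = 2 * max (fst p) (snd p) - fst p - snd p" by (auto simp: max_def)
      ultimately have "- ln \<bar>fst p - snd p\<bar> = 1 / 2 * T p + (1 - max (fst p) (snd p)) + R p"
        unfolding E_def R_def by argo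
      then show "(case p of (x, y) \<Rightarrow> - ln \<bar>x - y\<bar> * (h x * h y))
        = 1 / 2 * (T p * H p) + ((1 - max (fst p) (snd p)) * H p + R p * H p)"
        by (simp only: case_prod_beta' H_def[symmetric]) (simp add: algebra_simps)
    qed
  qed
  also have "\<dots> = 1 / 2 * (\<integral>p. T p * H p \<partial>unit_square) + (\<integral>p. (1 - max (fst p) (snd p)) * H p \<partial>unit_square)"
    by (simp only: Bochner_Integration.integral_add[OF TH_int Bochner_Integration.integrable_add[OF M_int R_int]]
        Bochner_Integration.integral_add[OF M_int R_int] R0 integral_mult_right_zero add_0_right)
  also have "(\<integral>p. (1 - max (fst p) (snd p)) * H p \<partial>unit_square)
    = (\<integral>z. (\<integral>x. indicator {..z} x * h x \<partial>lborel_Icc 0 1)\<^sup>2 \<partial>lborel_Icc 0 1)"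
    using gram_max[OF h hC] by (simp add: case_prod_beta' H_def)
  finally show ?thesis using T_nonneg by simp
qed

section \<open>Sufficiency of the variational conditions\<close>

definition log_pot :: "(real \<Rightarrow> real) \<Rightarrow> real \<Rightarrow> real" where
  "log_pot g x = (\<integral>y. ln \<bar>x - y\<bar> * g y \<partial>lborel_Icc 0 1)"

definition log_form :: "(real \<Rightarrow> real) \<Rightarrow> (real \<Rightarrow> real) \<Rightarrow> real" where
  "log_form f g = (\<integral>(x, y). ln \<bar>x - y\<bar> * (f x * g y) \<partial>unit_square)"

lemma log_form_integrable:
  fixes f g :: "real \<Rightarrow> real"
  assumes [measurable]: "f \<in> borel_measurable borel" "g \<in> borel_measurable borel"
    and f: "\<And>x. \<bar>f x\<bar> \<le> C" and g: "\<And>x. \<bar>g x\<bar> \<le> C'"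
  shows "integrable unit_square (\<lambda>(x, y). ln \<bar>x - y\<bar> * (f x * g y))"
proof -
  have "integrable unit_square (\<lambda>p. ln \<bar>fst p - snd p\<bar> * (f (fst p) * g (snd p)))"
  proof (rule integrable_mult_bounded[of _ _ _ "C * C'"])
    show "integrable unit_square (\<lambda>p. ln \<bar>fst p - snd p\<bar>)"
      using integrable_ln_abs_diff_pair[OF finite_measure_lborel_Icc, of "\<lambda>x. x" 0 1 1 0 1]
      by (simp add: case_prod_beta')
    have "C \<ge> 0" using f[of 0] by linarith
    then show "\<bar>f (fst p) * g (snd p)\<bar> \<le> C * C'" for p
      using f g by (auto simp: abs_mult intro!: mult_mono)
  qed measurable
  then show ?thesis by (simp add: case_prod_beta')
qed

lemma log_form_eq_log_pot:
  fixes f g :: "real \<Rightarrow> real"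
  assumes "f \<in> borel_measurable borel" "g \<in> borel_measurable borel"
    and "\<And>x. \<bar>f x\<bar> \<le> C" and "\<And>x. \<bar>g x\<bar> \<le> C'"
  shows "log_form f g = (\<integral>x. f x * log_pot g x \<partial>lborel_Icc 0 1)"
    and "integrable (lborel_Icc 0 1) (\<lambda>x. f x * log_pot g x)"
proof -
  interpret L: finite_measure "lborel_Icc 0 1" by (rule finite_measure_lborel_Icc)
  interpret P: pair_sigma_finite "lborel_Icc 0 1" "lborel_Icc 0 1" ..
  have eq: "f x * log_pot g x = (\<integral>y. (case (x, y) of (x, y) \<Rightarrow> ln \<bar>x - y\<bar> * (f x * g y)) \<partial>lborel_Icc 0 1)" for x
    by (simp add: log_pot_def mult.left_commute flip: integral_mult_right_zero)
  show "log_form f g = (\<integral>x. f x * log_pot g x \<partial>lborel_Icc 0 1)"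
    unfolding eq log_form_def using P.integral_fst'[OF log_form_integrable[OF assms]] by simp
  show "integrable (lborel_Icc 0 1) (\<lambda>x. f x * log_pot g x)"
    unfolding eq using P.integrable_fst'[OF log_form_integrable[OF assms]] by simp
qed

lemma log_form_commute: 
  fixes f g :: "real \<Rightarrow> real"
  assumes [measurable]: "f \<in> borel_measurable borel" "g \<in> borel_measurable borel"
  shows "log_form f g = log_form g f"
proof -
  interpret L: finite_measure "lborel_Icc 0 1" by (rule finite_measure_lborel_Icc)
  interpret P: pair_sigma_finite "lborel_Icc 0 1" "lborel_Icc 0 1" ..
  have m: "(\<lambda>(x, y). ln \<bar>x - y\<bar> * (f x * g y)) \<in> borel_measurable unit_square"
    unfolding case_prod_beta' by measurable
  show ?thesis
    unfolding log_form_def using P.integral_product_swap[OF m]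
    by (simp add: abs_minus_commute mult.commute)
qed

lemma log_form_quadratic_expansion:
  fixes g \<rho> :: "real \<Rightarrow> real"
  assumes g: "g \<in> borel_measurable borel" "\<And>x. \<bar>g x\<bar> \<le> C"
    and \<rho>: "\<rho> \<in> borel_measurable borel" "\<And>x. \<bar>\<rho> x\<bar> \<le> C"
  defines "h \<equiv> \<lambda>x. g x - \<rho> x"
  shows "log_form g g = log_form \<rho> \<rho> + 2 * log_form h \<rho> + log_form h h"
proof -
  have h: "h \<in> borel_measurable borel" "\<And>x. \<bar>h x\<bar> \<le> 2 * C"
  proof -
    show "\<bar>h x\<bar> \<le> 2 * C" for x using g(2)[of x] \<rho>(2)[of x] by (simp add: h_def)
  qed (use g(1) \<rho>(1) in \<open>simp add: h_def\<close>)
  have "log_form g g = (\<integral>p. (case p of (x, y) \<Rightarrow> ln \<bar>x - y\<bar> * (\<rho> x * \<rho> y)) +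
      ((case p of (x, y) \<Rightarrow> ln \<bar>x - y\<bar> * (h x * \<rho> y)) + ((case p of (x, y) \<Rightarrow> ln \<bar>x - y\<bar> * (\<rho> x * h y))
       + (case p of (x, y) \<Rightarrow> ln \<bar>x - y\<bar> * (h x * h y)))) \<partial>unit_square)"
    unfolding log_form_def
    by (rule Bochner_Integration.integral_cong) (auto simp: h_def algebra_simps)
  also have "\<dots> = log_form \<rho> \<rho> + (log_form h \<rho> + (log_form \<rho> h + log_form h h))"
    unfolding log_form_def
    by (simp only: Bochner_Integration.integral_add Bochner_Integration.integrable_add
        log_form_integrable[OF \<rho>(1) \<rho>(1) \<rho>(2) \<rho>(2)] log_form_integrable[OF h(1) \<rho>(1) h(2) \<rho>(2)]
        log_form_integrable[OF \<rho>(1) h(1) \<rho>(2) h(2)] log_form_integrable[OF h(1) h(1) h(2) h(2)])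
  finally show ?thesis by (simp add: log_form_commute[OF \<rho>(1) h(1)])
qed

section \<open>Admissible measures and their densities\<close>

abbreviation density_measure :: "(real \<Rightarrow> real) \<Rightarrow> real measure" where
  "density_measure g \<equiv> density unit_lborel (\<lambda>x. ennreal (g x))"

lemma integral_density_measure:
  fixes f g :: "real \<Rightarrow> real"
  assumes "g \<in> borel_measurable borel" "f \<in> borel_measurable borel" "\<And>x. 0 \<le> g x"
  shows "(\<integral>x. f x \<partial>density_measure g) = (\<integral>x. f x * g x \<partial>lborel_Icc 0 1)"
  unfolding unit_lborel_def using assms by (subst integral_real_density) (auto simp: mult.commute)

lemma emeasure_density_measure:
  fixes g :: "real \<Rightarrow> real"
  assumes g: "g \<in> borel_measurable borel" "\<And>x. 0 \<le> g x" "\<And>x. g x \<le> C"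
    and [measurable]: "S \<in> sets borel"
  shows "emeasure (density_measure g) (S \<inter> {0..1}) = ennreal (\<integral>x. indicator S x * g x \<partial>lborel_Icc 0 1)"
proof -
  have "\<bar>indicator S x * g x\<bar> \<le> \<bar>C\<bar>" for x
    using g(2,3)[of x] by (auto simp: indicator_def)
  then have i: "integrable (lborel_Icc 0 1) (\<lambda>x. indicator S x * g x)"
    using g(1) by (intro integrable_lborel_Icc_bounded) auto
  have "emeasure (density_measure g) (S \<inter> {0..1}) = (\<integral>\<^sup>+x. ennreal (g x) * indicator (S \<inter> {0..1}) x \<partial>lborel_Icc 0 1)"
    unfolding unit_lborel_def using g(1)
    by (intro emeasure_density) (auto simp: sets_restrict_space)
  also have "\<dots> = (\<integral>\<^sup>+x. ennreal (indicator S x * g x) \<partial>lborel_Icc 0 1)"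
    by (intro nn_integral_cong) (auto simp: indicator_def)
  also have "\<dots> = ennreal (\<integral>x. indicator S x * g x \<partial>lborel_Icc 0 1)"
    using i g(2) by (intro nn_integral_eq_integral) auto
  finally show ?thesis .
qed

lemma admissible_density_measure:
  fixes g :: "real \<Rightarrow> real"
  assumes g: "g \<in> borel_measurable borel" "\<And>x. 0 \<le> g x" "\<And>x. g x \<le> 1 / c"
    and mass: "(\<integral>x. g x \<partial>lborel_Icc 0 1) = 1"
  shows "admissible c (density_measure g)"
  unfolding admissible_def
proof (intro conjI ballI)
  show s: "sets (density_measure g) = sets unit_lborel" by simp
  show "prob_space (density_measure g)"
    using emeasure_density_measure[OF g, of UNIV] mass by (intro prob_spaceI) (simp add: unit_lborel_def)
  fix S assume "S \<in> sets (density_measure g)"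
  then have S: "S \<in> sets borel" "S = S \<inter> {0..1}"
    by (auto simp: unit_lborel_def sets_restrict_space)
  have fin: "emeasure lborel S < \<infinity>"
    using emeasure_mono[of S "{0..1}" lborel] S by (simp add: le_less_trans inf.orderI order_trans)
  have "measure (density_measure g) S = (\<integral>x. indicator S x * g x \<partial>lborel_Icc 0 1)"
    using emeasure_density_measure[OF g S(1)] S(2)[symmetric] g(2)
    by (simp add: measure_def Bochner_Integration.integral_nonneg)
  also have "\<dots> \<le> (\<integral>x. 1 / c * indicator S x \<partial>lborel_Icc 0 1)"
  proof (rule integral_mono)
    have "\<bar>indicator S x * g x\<bar> \<le> 1 / c" for x
      using g(2,3)[of x] order_trans[OF g(2,3)] by (simp add: indicator_def)
    then show "integrable (lborel_Icc 0 1) (\<lambda>x. indicator S x * g x)"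
      using g(1) S(1) by (intro integrable_lborel_Icc_bounded) auto
    show "integrable (lborel_Icc 0 1) (\<lambda>x. 1 / c * indicator S x)"
      using S by (intro integrable_lborel_Icc_bounded[of _ _ _ "\<bar>1 / c\<bar>"]) (auto simp: indicator_def)
    show "indicator S x * g x \<le> 1 / c * indicator S x" for x
      using g(3)[of x] by (simp add: indicator_def)
  qed
  also have "\<dots> = 1 / c * measure lborel S"
  proof -
    have "measure (lborel_Icc 0 1) S = measure lborel S"
      using S by (subst measure_restrict_space) auto
    then have "(\<integral>x. indicator S x \<partial>lborel_Icc 0 1) = measure lborel S"
      using S(2) by simp
    then show ?thesis by (simp only: integral_mult_right_zero)
  qed
  finally show "measure (density_measure g) S \<le> 1 / c * measure lborel S" .
qed

text \<open>The constraint sends null sets to null sets, so Radon-Nikodym applies, and testing it on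
  all measurable sets bounds the density by 1 / c almost everywhere. The representative is extended
  by 0 and clipped, so that it is Borel on the line and satisfies the bounds at every point.\<close>

lemma admissible_imp_density_measure:
  assumes adm: "admissible c \<nu>" and c: "c > 0"
  obtains g where "g \<in> borel_measurable borel" "\<And>x. 0 \<le> g x" "\<And>x. g x \<le> 1 / c"
    "\<nu> = density_measure g" "(\<integral>x. g x \<partial>lborel_Icc 0 1) = 1"
proof -
  let ?M = "lborel_Icc 0 1"
  interpret L: finite_measure ?M by (rule finite_measure_lborel_Icc)
  interpret N: prob_space \<nu> using adm by (simp add: admissible_def)
  have sets: "sets \<nu> = sets ?M" and le: "\<And>S. S \<in> sets ?M \<Longrightarrow> measure \<nu> S \<le> 1 / c * measure lborel S"
    using adm by (auto simp: admissible_def unit_lborel_def)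
  have meas_eq: "measure ?M S = measure lborel S" if "S \<in> sets ?M" for S
    using that by (subst measure_restrict_space) (auto simp: sets_restrict_space)
  have "absolutely_continuous ?M \<nu>"
    unfolding absolutely_continuous_def
  proof
    fix S assume S: "S \<in> null_sets ?M"
    then have "measure \<nu> S \<le> 0" using le[of S] meas_eq[of S] by (auto simp: null_sets_def measure_def)
    then show "S \<in> null_sets \<nu>"
      using S sets measure_nonneg[of \<nu> S] by (auto simp: null_sets_def N.emeasure_eq_measure)
  qed
  from L.Radon_Nikodym[OF this sets] obtain f where f[measurable]: "f \<in> borel_measurable ?M" and \<nu>: "density ?M f = \<nu>"
    by blast
  have fin: "(\<integral>\<^sup>+x. f x \<partial>?M) < \<infinity>"
  proof -
    have "(\<integral>\<^sup>+x. f x \<partial>?M) = (\<integral>\<^sup>+x. f x * indicator (space ?M) x \<partial>?M)"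
      by (intro nn_integral_cong) simp
    also have "\<dots> = emeasure \<nu> (space \<nu>)"
      unfolding \<nu>[symmetric] by (simp only: space_density) (rule emeasure_density[OF f sets.top, symmetric])
    finally show ?thesis using N.emeasure_space_1 by simp
  qed
  have AE_fin: "AE x in ?M. f x \<noteq> \<infinity>"
    using nn_integral_PInf_AE[OF f] fin by auto
  define r where "r x = enn2real (f x)" for x
  have [measurable]: "r \<in> borel_measurable ?M" unfolding r_def by measurable
  have AE_r: "AE x in ?M. f x = ennreal (r x)"
    using AE_fin by (rule AE_mp) (auto intro!: AE_I2 simp: r_def ennreal_enn2real_if)
  have \<nu>_r: "\<nu> = density ?M (\<lambda>x. ennreal (r x))"
    unfolding \<nu>[symmetric] by (intro density_cong AE_r) measurable
  have r_int: "integrable ?M r"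
  proof (rule integrableI_bounded)
    have "(\<integral>\<^sup>+x. ennreal (norm (r x)) \<partial>?M) = (\<integral>\<^sup>+x. f x \<partial>?M)"
      by (intro nn_integral_cong_AE) (use AE_r in \<open>auto simp: r_def\<close>)
    then show "(\<integral>\<^sup>+x. ennreal (norm (r x)) \<partial>?M) < \<infinity>" using fin by simp
  qed measurable
  have "AE x in ?M. 0 \<le> 1 / c - r x"
  proof (rule L.density_nonneg)
    show "integrable ?M (\<lambda>x. 1 / c - r x)" using r_int by simp
    fix S assume S[measurable]: "S \<in> sets ?M"
    have i: "integrable ?M (\<lambda>x. indicator S x * r x)"
      using integrable_mult_indicator[OF S r_int] by simp
    have i': "integrable ?M (\<lambda>x. indicator S x * (1 / c))"
      by (intro integrable_mult_left integrable_real_indicator S) (simp add: less_top[symmetric])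
    have "(\<integral>x. indicator S x * r x \<partial>?M) = measure \<nu> S"
    proof -
      have "ennreal (measure \<nu> S) = (\<integral>\<^sup>+x. ennreal (r x) * indicator S x \<partial>?M)"
        unfolding N.emeasure_eq_measure[symmetric] unfolding \<nu>_r using S by (intro emeasure_density) measurable
      also have "\<dots> = (\<integral>\<^sup>+x. ennreal (indicator S x * r x) \<partial>?M)"
        by (intro nn_integral_cong) (auto simp: indicator_def)
      also have "\<dots> = ennreal (\<integral>x. indicator S x * r x \<partial>?M)"
        by (intro nn_integral_eq_integral i) (auto simp: r_def)
      finally show ?thesis by (simp add: r_def Bochner_Integration.integral_nonneg)
    qed
    moreover have "(\<integral>x. indicator S x * (1 / c) \<partial>?M) = 1 / c * measure lborel S"
      using meas_eq[OF S] sets.sets_into_space[OF S] by (simp add: Int_absorb2)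
    moreover have "(LINT x:S|?M. 1 / c - r x) = (\<integral>x. indicator S x * (1 / c) \<partial>?M) - (\<integral>x. indicator S x * r x \<partial>?M)"
      unfolding set_lebesgue_integral_def
      by (subst Bochner_Integration.integral_diff[OF i' i, symmetric]) (simp add: algebra_simps)
    ultimately show "0 \<le> (LINT x:S|?M. 1 / c - r x)" using le[OF S] c by auto
  qed
  then have AE_le: "AE x in ?M. r x \<le> 1 / c" by auto
  define g where "g x = max 0 (min (1 / c) (indicator {0..1} x * r x))" for x
  have [measurable]: "g \<in> borel_measurable borel"
  proof -
    have "(\<lambda>x. r x * indicator {0..1} x) \<in> borel_measurable lborel"
      using \<open>r \<in> borel_measurable ?M\<close> by (subst (asm) borel_measurable_restrict_space_iff) (auto simp: mult.commute)
    then have [measurable]: "(\<lambda>x. indicator {0..1} x * r x) \<in> borel_measurable borel" by (simp add: mult.commute)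
    show ?thesis unfolding g_def by measurable
  qed
  have "AE x in ?M. r x = g x"
    using AE_le by (rule AE_mp) (auto intro!: AE_I2 simp: g_def r_def)
  then have \<nu>_g: "\<nu> = density_measure g"
    unfolding unit_lborel_def \<nu>_r by (intro density_cong) (auto elim: AE_mp)
  have g: "\<And>x. 0 \<le> g x" "\<And>x. g x \<le> 1 / c" using c by (auto simp: g_def)
  have "ennreal (\<integral>x. indicator UNIV x * g x \<partial>?M) = emeasure \<nu> (space \<nu>)"
    using emeasure_density_measure[OF \<open>g \<in> borel_measurable borel\<close> g, of UNIV]
    by (simp add: \<nu>_g unit_lborel_def)
  then have "(\<integral>x. g x \<partial>?M) = 1"
    using N.emeasure_space_1 by (simp flip: ennreal_1 add: g Bochner_Integration.integral_nonneg del: ennreal_1)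
  then show ?thesis using that[OF \<open>g \<in> borel_measurable borel\<close> g \<nu>_g] by simp
qed

lemma energy_density_measure:
  fixes g V :: "real \<Rightarrow> real"
  assumes g: "g \<in> borel_measurable borel" "\<And>x. 0 \<le> g x" "\<And>x. g x \<le> C"
    and V: "ext_field V \<in> borel_measurable borel"
  shows "energy V c (density_measure g) = - c * log_form g g + (\<integral>x. g x * ext_field V x \<partial>lborel_Icc 0 1)"
proof -
  have gC: "\<bar>g x\<bar> \<le> C" for x using g(2,3)[of x] by simp
  have ln_inv: "ln (1 / u) = - ln u" for u :: real by (cases "u = 0") (simp_all add: ln_div)
  have "(\<integral>y. ln (1 / \<bar>x - y\<bar>) \<partial>density_measure g) = - log_pot g x" for x
    unfolding ln_inv using g(1,2)
    by (subst integral_density_measure) (simp_all add: log_pot_def)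
  moreover have "(\<integral>x. - log_pot g x \<partial>density_measure g) = - log_form g g"
  proof -
    have "log_pot g \<in> borel_measurable borel"
    proof -
      interpret L: finite_measure "lborel_Icc 0 1" by (rule finite_measure_lborel_Icc)
      have "(\<lambda>q. g (snd q)) \<in> borel_measurable (borel \<Otimes>\<^sub>M lborel_Icc 0 1)"
        by (rule measurable_compose[OF measurable_snd_lborel_Icc g(1)])
      then have "(\<lambda>(x, y). ln \<bar>x - y\<bar> * g y) \<in> borel_measurable (borel \<Otimes>\<^sub>M lborel_Icc 0 1)"
        unfolding case_prod_beta' by measurable
      then show ?thesis unfolding log_pot_def[abs_def] by (rule L.borel_measurable_lebesgue_integral)
    qed
    then show ?thesis using g(1,2)
      by (subst integral_density_measure) (simp_all add: log_form_eq_log_pot(1)[OF g(1) g(1) gC gC] mult.commute)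
  qed
  moreover have "(\<integral>x. ext_field V x \<partial>density_measure g) = (\<integral>x. g x * ext_field V x \<partial>lborel_Icc 0 1)"
    using g V by (subst integral_density_measure) (simp_all add: mult.commute)
  ultimately show ?thesis by (simp add: energy_def)
qed

text \<open>The square of the primitive of g - \<rho> is continuous and nonnegative with integral 0,
  so the primitive vanishes on [0,1]. The measures then agree on initial segments, an
  intersection-stable generator.\<close>

lemma density_measure_eqI:
  fixes g \<rho> :: "real \<Rightarrow> real"
  assumes g: "g \<in> borel_measurable borel" "\<And>x. 0 \<le> g x" "\<And>x. g x \<le> C" "(\<integral>x. g x \<partial>lborel_Icc 0 1) = 1"
    and \<rho>: "\<rho> \<in> borel_measurable borel" "\<And>x. 0 \<le> \<rho> x" "\<And>x. \<rho> x \<le> C" "(\<integral>x. \<rho> x \<partial>lborel_Icc 0 1) = 1"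
    and H: "(\<integral>z. (\<integral>x. indicator {..z} x * (g x - \<rho> x) \<partial>lborel_Icc 0 1)\<^sup>2 \<partial>lborel_Icc 0 1) = 0"
  shows "density_measure g = density_measure \<rho>"
proof -
  define h where "h x = g x - \<rho> x" for x
  define H where "H z = (\<integral>x. indicator {..z} x * h x \<partial>lborel_Icc 0 1)" for z
  have h: "h \<in> borel_measurable borel" "\<And>x. \<bar>h x\<bar> \<le> C"
  proof -
    show "\<bar>h x\<bar> \<le> C" for x using g(2,3)[of x] \<rho>(2,3)[of x] by (simp add: h_def)
  qed (use g(1) \<rho>(1) in \<open>simp add: h_def[abs_def]\<close>)
  have h_int: "integrable (lborel_Icc 0 z) h" for z
    using h by (intro integrable_lborel_Icc_bounded) auto
  have H_eq: "H z = integral {0..z} h" if "z \<in> {0..1}" for z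
  proof -
    have "H z = (\<integral>x. h x \<partial>lborel_Icc 0 z)"
      unfolding H_def integral_lborel_Icc set_lebesgue_integral_def
      using that by (intro Bochner_Integration.integral_cong) (auto simp: indicator_def)
    also have "\<dots> = integral {0..z} h"
      by (rule integral_unique[OF has_integral_lborel_Icc[OF h_int], symmetric])
    finally show ?thesis .
  qed
  have "continuous_on {0..1} (\<lambda>z. integral {0..z} h)"
    using has_integral_integrable[OF has_integral_lborel_Icc[OF h_int]] by (rule indefinite_integral_continuous_1)
  then have "continuous_on {0..1} H"
    by (rule continuous_on_eq) (simp add: H_eq)
  then have contH2: "continuous_on {0..1} (\<lambda>z. (H z)\<^sup>2)" by (intro continuous_intros)
  have int0: "integral {0..1} (\<lambda>z. (H z)\<^sup>2) = 0"
  proof -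
    have "((\<lambda>z. (H z)\<^sup>2) has_integral integral {0..1} (\<lambda>z. (H z)\<^sup>2)) {0..1}"
      by (intro integrable_integral integrable_continuous_real contH2)
    from lborel_Icc_integral_continuous(2)[OF contH2 this] show ?thesis
      using H by (simp add: H_def h_def)
  qed
  then have H0: "H z = 0" if "z \<in> {0..1}" for z
    using integral_eq_0_iff[OF contH2] int0 that by auto
  have H_all: "H z = 0" for z
  proof -
    consider "z < 0" | "z \<in> {0..1}" | "z > 1" by fastforce
    then show ?thesis
    proof cases
      case 1
      then have "H z = (\<integral>x. 0 \<partial>lborel_Icc 0 1)" unfolding H_def
        by (intro Bochner_Integration.integral_cong) auto
      then show ?thesis by simp
    next
      case 3
      then have "H z = H 1" unfolding H_def
        by (intro Bochner_Integration.integral_cong) (auto simp: indicator_def)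
      then show ?thesis using H0 by simp
    qed (rule H0)
  qed
  have diff: "(\<integral>x. indicator {..z} x * g x \<partial>lborel_Icc 0 1) = (\<integral>x. indicator {..z} x * \<rho> x \<partial>lborel_Icc 0 1)" for z
  proof -
    have i: "integrable (lborel_Icc 0 1) (\<lambda>x. indicator {..z} x * f x)"
      if "f \<in> borel_measurable borel" "\<And>x. 0 \<le> f x" "\<And>x. f x \<le> C" for f
    proof -
      have "\<bar>indicator {..z} x * f x\<bar> \<le> C" for x
        using that(2,3)[of x] order_trans[OF that(2,3)] by (simp add: indicator_def)
      then show ?thesis using that(1) by (intro integrable_lborel_Icc_bounded) auto
    qed
    have "H z = (\<integral>x. indicator {..z} x * g x - indicator {..z} x * \<rho> x \<partial>lborel_Icc 0 1)"
      by (simp add: H_def h_def right_diff_distrib)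
    also have "\<dots> = (\<integral>x. indicator {..z} x * g x \<partial>lborel_Icc 0 1) - (\<integral>x. indicator {..z} x * \<rho> x \<partial>lborel_Icc 0 1)"
      by (intro Bochner_Integration.integral_diff i g \<rho>)
    finally show ?thesis using H_all[of z] by simp
  qed
  have em: "emeasure (density_measure g) ({..z} \<inter> {0..1}) = emeasure (density_measure \<rho>) ({..z} \<inter> {0..1})" for z
    by (subst emeasure_density_measure[OF g(1-3)], simp, subst emeasure_density_measure[OF \<rho>(1-3)], simp) (simp only: diff)
  show ?thesis
  proof (rule measure_eqI_generator_eq[of "range (\<lambda>z. {..z} \<inter> {0..1})" "{0..1}" _ _ "\<lambda>_. {..1} \<inter> {0..1}"])
    show "Int_stable (range (\<lambda>z::real. {..z} \<inter> {0..1}))"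
    proof (rule Int_stableI, clarify)
      fix y z :: real
      have "({..y} \<inter> {0..1}) \<inter> ({..z} \<inter> {0..1}) = {..min y z} \<inter> {0..1}" by auto
      then show "({..y} \<inter> {0..1}) \<inter> ({..z} \<inter> {0..1}) \<in> range (\<lambda>z::real. {..z} \<inter> {0..1})" by blast
    qed
    have "sets unit_lborel = sigma_sets {0..1} (range (\<lambda>z. {..z} \<inter> {0..1}))"
    proof -
      have b: "sets (borel :: real measure) = sigma_sets UNIV (range (\<lambda>z. {..z}))"
        by (simp add: borel_eq_atMost)
      have "sets unit_lborel = (\<inter>) {0..1} ` sigma_sets UNIV (range (\<lambda>z::real. {..z}))"
        by (simp add: unit_lborel_def sets_restrict_space b)
      also have "\<dots> = sigma_sets {0..1} ((\<inter>) {0..1} ` range (\<lambda>z::real. {..z}))"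
        by (rule sigma_sets_Int) (auto simp flip: b)
      also have "(\<inter>) {0..1} ` range (\<lambda>z::real. {..z}) = range (\<lambda>z. {..z} \<inter> {0..1})"
        by (auto simp: image_image Int_commute)
      finally show ?thesis .
    qed
    then show "sets (density_measure g) = sigma_sets {0..1} (range (\<lambda>z. {..z} \<inter> {0..1}))"
      "sets (density_measure \<rho>) = sigma_sets {0..1} (range (\<lambda>z. {..z} \<inter> {0..1}))" by simp_all
    show "emeasure (density_measure g) ({..1} \<inter> {0..1}) \<noteq> \<infinity>"
      by (subst emeasure_density_measure[OF g(1-3)]) simp_all
  qed (use em in auto)
qed

text \<open>With h = g - \<rho> the energy gap is the integral of h times the variational derivative
  plus c times the logarithmic energy of h. The first summand is nonnegative by the conditions. The
  second dominates c times the integral of the squared primitive of h, so a second minimizer has the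
  same primitive.\<close>

theorem variational_conditions_sufficient:
  fixes \<rho> V :: "real \<Rightarrow> real"
  assumes c: "c > 0"
    and \<rho>: "\<rho> \<in> borel_measurable borel" "\<And>x. 0 \<le> \<rho> x" "\<And>x. \<rho> x \<le> 1 / c" "(\<integral>x. \<rho> x \<partial>lborel_Icc 0 1) = 1"
    and V: "ext_field V \<in> borel_measurable borel" "\<And>x. x \<in> {0..1} \<Longrightarrow> \<bar>ext_field V x\<bar> \<le> B"
    and pos: "AE x in lborel_Icc 0 1. 0 < \<rho> x \<longrightarrow> - 2 * c * log_pot \<rho> x + ext_field V x \<le> l"
    and sat: "AE x in lborel_Icc 0 1. \<rho> x < 1 / c \<longrightarrow> l \<le> - 2 * c * log_pot \<rho> x + ext_field V x"
  shows "is_unique_minimizer V c (density_measure \<rho>)"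
proof -
  have key: "energy V c (density_measure \<rho>) + c * (\<integral>z. (\<integral>x. indicator {..z} x * (g x - \<rho> x) \<partial>lborel_Icc 0 1)\<^sup>2 \<partial>lborel_Icc 0 1)
      \<le> energy V c (density_measure g)"
    if g: "g \<in> borel_measurable borel" "\<And>x. 0 \<le> g x" "\<And>x. g x \<le> 1 / c" "(\<integral>x. g x \<partial>lborel_Icc 0 1) = 1" for g
  proof -
    define h where "h x = g x - \<rho> x" for x
    have abs: "\<bar>g x\<bar> \<le> 1 / c" "\<bar>\<rho> x\<bar> \<le> 1 / c" "\<bar>h x\<bar> \<le> 1 / c" for x
      using g(2,3)[of x] \<rho>(2,3)[of x] by (auto simp: h_def)
    have h: "h \<in> borel_measurable borel" using g(1) \<rho>(1) by (simp add: h_def[abs_def])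
    have int: "integrable (lborel_Icc 0 1) g" "integrable (lborel_Icc 0 1) \<rho>" "integrable (lborel_Icc 0 1) h"
      by (intro integrable_lborel_Icc_bounded[of _ _ _ "1 / c"] measurable_lborel_Icc abs g \<rho> h)+
    have mean: "(\<integral>x. h x \<partial>lborel_Icc 0 1) = 0"
      using g(4) \<rho>(4) int by (simp add: h_def)
    have fV: "integrable (lborel_Icc 0 1) (\<lambda>x. f x * ext_field V x)" if "integrable (lborel_Icc 0 1) f" for f
      by (rule integrable_mult_bounded[OF that, of _ B]) (use V in auto)
    have hp: "integrable (lborel_Icc 0 1) (\<lambda>x. h x * log_pot \<rho> x)"
      by (rule log_form_eq_log_pot(2)[OF h \<rho>(1) abs(3) abs(2)])
    \<comment> \<open>Since h has mean zero, l may be subtracted from the variational derivative.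
      Where the difference is negative, \<rho> = 1 / c and h \<le> 0; where it is positive, \<rho> =
      0 and h \<ge> 0.\<close>
    have "(\<integral>x. h x * (- 2 * c * log_pot \<rho> x + ext_field V x - l) \<partial>lborel_Icc 0 1) \<ge> 0"
    proof (rule integral_nonneg_AE)
      show "AE x in lborel_Icc 0 1. 0 \<le> h x * (- 2 * c * log_pot \<rho> x + ext_field V x - l)"
        using pos sat
      proof eventually_elim
        case (elim x)
        show ?case
        proof (cases "- 2 * c * log_pot \<rho> x + ext_field V x - l" "0 :: real" rule: linorder_cases)
          case less
          then have "\<rho> x = 1 / c" using elim \<rho>(3)[of x] by linarith
          then show ?thesis using g(3)[of x] less by (intro mult_nonpos_nonpos) (auto simp: h_def)
        next
          case greater
          then have "\<rho> x = 0" using elim \<rho>(2)[of x] by linarith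
          then show ?thesis using g(2)[of x] greater by (intro mult_nonneg_nonneg) (auto simp: h_def)
        qed simp
      qed
    qed
    also have "(\<integral>x. h x * (- 2 * c * log_pot \<rho> x + ext_field V x - l) \<partial>lborel_Icc 0 1)
      = (\<integral>x. (- 2 * c) * (h x * log_pot \<rho> x) + (h x * ext_field V x - l * h x) \<partial>lborel_Icc 0 1)"
      by (intro Bochner_Integration.integral_cong refl) (simp add: algebra_simps)
    also have "\<dots> = - 2 * c * log_form h \<rho> + ((\<integral>x. h x * ext_field V x \<partial>lborel_Icc 0 1) - l * 0)"
      by (simp only: Bochner_Integration.integral_add[OF integrable_mult_right[OF hp]
            Bochner_Integration.integrable_diff[OF fV[OF int(3)] integrable_mult_right[OF int(3)]]]
          Bochner_Integration.integral_diff[OF fV[OF int(3)] integrable_mult_right[OF int(3)]]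
          integral_mult_right_zero mean log_form_eq_log_pot(1)[OF h \<rho>(1) abs(3) abs(2)])
    also have "(\<integral>x. h x * ext_field V x \<partial>lborel_Icc 0 1)
      = (\<integral>x. g x * ext_field V x \<partial>lborel_Icc 0 1) - (\<integral>x. \<rho> x * ext_field V x \<partial>lborel_Icc 0 1)"
      by (simp only: Bochner_Integration.integral_diff[OF fV[OF int(1)] fV[OF int(2)], symmetric] h_def left_diff_distrib)
    finally have lin: "0 \<le> - 2 * c * log_form h \<rho> + ((\<integral>x. g x * ext_field V x \<partial>lborel_Icc 0 1)
       - (\<integral>x. \<rho> x * ext_field V x \<partial>lborel_Icc 0 1))" by simp
    have quad: "(\<integral>z. (\<integral>x. indicator {..z} x * h x \<partial>lborel_Icc 0 1)\<^sup>2 \<partial>lborel_Icc 0 1) \<le> - log_form h h"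
      using log_energy_ge[OF h abs(3) mean] by (simp add: log_form_def case_prod_beta')
    have "log_form g g = log_form \<rho> \<rho> + 2 * log_form h \<rho> + log_form h h"
      using log_form_quadratic_expansion[OF g(1) abs(1) \<rho>(1) abs(2)] by (simp add: h_def[abs_def])
    then have "energy V c (density_measure g) - energy V c (density_measure \<rho>) = c * (- log_form h h)
      + (- 2 * c * log_form h \<rho> + ((\<integral>x. g x * ext_field V x \<partial>lborel_Icc 0 1) - (\<integral>x. \<rho> x * ext_field V x \<partial>lborel_Icc 0 1)))"
      by (simp add: energy_density_measure[OF g(1-3) V(1)] energy_density_measure[OF \<rho>(1-3) V(1)] algebra_simps)
    also have "\<dots> \<ge> c * (\<integral>z. (\<integral>x. indicator {..z} x * h x \<partial>lborel_Icc 0 1)\<^sup>2 \<partial>lborel_Icc 0 1)"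
      using mult_left_mono[OF quad, of c] lin c by linarith
    finally show ?thesis by (simp add: h_def)
  qed
  have sq: "0 \<le> (\<integral>z. (\<integral>x. indicator {..z} x * (g x - \<rho> x) \<partial>lborel_Icc 0 1)\<^sup>2 \<partial>lborel_Icc 0 1)" for g
    by (intro Bochner_Integration.integral_nonneg) simp
  have min: "is_minimizer V c (density_measure \<rho>)"
    unfolding is_minimizer_def
  proof (intro conjI allI impI)
    show "admissible c (density_measure \<rho>)" by (rule admissible_density_measure[OF \<rho>])
    fix \<nu> assume "admissible c \<nu>"
    from admissible_imp_density_measure[OF this c] obtain g where
      g: "g \<in> borel_measurable borel" "\<And>x. 0 \<le> g x" "\<And>x. g x \<le> 1 / c" "\<nu> = density_measure g"
        "(\<integral>x. g x \<partial>lborel_Icc 0 1) = 1" by metis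
    show "energy V c (density_measure \<rho>) \<le> energy V c \<nu>"
      unfolding g(4) using key[OF g(1-3,5)] mult_nonneg_nonneg[OF less_imp_le[OF c] sq[of g]] by linarith
  qed
  show ?thesis
    unfolding is_unique_minimizer_def
  proof (intro conjI allI impI min)
    fix \<nu> assume \<nu>: "is_minimizer V c \<nu>"
    then have "admissible c \<nu>" by (simp add: is_minimizer_def)
    from admissible_imp_density_measure[OF this c] obtain g where
      g: "g \<in> borel_measurable borel" "\<And>x. 0 \<le> g x" "\<And>x. g x \<le> 1 / c" "\<nu> = density_measure g"
        "(\<integral>x. g x \<partial>lborel_Icc 0 1) = 1" by metis
    have "energy V c \<nu> \<le> energy V c (density_measure \<rho>)"
      using \<nu> min by (simp add: is_minimizer_def)
    then have "c * (\<integral>z. (\<integral>x. indicator {..z} x * (g x - \<rho> x) \<partial>lborel_Icc 0 1)\<^sup>2 \<partial>lborel_Icc 0 1) \<le> 0"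
      using key[OF g(1-3,5)] unfolding g(4) by linarith
    then have "(\<integral>z. (\<integral>x. indicator {..z} x * (g x - \<rho> x) \<partial>lborel_Icc 0 1)\<^sup>2 \<partial>lborel_Icc 0 1) = 0"
      using sq[of g] c by (simp add: mult_le_0_iff)
    then show "\<nu> = density_measure \<rho>"
      unfolding g(4) by (rule density_measure_eqI[OF g(1-3,5) \<rho>])
  qed
qed

section \<open>Arctangent profiles and their potentials\<close>

text \<open>The solution y of k tan t = 1 / T(y), where T(y)^2 = (\<beta> - y) / (y - \<alpha>); it
  moves from \<alpha> at t = 0 to \<beta> at t = pi / 2. The image of the uniform distribution of t
  is the balayage onto the band of the point mass at p, if k^2 = (p - \<alpha>) / (p -
  \<beta>).\<close>

definition band_point :: "real \<Rightarrow> real \<Rightarrow> real \<Rightarrow> real \<Rightarrow> real" where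
  "band_point \<alpha> \<beta> k t = (\<alpha> * (cos t)\<^sup>2 + \<beta> * (k\<^sup>2 * (sin t)\<^sup>2)) / ((cos t)\<^sup>2 + k\<^sup>2 * (sin t)\<^sup>2)"

text \<open>The values pi / 2 and 0 off the band continue the one-sided limits of the arctangent;
  they are the measures of all angles and of none.\<close>

definition band_profile :: "real \<Rightarrow> real \<Rightarrow> real \<Rightarrow> real \<Rightarrow> real" where
  "band_profile \<alpha> \<beta> k y =
     (if y \<le> \<alpha> then pi / 2 else if y < \<beta> then arctan (k * sqrt ((\<beta> - y) / (y - \<alpha>))) else 0)"

lemma borel_measurable_band_profile [measurable]: "band_profile \<alpha> \<beta> k \<in> borel_measurable borel"
  unfolding band_profile_def[abs_def] by measurable

lemma borel_measurable_band_point [measurable]: "band_point \<alpha> \<beta> k \<in> borel_measurable borel"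
  unfolding band_point_def[abs_def] by measurable

lemma band_weight_pos: "k > 0 \<Longrightarrow> (cos t)\<^sup>2 + k\<^sup>2 * (sin t)\<^sup>2 > (0::real)"
  using weighted_cos_sin_pos[of 1 "k\<^sup>2" t] by simp

lemma band_point_eq:
  assumes "k > 0"
  shows "band_point \<alpha> \<beta> k t = \<beta> - (\<beta> - \<alpha>) * ((cos t)\<^sup>2 / ((cos t)\<^sup>2 + k\<^sup>2 * (sin t)\<^sup>2))"
  using band_weight_pos[OF assms, of t] unfolding band_point_def by (simp add: field_simps)

lemma diff_band_point:
  assumes "k > 0"
  shows "s - band_point \<alpha> \<beta> k t
    = ((s - \<alpha>) * (cos t)\<^sup>2 + k\<^sup>2 * (s - \<beta>) * (sin t)\<^sup>2) / ((cos t)\<^sup>2 + k\<^sup>2 * (sin t)\<^sup>2)"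
  using band_weight_pos[OF assms, of t] unfolding band_point_def by (simp add: field_simps)

lemma band_point_bounds:
  assumes "\<alpha> < \<beta>" "k > 0"
  shows "\<alpha> \<le> band_point \<alpha> \<beta> k t" "band_point \<alpha> \<beta> k t \<le> \<beta>"
proof -
  define v where "v = (cos t)\<^sup>2 / ((cos t)\<^sup>2 + k\<^sup>2 * (sin t)\<^sup>2)"
  have "0 \<le> v" "v \<le> 1" using band_weight_pos[of k t] assms by (auto simp: v_def)
  then have "0 \<le> (\<beta> - \<alpha>) * v" "(\<beta> - \<alpha>) * v \<le> (\<beta> - \<alpha>) * 1"
    using assms by (auto intro!: mult_left_mono)
  then show "\<alpha> \<le> band_point \<alpha> \<beta> k t" "band_point \<alpha> \<beta> k t \<le> \<beta>"
    using assms by (auto simp: band_point_eq v_def)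
qed

lemma less_band_point_iff:
  assumes "k > 0"
  shows "y < band_point \<alpha> \<beta> k t \<longleftrightarrow> (y - \<alpha>) * (cos t)\<^sup>2 < k\<^sup>2 * (\<beta> - y) * (sin t)\<^sup>2"
  using band_weight_pos[OF assms, of t] unfolding band_point_def by (simp add: pos_less_divide_eq algebra_simps)

lemma integrable_continuous_band_point:
  fixes g :: "real \<Rightarrow> real"
  assumes k: "k > 0" and g: "continuous_on UNIV g"
  shows "integrable quarter (\<lambda>t. g (band_point \<alpha> \<beta> k t))"
proof -
  have "continuous_on {0..pi / 2} (band_point \<alpha> \<beta> k)"
    unfolding band_point_def[abs_def] using band_weight_pos[OF k]
    by (intro continuous_intros) (auto simp: less_imp_neq[symmetric])
  then have "continuous_on {0..pi / 2} (\<lambda>t. g (band_point \<alpha> \<beta> k t))"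
    by (rule continuous_on_compose2[OF g]) auto
  then show ?thesis
    using borel_integrable_atLeastAtMost' by (simp add: integrable_lborel_Icc_iff)
qed

text \<open>The profile is the layer-cake representation of the map \<open>band_point\<close>, so its logarithmic
  potential is an average of potentials of intervals.\<close>

lemma band_profile_layer_cake:
  assumes ab: "\<alpha> < \<beta>" and k: "k > 0"
  shows "(\<integral>t. indicator {..<band_point \<alpha> \<beta> k t} y \<partial>quarter) = band_profile \<alpha> \<beta> k y"
proof -
  \<comment> \<open>At t = 0 the point is \<alpha>, so the strict inequality fails for y = \<alpha>;
    at t = pi / 2 the comparison of tangents breaks down.\<close>
  have AE_int: "AE t in quarter. t \<in> {0<..<pi / 2}"
    by (rule AE_mp[OF AE_lborel_Icc_not_in_finite[of "{0, pi / 2}"]], simp) (auto intro!: AE_I2)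
  consider "y \<le> \<alpha>" | "\<alpha> < y" "y < \<beta>" | "y \<ge> \<beta>" by linarith
  then show ?thesis
  proof cases
    case 1
    have "(\<integral>t. indicator {..<band_point \<alpha> \<beta> k t} y \<partial>quarter) = (\<integral>t. (1::real) \<partial>quarter)"
    proof (rule integral_cong_AE)
      show "AE t in quarter. indicator {..<band_point \<alpha> \<beta> k t} y = (1::real)"
        using AE_int
      proof eventually_elim
        case (elim t)
        have "(y - \<alpha>) * (cos t)\<^sup>2 \<le> 0" using 1 by (simp add: mult_nonpos_nonneg)
        also have "0 < k\<^sup>2 * (\<beta> - y) * (sin t)\<^sup>2"
          using sin_gt_zero[of t] elim 1 ab k by auto
        finally show ?case using less_band_point_iff[OF k] by simp
      qed
      have "(\<lambda>t. indicator {..<band_point \<alpha> \<beta> k t} y :: real) = (\<lambda>t. if y < band_point \<alpha> \<beta> k t then 1 else 0)"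
        by (auto simp: indicator_def)
      then show "(\<lambda>t. indicator {..<band_point \<alpha> \<beta> k t} y :: real) \<in> borel_measurable quarter" by simp
    qed simp
    then show ?thesis using 1 integral_lborel_Icc_const[of 0 "pi / 2" 1] by (simp add: band_profile_def)
  next
    case 3
    then have "\<not> y < band_point \<alpha> \<beta> k t" for t using band_point_bounds[OF ab k, of t] by linarith
    then show ?thesis using 3 ab by (simp add: band_profile_def)
  next
    case 2
    define T where "T = sqrt ((\<beta> - y) / (y - \<alpha>))"
    have T: "T > 0" and T2: "T\<^sup>2 = (\<beta> - y) / (y - \<alpha>)" using 2 by (auto simp: T_def)
    \<comment> \<open>The angle at which \<open>band_point\<close> passes y: its cotangent is k
      T.\<close>
    define \<theta> where "\<theta> = pi / 2 - arctan (k * T)"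
    have \<theta>: "0 < \<theta>" "\<theta> < pi / 2" using arctan_ubound[of "k * T"] k T by (auto simp: \<theta>_def)
    have iff: "y < band_point \<alpha> \<beta> k t \<longleftrightarrow> \<theta> < t" if t: "t \<in> {0<..<pi / 2}" for t
    proof -
      have pos: "sin t > 0" "cos t > 0" using t sin_gt_zero[of t] cos_gt_zero[of t] by auto
      have "y < band_point \<alpha> \<beta> k t \<longleftrightarrow> (cos t)\<^sup>2 < k\<^sup>2 * T\<^sup>2 * (sin t)\<^sup>2"
        unfolding less_band_point_iff[OF k] T2 using 2 by (simp add: field_simps)
      also have "\<dots> \<longleftrightarrow> (cos t)\<^sup>2 < (k * T * sin t)\<^sup>2" by (simp add: power_mult_distrib)
      also have "\<dots> \<longleftrightarrow> cos t < k * T * sin t"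
        using power_mono_iff[of "k * T * sin t" "cos t" 2] pos k T by (auto simp flip: not_le)
      also have "\<dots> \<longleftrightarrow> cot t < k * T" using pos by (simp add: cot_def field_simps)
      also have "cot t = tan (pi / 2 - t)" by (simp add: cot_def tan_def sin_diff cos_diff)
      also have "tan (pi / 2 - t) < k * T \<longleftrightarrow> tan (pi / 2 - t) < tan (arctan (k * T))"
        by (simp only: tan_arctan)
      also have "\<dots> \<longleftrightarrow> pi / 2 - t < arctan (k * T)"
        using t arctan_bounded[of "k * T"] by (intro tan_mono_lt_eq) auto
      also have "\<dots> \<longleftrightarrow> \<theta> < t" by (auto simp: \<theta>_def)
      finally show ?thesis .
    qed
    have "(\<integral>t. indicator {..<band_point \<alpha> \<beta> k t} y \<partial>quarter) = (\<integral>t. (indicator {\<theta><..} t :: real) \<partial>quarter)"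
    proof (rule integral_cong_AE)
      show "AE t in quarter. indicator {..<band_point \<alpha> \<beta> k t} y = (indicator {\<theta><..} t :: real)"
        using AE_int by eventually_elim (simp add: indicator_def iff)
      have "(\<lambda>t. indicator {..<band_point \<alpha> \<beta> k t} y :: real) = (\<lambda>t. if y < band_point \<alpha> \<beta> k t then 1 else 0)"
        by (auto simp: indicator_def)
      then show "(\<lambda>t. indicator {..<band_point \<alpha> \<beta> k t} y :: real) \<in> borel_measurable quarter" by simp
    qed simp
    also have "\<dots> = pi / 2 - \<theta>"
    proof -
      have "measure quarter {\<theta><..pi / 2} = pi / 2 - \<theta>"
        using \<theta> by (subst measure_restrict_space) auto
      moreover have "{\<theta><..} \<inter> {0..pi / 2} = {\<theta><..pi / 2}" using \<theta> by auto
      ultimately show ?thesis by simp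
    qed
    finally show ?thesis using 2 by (simp add: band_profile_def \<theta>_def T_def)
  qed
qed

lemma integral_band_profile:
  fixes g :: "real \<Rightarrow> real"
  assumes ab: "\<alpha> < \<beta>" and k: "k > 0"
    and g: "integrable (quarter \<Otimes>\<^sub>M lborel_Icc 0 1) (\<lambda>(t, y). g y)"
  shows "(\<integral>y. g y * band_profile \<alpha> \<beta> k y \<partial>lborel_Icc 0 1)
    = (\<integral>t. (\<integral>y. g y * indicator {..<band_point \<alpha> \<beta> k t} y \<partial>lborel_Icc 0 1) \<partial>quarter)"
proof -
  interpret L: finite_measure "lborel_Icc 0 1" by (rule finite_measure_lborel_Icc)
  interpret Q: finite_measure quarter by (rule finite_measure_lborel_Icc)
  interpret P: pair_sigma_finite quarter "lborel_Icc 0 1" ..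
  have eq: "(\<lambda>q. indicator {..<band_point \<alpha> \<beta> k (fst q)} (snd q) :: real)
      = (\<lambda>q. if snd q < band_point \<alpha> \<beta> k (fst q) then 1 else 0)"
    by (auto simp: indicator_def)
  have "(\<lambda>q. indicator {..<band_point \<alpha> \<beta> k (fst q)} (snd q) :: real) \<in> borel_measurable (quarter \<Otimes>\<^sub>M lborel_Icc 0 1)"
    unfolding eq by measurable
  from integrable_mult_bounded[OF g this, of 1]
  have i: "integrable (quarter \<Otimes>\<^sub>M lborel_Icc 0 1) (\<lambda>(t, y). g y * indicator {..<band_point \<alpha> \<beta> k t} y)"
    by (simp add: case_prod_beta' indicator_def)
  have "(\<integral>y. g y * band_profile \<alpha> \<beta> k y \<partial>lborel_Icc 0 1)
    = (\<integral>y. (\<integral>t. g y * indicator {..<band_point \<alpha> \<beta> k t} y \<partial>quarter) \<partial>lborel_Icc 0 1)"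
    by (simp add: band_profile_layer_cake[OF ab k])
  also have "\<dots> = (\<integral>t. (\<integral>y. g y * indicator {..<band_point \<alpha> \<beta> k t} y \<partial>lborel_Icc 0 1) \<partial>quarter)"
    by (rule P.Fubini_integral[OF i])
  finally show ?thesis .
qed

lemma integral_indicator_lessThan:
  fixes g :: "real \<Rightarrow> real"
  assumes "0 \<le> z" "z \<le> 1" and [measurable]: "g \<in> borel_measurable borel"
  shows "(\<integral>y. g y * indicator {..<z} y \<partial>lborel_Icc 0 1) = (\<integral>y. g y \<partial>lborel_Icc 0 z)"
  unfolding integral_lborel_Icc set_lebesgue_integral_def
proof (rule integral_cong_AE)
  have "AE y in lborel. y \<notin> {z}" by (intro AE_not_in finite_imp_null_set_lborel) simp
  then show "AE y in lborel. indicator {0..1} y *\<^sub>R (g y * indicator {..<z} y) = indicator {0..z} y *\<^sub>R g y"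
    by eventually_elim (use assms in \<open>auto simp: indicator_def\<close>)
qed measurable

lemma log_pot_band_profile:
  assumes ab: "0 < \<alpha>" "\<alpha> < \<beta>" "\<beta> < 1" and k: "k > 0"
  shows "log_pot (band_profile \<alpha> \<beta> k) x
    = pi / 2 * ln_prim x - (\<integral>t. ln_prim (x - band_point \<alpha> \<beta> k t) \<partial>quarter)"
proof -
  have i: "integrable (quarter \<Otimes>\<^sub>M lborel_Icc 0 1) (\<lambda>(t, y). ln \<bar>x - y\<bar>)"
    by (rule integrable_ln_abs_diff_pair[OF finite_measure_lborel_Icc, of _ _ _ "\<bar>x\<bar>"]) auto
  have z: "0 \<le> band_point \<alpha> \<beta> k t" "band_point \<alpha> \<beta> k t \<le> 1" for t
    using band_point_bounds[OF ab(2) k, of t] ab by auto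
  have "log_pot (band_profile \<alpha> \<beta> k) x
    = (\<integral>t. ln_prim (x - 0) - ln_prim (x - band_point \<alpha> \<beta> k t) \<partial>quarter)"
    unfolding log_pot_def integral_band_profile[OF ab(2) k i]
    by (intro Bochner_Integration.integral_cong refl)
      (simp add: integral_indicator_lessThan[OF z] ln_abs_diff_integral[OF z(1)])
  also have "\<dots> = (\<integral>t. ln_prim x \<partial>quarter) - (\<integral>t. ln_prim (x - band_point \<alpha> \<beta> k t) \<partial>quarter)"
    by (simp only: diff_0_right) (intro Bochner_Integration.integral_diff
        integrable_continuous_band_point[OF k, of "\<lambda>_. ln_prim x"]
        integrable_continuous_band_point[OF k, of "\<lambda>z. ln_prim (x - z)"] continuous_intros)
  finally show ?thesis using integral_lborel_Icc_const[of 0 "pi / 2" "ln_prim x"] by simp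
qed

lemma mass_band_profile:
  assumes ab: "0 < \<alpha>" "\<alpha> < \<beta>" "\<beta> < 1" and k: "k > 0"
  shows "(\<integral>y. band_profile \<alpha> \<beta> k y \<partial>lborel_Icc 0 1) = pi / 2 * (\<beta> - (\<beta> - \<alpha>) / (1 + k))"
proof -
  interpret L: finite_measure "lborel_Icc 0 1" by (rule finite_measure_lborel_Icc)
  interpret Q: finite_measure quarter by (rule finite_measure_lborel_Icc)
  interpret P: finite_measure "quarter \<Otimes>\<^sub>M lborel_Icc 0 1"
    by (intro finite_measure_pair_measure finite_measure_lborel_Icc)
  have i: "integrable (quarter \<Otimes>\<^sub>M lborel_Icc 0 1) (\<lambda>(t, y). 1 :: real)"
    by (simp add: case_prod_beta')
  have z: "0 \<le> band_point \<alpha> \<beta> k t" "band_point \<alpha> \<beta> k t \<le> 1" for t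
    using band_point_bounds[OF ab(2) k, of t] ab by auto
  define v where "v t = (cos t)\<^sup>2 / ((cos t)\<^sup>2 + k\<^sup>2 * (sin t)\<^sup>2)" for t
  have "(\<integral>y. 1 * band_profile \<alpha> \<beta> k y \<partial>lborel_Icc 0 1) = (\<integral>t. band_point \<alpha> \<beta> k t \<partial>quarter)"
    unfolding integral_band_profile[OF ab(2) k i]
  proof (intro Bochner_Integration.integral_cong refl)
    fix t
    have "(\<integral>y. 1 * indicator {..<band_point \<alpha> \<beta> k t} y \<partial>lborel_Icc 0 1)
        = (\<integral>y. (1::real) \<partial>lborel_Icc 0 (band_point \<alpha> \<beta> k t))"
      by (rule integral_indicator_lessThan[OF z]) simp
    also have "\<dots> = (band_point \<alpha> \<beta> k t - 0) * 1" by (rule integral_lborel_Icc_const[OF z(1)])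
    finally show "(\<integral>y. 1 * indicator {..<band_point \<alpha> \<beta> k t} y \<partial>lborel_Icc 0 1) = band_point \<alpha> \<beta> k t"
      by simp
  qed
  also have "\<dots> = (\<integral>t. \<beta> - (\<beta> - \<alpha>) * v t \<partial>quarter)"
    by (simp add: band_point_eq[OF k] v_def)
  also have "\<dots> = pi / 2 * \<beta> - (\<beta> - \<alpha>) * (pi / 2 / (1 + k))"
  proof -
    have "continuous_on {0..pi / 2} v"
      unfolding v_def using band_weight_pos[OF k] by (intro continuous_intros) (auto simp: less_imp_neq[symmetric])
    then have "integrable quarter v"
      using borel_integrable_atLeastAtMost' by (simp add: integrable_lborel_Icc_iff)
    then have "(\<integral>t. \<beta> - (\<beta> - \<alpha>) * v t \<partial>quarter) = (\<integral>t. \<beta> \<partial>quarter) - (\<beta> - \<alpha>) * (\<integral>t. v t \<partial>quarter)"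
      by (subst Bochner_Integration.integral_diff) auto
    then show ?thesis
      using quarter_cos2_weight[OF k] integral_lborel_Icc_const[of 0 "pi / 2" \<beta>] by (simp add: v_def)
  qed
  finally show ?thesis by (simp add: algebra_simps)
qed

text \<open>The logarithmic potential of the image of \<open>quarter\<close> under
  \<open>band_point\<close>, that is, of pi / 2 times the balayage.\<close>

definition band_ln_pot :: "real \<Rightarrow> real \<Rightarrow> real \<Rightarrow> real \<Rightarrow> real" where
  "band_ln_pot \<alpha> \<beta> k s = (\<integral>t. ln \<bar>s - band_point \<alpha> \<beta> k t\<bar> \<partial>quarter)"

text \<open>Formally \<open>band_ln_pot\<close> is the derivative of the averaged
  \<open>ln_prim\<close>. Stating this for increments lets Fubini replace differentiation under an
  integral with a logarithmic pole.\<close>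

lemma ln_prim_band_point_increment:
  assumes ab: "\<alpha> < \<beta>" and k: "k > 0" and x: "x0 \<le> x"
  shows "(\<integral>t. ln_prim (x - band_point \<alpha> \<beta> k t) \<partial>quarter) - (\<integral>t. ln_prim (x0 - band_point \<alpha> \<beta> k t) \<partial>quarter)
      = (\<integral>s. band_ln_pot \<alpha> \<beta> k s \<partial>lborel_Icc x0 x)"
    and "integrable (lborel_Icc x0 x) (band_ln_pot \<alpha> \<beta> k)"
proof -
  interpret L: finite_measure "lborel_Icc x0 x" by (rule finite_measure_lborel_Icc)
  interpret Q: finite_measure quarter by (rule finite_measure_lborel_Icc)
  interpret P: pair_sigma_finite quarter "lborel_Icc x0 x" ..
  have i: "integrable (quarter \<Otimes>\<^sub>M lborel_Icc x0 x) (\<lambda>(t, s). ln \<bar>band_point \<alpha> \<beta> k t - s\<bar>)"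
  proof (rule integrable_ln_abs_diff_pair[OF finite_measure_lborel_Icc, of _ _ _ "\<bar>\<alpha>\<bar> + \<bar>\<beta>\<bar>"])
    show "\<bar>band_point \<alpha> \<beta> k t\<bar> \<le> \<bar>\<alpha>\<bar> + \<bar>\<beta>\<bar>" for t using band_point_bounds[OF ab k, of t] by auto
  qed (use x in auto)
  have "(\<integral>s. band_ln_pot \<alpha> \<beta> k s \<partial>lborel_Icc x0 x)
     = (\<integral>s. (\<integral>t. ln \<bar>band_point \<alpha> \<beta> k t - s\<bar> \<partial>quarter) \<partial>lborel_Icc x0 x)"
    by (simp add: band_ln_pot_def abs_minus_commute)
  also have "\<dots> = (\<integral>t. (\<integral>s. ln \<bar>band_point \<alpha> \<beta> k t - s\<bar> \<partial>lborel_Icc x0 x) \<partial>quarter)"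
    by (rule P.Fubini_integral[OF i])
  also have "\<dots> = (\<integral>t. ln_prim (x - band_point \<alpha> \<beta> k t) - ln_prim (x0 - band_point \<alpha> \<beta> k t) \<partial>quarter)"
  proof (intro Bochner_Integration.integral_cong refl)
    fix t
    show "(\<integral>s. ln \<bar>band_point \<alpha> \<beta> k t - s\<bar> \<partial>lborel_Icc x0 x)
      = ln_prim (x - band_point \<alpha> \<beta> k t) - ln_prim (x0 - band_point \<alpha> \<beta> k t)"
      using ln_prim_minus[of "x - band_point \<alpha> \<beta> k t"] ln_prim_minus[of "x0 - band_point \<alpha> \<beta> k t"]
      by (simp add: ln_abs_diff_integral[OF x])
  qed
  also have "\<dots> = (\<integral>t. ln_prim (x - band_point \<alpha> \<beta> k t) \<partial>quarter) - (\<integral>t. ln_prim (x0 - band_point \<alpha> \<beta> k t) \<partial>quarter)"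
    by (intro Bochner_Integration.integral_diff
        integrable_continuous_band_point[OF k, of "\<lambda>z. ln_prim (_ - z)"] continuous_intros)
  finally show "(\<integral>t. ln_prim (x - band_point \<alpha> \<beta> k t) \<partial>quarter) - (\<integral>t. ln_prim (x0 - band_point \<alpha> \<beta> k t) \<partial>quarter)
      = (\<integral>s. band_ln_pot \<alpha> \<beta> k s \<partial>lborel_Icc x0 x)" ..
  show "integrable (lborel_Icc x0 x) (band_ln_pot \<alpha> \<beta> k)"
    using P.integrable_snd[OF i] by (simp add: band_ln_pot_def[abs_def] abs_minus_commute)
qed

lemma ln_band_weight:
  assumes k: "k > 0"
  shows "integrable quarter (\<lambda>t. ln ((cos t)\<^sup>2 + k\<^sup>2 * (sin t)\<^sup>2))"
    and "(\<integral>t. ln ((cos t)\<^sup>2 + k\<^sup>2 * (sin t)\<^sup>2) \<partial>quarter) = pi * ln ((1 + k) / 2)"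
  using quarter_ln_cos_sin_sum[of 1 "k\<^sup>2"] k by simp_all

text \<open>Outside the band the numerator of s - \<open>band_point\<close> is a definite quadratic
  form in cosine and sine, so \<open>quarter_ln_cos_sin_sum\<close> applies to numerator and
  denominator alike; this is the source of the square roots.\<close>

lemma band_ln_pot_outside:
  assumes ab: "\<alpha> < \<beta>" and k: "k > 0" and s: "s < \<alpha> \<or> \<beta> < s"
  shows "band_ln_pot \<alpha> \<beta> k s = pi * ln ((sqrt \<bar>s - \<alpha>\<bar> + k * sqrt \<bar>s - \<beta>\<bar>) / (1 + k))"
proof -
  define N where "N t = \<bar>s - \<alpha>\<bar> * (cos t)\<^sup>2 + (k\<^sup>2 * \<bar>s - \<beta>\<bar>) * (sin t)\<^sup>2" for t
  define Q where "Q t = (cos t)\<^sup>2 + k\<^sup>2 * (sin t)\<^sup>2" for t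
  have half: "(x / 2) / (y / 2) = x / y" for x y :: real by simp
  have pos: "\<bar>s - \<alpha>\<bar> > 0" "k\<^sup>2 * \<bar>s - \<beta>\<bar> > 0" using s ab k by auto
  have N: "N t > 0" for t unfolding N_def by (rule weighted_cos_sin_pos[OF pos])
  have Q: "Q t > 0" for t unfolding Q_def by (rule band_weight_pos[OF k])
  have "\<bar>s - band_point \<alpha> \<beta> k t\<bar> = N t / Q t" for t
  proof -
    have "\<bar>(s - \<alpha>) * (cos t)\<^sup>2 + k\<^sup>2 * (s - \<beta>) * (sin t)\<^sup>2\<bar> = N t"
    proof (cases "s < \<alpha>")
      case True
      then have "N t = - ((s - \<alpha>) * (cos t)\<^sup>2 + k\<^sup>2 * (s - \<beta>) * (sin t)\<^sup>2)"
        using ab by (simp add: N_def algebra_simps)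
      then show ?thesis using N[of t] by linarith
    next
      case False
      then have "N t = (s - \<alpha>) * (cos t)\<^sup>2 + k\<^sup>2 * (s - \<beta>) * (sin t)\<^sup>2"
        using ab s by (simp add: N_def)
      then show ?thesis using N[of t] by linarith
    qed
    then show ?thesis using Q[of t] unfolding diff_band_point[OF k] Q_def[symmetric] by simp
  qed
  then have "ln \<bar>s - band_point \<alpha> \<beta> k t\<bar> = ln (N t) - ln (Q t)" for t
    using N[of t] Q[of t] by (simp add: ln_divide_pos)
  then have "band_ln_pot \<alpha> \<beta> k s = (\<integral>t. ln (N t) - ln (Q t) \<partial>quarter)"
    by (simp add: band_ln_pot_def)
  also have "\<dots> = pi * ln ((sqrt \<bar>s - \<alpha>\<bar> + sqrt (k\<^sup>2 * \<bar>s - \<beta>\<bar>)) / 2) - pi * ln ((1 + k) / 2)"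
    unfolding N_def Q_def
    by (simp only: Bochner_Integration.integral_diff[OF quarter_ln_cos_sin_sum(1)[OF pos] ln_band_weight(1)[OF k]]
        quarter_ln_cos_sin_sum(2)[OF pos] ln_band_weight(2)[OF k])
  also have "sqrt (k\<^sup>2 * \<bar>s - \<beta>\<bar>) = k * sqrt \<bar>s - \<beta>\<bar>" using k by (simp add: real_sqrt_mult)
  also have "pi * ln ((sqrt \<bar>s - \<alpha>\<bar> + k * sqrt \<bar>s - \<beta>\<bar>) / 2) - pi * ln ((1 + k) / 2)
    = pi * (ln ((sqrt \<bar>s - \<alpha>\<bar> + k * sqrt \<bar>s - \<beta>\<bar>) / 2) - ln ((1 + k) / 2))"
    by (simp add: right_diff_distrib)
  also have "ln ((sqrt \<bar>s - \<alpha>\<bar> + k * sqrt \<bar>s - \<beta>\<bar>) / 2) - ln ((1 + k) / 2)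
    = ln (((sqrt \<bar>s - \<alpha>\<bar> + k * sqrt \<bar>s - \<beta>\<bar>) / 2) / ((1 + k) / 2))"
    using pos k by (intro ln_divide_pos[symmetric]) (auto intro!: add_pos_nonneg)
  finally show ?thesis by (simp only: half)
qed

text \<open>Inside the band the numerator is indefinite, and \<open>quarter_ln_cos_sin_diff\<close>
  produces no square roots. The argument of the logarithm is affine in s, and for k =
  \<open>band_coord \<alpha> \<beta> p\<close> a multiple of |s - p|: on the band the balayage has
  the potential of p up to a constant.\<close>

lemma band_ln_pot_inside:
  assumes k: "k > 0" and s: "\<alpha> < s" "s < \<beta>"
  shows "band_ln_pot \<alpha> \<beta> k s = pi / 2 * ln (((s - \<alpha>) + k\<^sup>2 * (\<beta> - s)) / (1 + k)\<^sup>2)"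
proof -
  define N where "N t = (s - \<alpha>) * (cos t)\<^sup>2 - (k\<^sup>2 * (\<beta> - s)) * (sin t)\<^sup>2" for t
  define Q where "Q t = (cos t)\<^sup>2 + k\<^sup>2 * (sin t)\<^sup>2" for t
  have pos: "s - \<alpha> > 0" "k\<^sup>2 * (\<beta> - s) > 0" using s k by auto
  have Q: "Q t > 0" for t unfolding Q_def by (rule band_weight_pos[OF k])
  have eq: "\<bar>s - band_point \<alpha> \<beta> k t\<bar> = \<bar>N t\<bar> / Q t" for t
    using Q[of t] unfolding diff_band_point[OF k] Q_def[symmetric] N_def by (simp add: algebra_simps)
  \<comment> \<open>The numerator vanishes at the single angle arctan r, where the logarithm of the
    quotient does not split.\<close>
  define r where "r = sqrt ((s - \<alpha>) / (k\<^sup>2 * (\<beta> - s)))"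
  have AE_N: "AE t in quarter. N t \<noteq> 0"
  proof (rule AE_mp[OF AE_lborel_Icc_not_in_finite[of "{arctan r, pi / 2}"]], simp, intro AE_I2 impI notI)
    fix t assume t: "t \<in> space quarter" "t \<notin> {arctan r, pi / 2}" and "N t = 0"
    then have tt: "0 \<le> t" "t < pi / 2" by auto
    then have c: "cos t > 0" by (intro cos_gt_zero_pi) auto
    have "(tan t)\<^sup>2 = (s - \<alpha>) / (k\<^sup>2 * (\<beta> - s))"
    proof -
      have "(sin t)\<^sup>2 * (k\<^sup>2 * (\<beta> - s)) = (s - \<alpha>) * (cos t)\<^sup>2"
        using \<open>N t = 0\<close> by (simp add: N_def mult.commute)
      then show ?thesis using c pos unfolding tan_def power_divide by (subst frac_eq_eq) auto
    qed
    moreover have "tan t \<ge> 0" using tt c by (simp add: tan_def sin_ge_zero)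
    ultimately have "tan t = r" by (simp add: r_def real_sqrt_unique)
    then have "arctan r = t" using tt arctan_tan[of t] by auto
    then show False using t by simp
  qed
  have pos4: "(s - \<alpha>) + k\<^sup>2 * (\<beta> - s) > 0" using pos by linarith
  have "band_ln_pot \<alpha> \<beta> k s = (\<integral>t. ln \<bar>N t\<bar> - ln (Q t) \<partial>quarter)"
    unfolding band_ln_pot_def
  proof (rule integral_cong_AE)
    show "AE t in quarter. ln \<bar>s - band_point \<alpha> \<beta> k t\<bar> = ln \<bar>N t\<bar> - ln (Q t)"
      using AE_N by eventually_elim (use Q in \<open>simp add: eq ln_divide_pos\<close>)
    show "(\<lambda>t. ln \<bar>N t\<bar> - ln (Q t)) \<in> borel_measurable quarter" unfolding N_def Q_def by measurable
  qed measurable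
  also have "\<dots> = pi / 2 * ln (((s - \<alpha>) + k\<^sup>2 * (\<beta> - s)) / 4) - pi * ln ((1 + k) / 2)"
    unfolding N_def Q_def
    by (simp only: Bochner_Integration.integral_diff[OF quarter_ln_cos_sin_diff(1)[OF pos] ln_band_weight(1)[OF k]]
        quarter_ln_cos_sin_diff(2)[OF pos] ln_band_weight(2)[OF k])
  also have "pi * ln ((1 + k) / 2) = pi / 2 * ln (((1 + k) / 2)\<^sup>2)"
    using k ln_realpow[of "(1 + k) / 2" 2] by simp
  also have "pi / 2 * ln (((s - \<alpha>) + k\<^sup>2 * (\<beta> - s)) / 4) - pi / 2 * ln (((1 + k) / 2)\<^sup>2)
    = pi / 2 * (ln (((s - \<alpha>) + k\<^sup>2 * (\<beta> - s)) / 4) - ln (((1 + k) / 2)\<^sup>2))"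
    by (simp only: right_diff_distrib)
  also have "ln (((s - \<alpha>) + k\<^sup>2 * (\<beta> - s)) / 4) - ln (((1 + k) / 2)\<^sup>2)
    = ln ((((s - \<alpha>) + k\<^sup>2 * (\<beta> - s)) / 4) / ((1 + k) / 2)\<^sup>2)"
    using pos4 k by (intro ln_divide_pos[symmetric]) auto
  also have "(x / 4) / ((1 + k) / 2)\<^sup>2 = x / (1 + k)\<^sup>2" for x by (simp add: power_divide)
  finally show ?thesis .
qed

text \<open>The distance from \<beta> is (\<beta> - \<alpha>) v, so its \<open>ln_prim\<close> is a
  combination of v and v ln v, both already integrated.\<close>

lemma ln_prim_band_point_right_end:
  assumes ab: "\<alpha> < \<beta>" and k: "k > 0" "k \<noteq> 1"
  shows "(\<integral>t. ln_prim (\<beta> - band_point \<alpha> \<beta> k t) \<partial>quarter)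
    = pi / 2 * (\<beta> - \<alpha>) * ((ln (\<beta> - \<alpha>) - 1) / (1 + k) + (2 * k * ln 2 - 2 * ln (1 + k)) / (1 - k\<^sup>2))"
proof -
  define v where "v t = (cos t)\<^sup>2 / ((cos t)\<^sup>2 + k\<^sup>2 * (sin t)\<^sup>2)" for t
  define d where "d = \<beta> - \<alpha>"
  have d: "d > 0" using ab by (simp add: d_def)
  have v: "v t \<ge> 0" for t using band_weight_pos[OF k(1), of t] by (simp add: v_def)
  have "ln_prim (\<beta> - band_point \<alpha> \<beta> k t) = d * (ln d - 1) * v t + d * (v t * ln (v t))" for t
  proof -
    have e: "\<beta> - band_point \<alpha> \<beta> k t = d * v t" by (simp add: band_point_eq[OF k(1)] v_def d_def)
    show ?thesis
    proof (cases "v t = 0")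
      case False
      then have "v t > 0" using v[of t] by simp
      then show ?thesis unfolding e ln_prim_def using d by (simp add: ln_mult abs_mult algebra_simps)
    qed (simp add: e)
  qed
  moreover have "integrable quarter v"
  proof -
    have "continuous_on {0..pi / 2} v"
      unfolding v_def using band_weight_pos[OF k(1)] by (intro continuous_intros) (auto simp: less_imp_neq[symmetric])
    then show ?thesis using borel_integrable_atLeastAtMost' by (simp add: integrable_lborel_Icc_iff)
  qed
  ultimately have "(\<integral>t. ln_prim (\<beta> - band_point \<alpha> \<beta> k t) \<partial>quarter)
     = d * (ln d - 1) * (\<integral>t. v t \<partial>quarter) + d * (\<integral>t. v t * ln (v t) \<partial>quarter)"
    by (simp only: Bochner_Integration.integral_add integrable_mult_right integral_mult_right_zero
        quarter_weight_ln_weight(1)[OF k, folded v_def])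
  also have "\<dots> = d * (ln d - 1) * (pi / 2 / (1 + k)) + d * (pi / 2 * ((2 * k * ln 2 - 2 * ln (1 + k)) / (1 - k\<^sup>2)))"
    by (simp only: quarter_cos2_weight[OF k(1), folded v_def] quarter_weight_ln_weight(2)[OF k, folded v_def])
  also have "d * a * (pi / 2 / p) + d * (pi / 2 * q) = pi / 2 * d * (a / p + q)" for a p q :: real
    by (simp add: algebra_simps)
  finally show ?thesis by (simp only: d_def)
qed

section \<open>Green functions of the complement of the band\<close>

text \<open>The quotient (z - \<alpha>) / (z - \<beta>) maps the complement of the band to the plane
  cut along the nonpositive axis, and its root to the right half-plane, where Green functions are
  explicit. At 1 + B, 1, - A and 0 its values are k1, k2, k3 and k4.\<close>

definition band_coord :: "real \<Rightarrow> real \<Rightarrow> real \<Rightarrow> real" where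
  "band_coord \<alpha> \<beta> p = sqrt ((p - \<alpha>) / (p - \<beta>))"

lemma band_coord_right:
  assumes "\<alpha> < \<beta>" "\<beta> < p"
  shows "1 < band_coord \<alpha> \<beta> p"
  using assms by (simp add: band_coord_def field_simps)

lemma band_coord_right_antimono:
  assumes "\<alpha> < \<beta>" "\<beta> < p" "p < q"
  shows "band_coord \<alpha> \<beta> q < band_coord \<alpha> \<beta> p"
proof -
  have "(q - \<alpha>) * (p - \<beta>) < (p - \<alpha>) * (q - \<beta>)"
    using mult_strict_left_mono[of p q "\<beta> - \<alpha>"] assms by (simp add: algebra_simps)
  then show ?thesis using assms by (simp add: band_coord_def frac_less_eq) (simp add: divide_simps)
qed

lemma band_coord_left:
  assumes "\<alpha> < \<beta>" "p < \<alpha>"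
  shows "0 < band_coord \<alpha> \<beta> p" "band_coord \<alpha> \<beta> p < 1"
  using assms by (auto simp: band_coord_def divide_neg_neg divide_less_eq_1)

lemma band_coord_left_antimono:
  assumes "\<alpha> < \<beta>" "p < q" "q < \<alpha>"
  shows "band_coord \<alpha> \<beta> q < band_coord \<alpha> \<beta> p"
proof -
  have "(q - \<alpha>) * (p - \<beta>) < (p - \<alpha>) * (q - \<beta>)"
    using mult_strict_left_mono[of p q "\<beta> - \<alpha>"] assms by (simp add: algebra_simps)
  moreover have "(p - \<beta>) * (q - \<beta>) > 0" using assms by (simp add: mult_neg_neg)
  ultimately have "(q - \<alpha>) / (q - \<beta>) < (p - \<alpha>) / (p - \<beta>)"
    using assms by (simp add: divide_less_eq less_divide_eq)
  then show ?thesis by (simp add: band_coord_def)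
qed

lemma band_coord_facts:
  assumes "\<alpha> < \<beta>" "p < \<alpha> \<or> \<beta> < p"
  shows "band_coord \<alpha> \<beta> p > 0" "band_coord \<alpha> \<beta> p \<noteq> 1"
    and "(band_coord \<alpha> \<beta> p)\<^sup>2 = (p - \<alpha>) / (p - \<beta>)"
  using band_coord_right[OF assms(1), of p] band_coord_left[OF assms(1), of p] assms
  by (auto simp: band_coord_def divide_nonpos_nonpos)

lemma ln_abs_divide: "a \<noteq> 0 \<Longrightarrow> b \<noteq> 0 \<Longrightarrow> ln \<bar>a / b\<bar> = (ln \<bar>a\<bar>) - ln \<bar>b\<bar>" for a b :: real
  by (simp add: ln_divide_pos)

text \<open>\<open>ln \<bar>(\<kappa> + k) / (\<kappa> - k)\<bar>\<close> is the Green function of the complement of the band in the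
  coordinate \<open>\<kappa> = band_coord \<alpha> \<beta> s\<close>, in which infinity sits at \<open>\<kappa> = 1\<close>.\<close>

lemma band_green_inside:
  assumes ab: "\<alpha> < \<beta>" and p: "p < \<alpha> \<or> \<beta> < p" and s: "\<alpha> < s" "s < \<beta>"
  defines "k \<equiv> band_coord \<alpha> \<beta> p"
  shows "2 / pi * band_ln_pot \<alpha> \<beta> k s - ln \<bar>s - p\<bar> = - ln \<bar>(1 + k) / (1 - k)\<bar>"
proof -
  note k = band_coord_facts[OF ab p, folded k_def]
  have pb: "p - \<beta> \<noteq> 0" using p ab by auto
  have "(s - \<alpha>) + k\<^sup>2 * (\<beta> - s) = (k\<^sup>2 - 1) * (p - s)"
    unfolding k(3) using pb by (simp add: divide_simps) (simp add: algebra_simps)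
  moreover have "(s - \<alpha>) + k\<^sup>2 * (\<beta> - s) > 0" using s k(1) by (simp add: add_pos_pos)
  ultimately have "(s - \<alpha>) + k\<^sup>2 * (\<beta> - s) = \<bar>k\<^sup>2 - 1\<bar> * \<bar>s - p\<bar>"
    by (metis abs_minus_commute abs_mult abs_of_pos)
  also have "\<bar>k\<^sup>2 - 1\<bar> = \<bar>1 - k\<bar> * (1 + k)"
  proof -
    have "k\<^sup>2 - 1 = - ((1 - k) * (1 + k))" by (simp add: power2_eq_square algebra_simps)
    then show ?thesis using k(1) by (simp add: abs_mult)
  qed
  finally have "2 / pi * band_ln_pot \<alpha> \<beta> k s = ln (\<bar>1 - k\<bar> * (1 + k) * \<bar>s - p\<bar> / (1 + k)\<^sup>2)"
    unfolding band_ln_pot_inside[OF k(1) s] by simp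
  also have "\<bar>1 - k\<bar> * (1 + k) * \<bar>s - p\<bar> / (1 + k)\<^sup>2 = \<bar>1 - k\<bar> * \<bar>s - p\<bar> / (1 + k)"
    using k(1) by (simp add: power2_eq_square)
  also have "ln \<dots> = ln \<bar>1 - k\<bar> + ln \<bar>s - p\<bar> - ln (1 + k)"
    using k p s by (subst ln_divide_pos) (auto simp: ln_mult)
  finally show ?thesis using k by (subst ln_abs_divide) auto
qed

lemma band_green_outside:
  assumes ab: "\<alpha> < \<beta>" and p: "p < \<alpha> \<or> \<beta> < p" and s: "s < \<alpha> \<or> \<beta> < s" and sp: "s \<noteq> p"
  defines "k \<equiv> band_coord \<alpha> \<beta> p" and "\<kappa> \<equiv> band_coord \<alpha> \<beta> s"
  shows "2 / pi * band_ln_pot \<alpha> \<beta> k s - ln \<bar>s - p\<bar>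
    = ln \<bar>(\<kappa> + k) / (\<kappa> - k)\<bar> - ln \<bar>(1 + k) / (1 - k)\<bar>"
proof -
  note k = band_coord_facts[OF ab p, folded k_def]
  note \<kappa> = band_coord_facts[OF ab s, folded \<kappa>_def]
  have pb: "p - \<beta> \<noteq> 0" and sb: "s - \<beta> \<noteq> 0" using p s ab by auto
  define b where "b = sqrt \<bar>s - \<beta>\<bar>"
  have b: "b > 0" and b2: "b\<^sup>2 = \<bar>s - \<beta>\<bar>" using sb by (auto simp: b_def)
  have "sqrt \<bar>s - \<alpha>\<bar> = \<kappa> * b"
  proof -
    have "\<bar>s - \<alpha>\<bar> = (\<kappa> * b)\<^sup>2"
      unfolding power_mult_distrib \<kappa>(3) b2 using s ab by (auto simp: abs_if divide_simps algebra_simps)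
    then show ?thesis using \<kappa>(1) b by simp
  qed
  then have "2 / pi * band_ln_pot \<alpha> \<beta> k s = 2 * ln (b * (\<kappa> + k) / (1 + k))"
    unfolding band_ln_pot_outside[OF ab k(1) s] by (simp add: b_def algebra_simps)
  also have "ln (b * (\<kappa> + k) / (1 + k)) = ln b + ln (\<kappa> + k) - ln (1 + k)"
    using b \<kappa>(1) k(1) by (subst ln_divide_pos) (auto simp: ln_mult)
  finally have 1: "2 / pi * band_ln_pot \<alpha> \<beta> k s = 2 * ln b + 2 * ln (\<kappa> + k) - 2 * ln (1 + k)" by simp
  \<comment> \<open>The identity behind this is (s - \<beta>) (\<kappa>^2 - k^2) = (1 - k^2) (s -
    p); the quotient (s - \<beta>) / |s - \<beta>| restores the sign lost in b^2, so that one
    formula covers both sides of the band.\<close>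
  have id: "b\<^sup>2 * ((\<kappa> - k) * (\<kappa> + k)) * ((s - \<beta>) / \<bar>s - \<beta>\<bar>) = (1 - k) * (1 + k) * (s - p)"
  proof -
    have "b\<^sup>2 * ((s - \<beta>) / \<bar>s - \<beta>\<bar>) = s - \<beta>" using sb by (simp add: b2)
    moreover have "b\<^sup>2 * ((\<kappa> - k) * (\<kappa> + k)) * e = b\<^sup>2 * e * (\<kappa>\<^sup>2 - k\<^sup>2)" for e
      by algebra
    ultimately have "b\<^sup>2 * ((\<kappa> - k) * (\<kappa> + k)) * ((s - \<beta>) / \<bar>s - \<beta>\<bar>) = (s - \<beta>) * (\<kappa>\<^sup>2 - k\<^sup>2)"
      by (simp only:)
    also have "\<dots> = (1 - k\<^sup>2) * (s - p)"
      unfolding k(3) \<kappa>(3) using pb sb by (simp add: divide_simps) (simp add: algebra_simps)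
    finally show ?thesis by (simp add: power2_eq_square algebra_simps)
  qed
  then have "\<bar>b\<^sup>2 * ((\<kappa> - k) * (\<kappa> + k)) * ((s - \<beta>) / \<bar>s - \<beta>\<bar>)\<bar> = \<bar>(1 - k) * (1 + k) * (s - p)\<bar>" by simp
  then have id': "b\<^sup>2 * (\<bar>\<kappa> - k\<bar> * (\<kappa> + k)) = \<bar>1 - k\<bar> * (1 + k) * \<bar>s - p\<bar>"
    using sb k(1) \<kappa>(1) by (simp add: abs_mult)
  then have neq: "\<kappa> \<noteq> k" using sp k by auto
  have "ln (b\<^sup>2 * (\<bar>\<kappa> - k\<bar> * (\<kappa> + k))) = 2 * ln b + ln \<bar>\<kappa> - k\<bar> + ln (\<kappa> + k)"
    using neq b k(1) \<kappa>(1) by (simp add: ln_mult ln_realpow)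
  moreover have "ln (\<bar>1 - k\<bar> * (1 + k) * \<bar>s - p\<bar>) = ln \<bar>1 - k\<bar> + ln (1 + k) + ln \<bar>s - p\<bar>"
    using sp k by (simp add: ln_mult)
  ultimately have "2 * ln b + ln \<bar>\<kappa> - k\<bar> + ln (\<kappa> + k) = ln \<bar>1 - k\<bar> + ln (1 + k) + ln \<bar>s - p\<bar>"
    by (simp add: id')
  moreover have "ln \<bar>(\<kappa> + k) / (\<kappa> - k)\<bar> = ln (\<kappa> + k) - ln \<bar>\<kappa> - k\<bar>"
    using neq k(1) \<kappa>(1) by (subst ln_abs_divide) auto
  moreover have "ln \<bar>(1 + k) / (1 - k)\<bar> = ln (1 + k) - ln \<bar>1 - k\<bar>"
    using k by (subst ln_abs_divide) auto
  ultimately show ?thesis using 1 by linarith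
qed

text \<open>Changing the sign of k inverts the quotient, so the sign in front of the logarithm can
  be moved onto k and a signed sum becomes the logarithm of one quotient of products.\<close>

lemma ln_abs_signed_quotient:
  fixes x k \<sigma> :: real
  assumes "\<sigma> = 1 \<or> \<sigma> = -1" "x \<noteq> k" "x \<noteq> - k"
  shows "\<sigma> * ln \<bar>(x + k) / (x - k)\<bar> = ln \<bar>x + \<sigma> * k\<bar> - ln \<bar>x - \<sigma> * k\<bar>"
  using assms ln_abs_divide[of "x + k" "x - k"] by auto

text \<open>The sign patterns \<open>(s2, s4)\<close> of the points \<open>1\<close> and \<open>0\<close>: void-band-void, saturated-band-void and
  saturated-band-saturated.\<close>

definition band_signs :: "real \<Rightarrow> real \<Rightarrow> bool" where
  "band_signs s2 s4 \<longleftrightarrow> (s2, s4) \<in> {(1, -1), (1, 1), (-1, 1)}"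

lemma band_signs_cases:
  assumes "band_signs s2 s4"
  obtains "s2 = 1" "s4 = -1" | "s2 = 1" "s4 = 1" | "s2 = -1" "s4 = 1"
  using assms by (auto simp: band_signs_def)

text \<open>With \<open>N x = (x - k1) (x + s2 k2) (x + k3) (x + s4 k4)\<close> the endpoint equation \<open>N 1 = N (-1)\<close> forces
  \<open>N x - N (-x) = 2 e x (x\<^sup>2 - 1)\<close>, where \<open>e\<close> is the sum of the signed roots.\<close>

lemma green_sum_sign:
  fixes k1 k2 k3 k4 x :: real
  assumes sg: "band_signs s2 s4"
    and k: "0 < k4" "k4 < k3" "k3 < 1" "1 < k1" "k1 < k2"
    and endpoint: "(1 - k1) * (1 + s2 * k2) * (1 + k3) * (1 + s4 * k4) = (1 + k1) * (1 - s2 * k2) * (1 - k3) * (1 - s4 * k4)"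
  defines "F \<equiv> \<lambda>x. - ln \<bar>(x + k1) / (x - k1)\<bar> + s2 * ln \<bar>(x + k2) / (x - k2)\<bar> + ln \<bar>(x + k3) / (x - k3)\<bar>
      + s4 * ln \<bar>(x + k4) / (x - k4)\<bar>"
  shows "F 1 = 0" "k2 < x \<Longrightarrow> s2 * F x > 0" "0 < x \<Longrightarrow> x < k4 \<Longrightarrow> s4 * F x > 0"
proof -
  define N where "N x = (x - k1) * (x + s2 * k2) * (x + k3) * (x + s4 * k4)" for x
  define N' where "N' x = (x + k1) * (x - s2 * k2) * (x - k3) * (x - s4 * k4)" for x
  define e where "e = - k1 + s2 * k2 + k3 + s4 * k4"
  have s: "s2 = 1 \<or> s2 = -1" "s4 = 1 \<or> s4 = -1" using sg by (auto simp: band_signs_def)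
  \<comment> \<open>If s2 = 1, then k2 > k1 and k3 > k4 give e > 0; if s2 = -1, then s4 = 1, and k1
    > k3 and k2 > k4 give e < 0.\<close>
  have e: "s2 * e > 0" using sg k by (auto simp: band_signs_def e_def)
  have diff: "N x - N' x = 2 * e * x * (x\<^sup>2 - 1)" for x
    using endpoint unfolding N_def N'_def e_def by algebra
  have F: "F x = ln \<bar>N x\<bar> - ln \<bar>N' x\<bar>" if "x > 0" "x \<noteq> k1" "x \<noteq> k2" "x \<noteq> k3" "x \<noteq> k4" for x
  proof -
    have nz: "x + s2 * k2 \<noteq> 0" "x - s2 * k2 \<noteq> 0" "x + s4 * k4 \<noteq> 0" "x - s4 * k4 \<noteq> 0"
      using s that k by auto
    have "ln \<bar>N x\<bar> = ln \<bar>x - k1\<bar> + ln \<bar>x + s2 * k2\<bar> + ln \<bar>x + k3\<bar> + ln \<bar>x + s4 * k4\<bar>"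
      using that nz k unfolding N_def abs_mult by (simp add: ln_mult)
    moreover have "ln \<bar>N' x\<bar> = ln \<bar>x + k1\<bar> + ln \<bar>x - s2 * k2\<bar> + ln \<bar>x - k3\<bar> + ln \<bar>x - s4 * k4\<bar>"
      using that nz k unfolding N'_def abs_mult by (simp add: ln_mult)
    moreover have "ln \<bar>(x + k1) / (x - k1)\<bar> = ln \<bar>x + k1\<bar> - ln \<bar>x - k1\<bar>"
      "ln \<bar>(x + k3) / (x - k3)\<bar> = ln \<bar>x + k3\<bar> - ln \<bar>x - k3\<bar>"
      using that k by (intro ln_abs_divide; linarith)+
    moreover have "s2 * ln \<bar>(x + k2) / (x - k2)\<bar> = ln \<bar>x + s2 * k2\<bar> - ln \<bar>x - s2 * k2\<bar>"
      "s4 * ln \<bar>(x + k4) / (x - k4)\<bar> = ln \<bar>x + s4 * k4\<bar> - ln \<bar>x - s4 * k4\<bar>"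
      using that k by (intro ln_abs_signed_quotient s; linarith)+
    ultimately show ?thesis unfolding F_def by linarith
  qed
  show "F 1 = 0" using F[of 1] diff[of 1] k by simp
  show "s2 * F x > 0" if x: "k2 < x"
  proof -
    have pos: "N x > 0" "N' x > 0"
      unfolding N_def N'_def using s x k by (auto intro!: mult_pos_pos)
    have "x\<^sup>2 - 1 > 0" using x k by (simp add: one_less_power)
    then have "s2 * (N x - N' x) > 0"
      unfolding diff using mult_pos_pos[OF mult_pos_pos[OF e, of "2 * x"], of "x\<^sup>2 - 1"] x k by (simp add: mult_ac)
    then show ?thesis using F[of x] pos x k s(1) by auto
  qed
  show "s4 * F x > 0" if x: "0 < x" "x < k4"
  proof -
    have "x\<^sup>2 < 1" using x k by (simp add: power2_less_1_iff)
    then have e': "s2 * (2 * e * x * (x\<^sup>2 - 1)) < 0"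
      using mult_pos_neg[OF mult_pos_pos[OF e, of "2 * x"], of "x\<^sup>2 - 1"] x by (simp add: mult_ac)
    \<comment> \<open>On (0, k4) both products have the sign - s2 s4, so |N| - |N'| = - s2 s4 (N -
      N').\<close>
    have pos: "- (s2 * s4) * N x > 0" "- (s2 * s4) * N' x > 0"
      unfolding N_def N'_def using s x k
      by (auto simp: mult_less_0_iff zero_less_mult_iff)
    show ?thesis
      using F[of x] pos x k e' diff[of x] s by auto
  qed
qed

section \<open>The constrained minimizer\<close>

lemma integral_lborel_Icc_pos:
  fixes f :: "real \<Rightarrow> real"
  assumes "a < b" "integrable (lborel_Icc a b) f" "AE x in lborel_Icc a b. f x > 0"
  shows "(\<integral>x. f x \<partial>lborel_Icc a b) > 0"
proof -
  interpret finite_measure "lborel_Icc a b" by (rule finite_measure_lborel_Icc)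
  have "emeasure (lborel_Icc a b) (space (lborel_Icc a b)) \<noteq> 0"
    using assms(1) by (simp add: emeasure_restrict_space)
  from integral_less_AE_space[OF _ assms(2,3) this] show ?thesis by simp
qed

text \<open>A relatively open J containing a point of [u, v], possibly an endpoint, meets (u, v) in
  a nonempty open set, which is not null. This turns almost-everywhere statements about the density
  into pointwise witnesses inside J.\<close>

lemma openin_unit_interval_AE_meets:
  fixes J :: "real set"
  assumes J: "openin (top_of_set {0..1}) J" "x \<in> J"
    and uv: "0 \<le> u" "u < v" "v \<le> 1" "u \<le> x" "x \<le> v"
    and AE: "AE y in unit_lborel. Q y"
  obtains y where "y \<in> J" "u < y" "y < v" "Q y"
proof -
  obtain U where U: "open U" "J = {0..1} \<inter> U" using J(1) by (auto simp: openin_open)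
  have "x \<in> closure {u<..<v}" using uv by simp
  then have "U \<inter> {u<..<v} \<noteq> {}"
    using U J(2) by (auto simp: closure_iff_nhds_not_empty)
  moreover have "open (U \<inter> {u<..<v})" using U by auto
  ultimately have nn: "U \<inter> {u<..<v} \<notin> null_sets lborel"
    using open_not_negligible null_sets_completionI[of "U \<inter> {u<..<v}" lborel]
    by (auto simp: negligible_iff_null_sets)
  have "AE y in lborel. y \<in> {0..1} \<longrightarrow> Q y" using AE unfolding unit_lborel_def AE_lborel_Icc_iff .
  moreover have "U \<inter> {u<..<v} \<in> sets lborel" using U by auto
  ultimately have "\<exists>y\<in>U \<inter> {u<..<v}. y \<in> {0..1} \<longrightarrow> Q y"
    using nn by (metis (mono_tags, lifting) AE_iff_null_sets AE_mp AE_I2)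
  then show ?thesis using that U uv by force
qed

text \<open>The potential theory needs only two equations for the ends of the band, and the two
  signs merge the three cases; the closed formulas are inserted in
  \<open>hahn_band_instance\<close>. \<open>endpoint\<close> is the exponentiated form of the
  cancellation at infinity, and \<open>mass\<close> adds up the masses of
  \<open>mass_band_profile\<close>.\<close>

locale hahn_band =
  fixes A B c \<alpha> \<beta> s2 s4 :: real
  assumes A: "0 < A" and B: "0 < B" and c: "0 < c"
    and \<alpha>\<beta>: "0 < \<alpha>" "\<alpha> < \<beta>" "\<beta> < 1"
    and signs: "band_signs s2 s4"
    and endpoint: "(1 - band_coord \<alpha> \<beta> (1 + B)) * (1 + s2 * band_coord \<alpha> \<beta> 1) * (1 + band_coord \<alpha> \<beta> (- A))
        * (1 + s4 * band_coord \<alpha> \<beta> 0)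
      = (1 + band_coord \<alpha> \<beta> (1 + B)) * (1 - s2 * band_coord \<alpha> \<beta> 1) * (1 - band_coord \<alpha> \<beta> (- A))
        * (1 - s4 * band_coord \<alpha> \<beta> 0)"
    and mass: "c = (1 - s2) / 2 + 1 / 2 * (
        - (\<beta> - (\<beta> - \<alpha>) / (1 + band_coord \<alpha> \<beta> (1 + B))) + s2 * (\<beta> - (\<beta> - \<alpha>) / (1 + band_coord \<alpha> \<beta> 1))
        + (\<beta> - (\<beta> - \<alpha>) / (1 + band_coord \<alpha> \<beta> (- A))) + s4 * (\<beta> - (\<beta> - \<alpha>) / (1 + band_coord \<alpha> \<beta> 0)))"
begin

text \<open>The charges of the four points. With the kernel - ln |s - p|, the points - A and 1 + B
  carry the signs of the logarithms in V'; the signs of 0 and 1 record whether the adjacent region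
  is void or saturated.\<close>

definition signed :: "(real \<Rightarrow> real) \<Rightarrow> real" where
  "signed F = - F (1 + B) + s2 * F 1 + F (- A) + s4 * F 0"

text \<open>The constant (1 - s2) / 2 is the value of c \<rho> beyond \<beta>, where all profiles
  vanish.\<close>

definition \<rho> :: "real \<Rightarrow> real" where
  "\<rho> y = 1 / c * ((1 - s2) / 2 + 1 / pi * signed (\<lambda>p. band_profile \<alpha> \<beta> (band_coord \<alpha> \<beta> p) y))"

definition \<mu> :: "real measure" where
  "\<mu> = density_measure \<rho>"

abbreviation G :: "real \<Rightarrow> real" where
  "G \<equiv> var_deriv (V_Hahn A B) c \<mu>"

lemma poles: "p \<in> {1 + B, 1, - A, 0} \<Longrightarrow> p < \<alpha> \<or> \<beta> < p"
  using A B \<alpha>\<beta> by auto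

lemma coord_order:
  "0 < band_coord \<alpha> \<beta> 0" "band_coord \<alpha> \<beta> 0 < band_coord \<alpha> \<beta> (- A)" "band_coord \<alpha> \<beta> (- A) < 1"
  "1 < band_coord \<alpha> \<beta> (1 + B)" "band_coord \<alpha> \<beta> (1 + B) < band_coord \<alpha> \<beta> 1"
  using band_coord_left(1)[OF \<alpha>\<beta>(2), of 0] band_coord_left_antimono[OF \<alpha>\<beta>(2), of "- A" 0]
    band_coord_left(2)[OF \<alpha>\<beta>(2), of "- A"] band_coord_right[OF \<alpha>\<beta>(2), of "1 + B"]
    band_coord_right_antimono[OF \<alpha>\<beta>(2), of 1 "1 + B"] A B \<alpha>\<beta>
  by auto

lemma signed_cong: "(\<And>p. p \<in> {1 + B, 1, - A, 0} \<Longrightarrow> F p = F' p) \<Longrightarrow> signed F = signed F'"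
  by (simp add: signed_def)

lemma \<rho>_left: "y \<le> \<alpha> \<Longrightarrow> \<rho> y = (1 + s4) / 2 / c"
  using c by (simp add: \<rho>_def signed_def band_profile_def field_simps)

lemma \<rho>_right: "\<beta> \<le> y \<Longrightarrow> \<rho> y = (1 - s2) / 2 / c"
  using \<alpha>\<beta> by (simp add: \<rho>_def signed_def band_profile_def field_simps)

text \<open>The arctangents inherit the order of the coordinates inside (0, pi / 2), and in each
  sign pattern this confines pi c \<rho> to (0, pi).\<close>

lemma \<rho>_band:
  assumes y: "\<alpha> < y" "y < \<beta>"
  shows "0 < \<rho> y" "\<rho> y < 1 / c"
proof -
  define T where "T = sqrt ((\<beta> - y) / (y - \<alpha>))"
  have T: "T > 0" using y by (simp add: T_def)
  define a where "a p = arctan (band_coord \<alpha> \<beta> p * T)" for p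
  have o: "0 < a 0" "a 0 < a (- A)" "a (- A) < a (1 + B)" "a (1 + B) < a 1" "a 1 < pi / 2"
    using coord_order T arctan_ubound[of "band_coord \<alpha> \<beta> 1 * T"] by (auto simp: a_def arctan_less_iff)
  have \<rho>: "\<rho> y = 1 / c * ((1 - s2) / 2 + 1 / pi * (- a (1 + B) + s2 * a 1 + a (- A) + s4 * a 0))"
    using y by (simp add: \<rho>_def signed_def band_profile_def a_def T_def)
  define w where "w = (1 - s2) / 2 * pi + (- a (1 + B) + s2 * a 1 + a (- A) + s4 * a 0)"
  have "0 < w" "w < pi"
    using signs o by (auto simp: w_def elim!: band_signs_cases)
  then have w: "0 < w / pi" "w / pi < 1" by simp_all
  have eq: "\<rho> y = w / pi / c"
    using c unfolding \<rho> w_def by (simp add: field_simps)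
  show "0 < \<rho> y" unfolding eq by (rule divide_pos_pos[OF w(1) c])
  show "\<rho> y < 1 / c" unfolding eq by (rule divide_strict_right_mono[OF w(2) c])
qed

lemma \<rho>_bounds: "0 \<le> \<rho> y" "\<rho> y \<le> 1 / c"
proof -
  consider "y \<le> \<alpha>" | "\<alpha> < y" "y < \<beta>" | "\<beta> \<le> y" by linarith
  then have "0 \<le> \<rho> y \<and> \<rho> y \<le> 1 / c"
  proof cases
    case 2
    then show ?thesis using \<rho>_band by (auto intro: less_imp_le)
  qed (use signs c in \<open>auto simp: \<rho>_left \<rho>_right elim!: band_signs_cases\<close>)
  then show "0 \<le> \<rho> y" "\<rho> y \<le> 1 / c" by auto
qed

lemma \<rho>_measurable [measurable]: "\<rho> \<in> borel_measurable borel"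
  unfolding \<rho>_def[abs_def] signed_def by measurable

lemma band_profile_bounded: "p \<in> {1 + B, 1, - A, 0} \<Longrightarrow> \<bar>band_profile \<alpha> \<beta> (band_coord \<alpha> \<beta> p) y\<bar> \<le> pi / 2"
  using arctan_bounded[of "band_coord \<alpha> \<beta> p * sqrt ((\<beta> - y) / (y - \<alpha>))"]
  by (auto simp: band_profile_def abs_le_iff less_imp_le)

lemma integral_times_\<rho>:
  fixes g :: "real \<Rightarrow> real"
  assumes g: "integrable (lborel_Icc 0 1) g"
  shows "(\<integral>y. g y * \<rho> y \<partial>lborel_Icc 0 1) = 1 / c * ((1 - s2) / 2 * (\<integral>y. g y \<partial>lborel_Icc 0 1)
    + 1 / pi * signed (\<lambda>p. \<integral>y. g y * band_profile \<alpha> \<beta> (band_coord \<alpha> \<beta> p) y \<partial>lborel_Icc 0 1))"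
proof -
  let ?f = "\<lambda>p y. g y * band_profile \<alpha> \<beta> (band_coord \<alpha> \<beta> p) y"
  have i: "integrable (lborel_Icc 0 1) (?f p)" if "p \<in> {1 + B, 1, - A, 0}" for p
    by (rule integrable_mult_bounded[OF g _ band_profile_bounded[OF that]]) measurable
  have i': "integrable (lborel_Icc 0 1) (?f (1 + B))" "integrable (lborel_Icc 0 1) (?f 1)"
    "integrable (lborel_Icc 0 1) (?f (- A))" "integrable (lborel_Icc 0 1) (?f 0)"
    by (rule i; simp)+
  have "(\<integral>y. g y * \<rho> y \<partial>lborel_Icc 0 1)
    = (\<integral>y. 1 / c * ((1 - s2) / 2 * g y + 1 / pi * ((- 1) * ?f (1 + B) y + (s2 * ?f 1 y + (?f (- A) y + s4 * ?f 0 y)))) \<partial>lborel_Icc 0 1)"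
    using c by (intro Bochner_Integration.integral_cong refl) (simp add: \<rho>_def signed_def field_simps)
  also have "\<dots> = 1 / c * ((1 - s2) / 2 * (\<integral>y. g y \<partial>lborel_Icc 0 1)
      + 1 / pi * ((- 1) * (\<integral>y. ?f (1 + B) y \<partial>lborel_Icc 0 1) + (s2 * (\<integral>y. ?f 1 y \<partial>lborel_Icc 0 1)
        + ((\<integral>y. ?f (- A) y \<partial>lborel_Icc 0 1) + s4 * (\<integral>y. ?f 0 y \<partial>lborel_Icc 0 1)))))"
    by (simp only: integral_mult_right_zero Bochner_Integration.integral_add
        Bochner_Integration.integrable_add integrable_mult_right g i')
  finally show ?thesis by (simp add: signed_def)
qed

lemma \<rho>_mass: "(\<integral>y. \<rho> y \<partial>lborel_Icc 0 1) = 1"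
proof -
  have pos: "band_coord \<alpha> \<beta> p > 0" if "p \<in> {1 + B, 1, - A, 0}" for p
    by (rule band_coord_facts[OF \<alpha>\<beta>(2) poles[OF that]])
  have "integrable (lborel_Icc 0 1) (\<lambda>y. 1 :: real)"
    by (rule integrable_lborel_Icc_bounded[of _ _ _ 1]) auto
  from integral_times_\<rho>[OF this]
  have "(\<integral>y. \<rho> y \<partial>lborel_Icc 0 1) = 1 / c * ((1 - s2) / 2 * (\<integral>y. 1 \<partial>lborel_Icc 0 1)
    + 1 / pi * signed (\<lambda>p. pi / 2 * (\<beta> - (\<beta> - \<alpha>) / (1 + band_coord \<alpha> \<beta> p))))"
    using mass_band_profile[OF \<alpha>\<beta> pos] by (simp add: signed_def)
  also have "(\<integral>y. (1::real) \<partial>lborel_Icc 0 1) = 1" using integral_lborel_Icc_const[of 0 1 1] by simp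
  also have "1 / pi * signed (\<lambda>p. pi / 2 * (\<beta> - (\<beta> - \<alpha>) / (1 + band_coord \<alpha> \<beta> p)))
    = 1 / 2 * signed (\<lambda>p. \<beta> - (\<beta> - \<alpha>) / (1 + band_coord \<alpha> \<beta> p))"
    unfolding signed_def by (simp add: distrib_left right_diff_distrib)
  also have "1 / c * ((1 - s2) / 2 * 1 + 1 / 2 * signed (\<lambda>p. \<beta> - (\<beta> - \<alpha>) / (1 + band_coord \<alpha> \<beta> p))) = 1 / c * c"
    using mass by (simp only: signed_def mult_1_right)
  finally show ?thesis using c by simp
qed

lemma log_pot_\<rho>:
  "log_pot \<rho> x = 1 / c * ((1 - s2) / 2 * (ln_prim x - ln_prim (x - 1))
    + 1 / pi * signed (\<lambda>p. pi / 2 * ln_prim x - (\<integral>t. ln_prim (x - band_point \<alpha> \<beta> (band_coord \<alpha> \<beta> p) t) \<partial>quarter)))"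
proof -
  have pos: "band_coord \<alpha> \<beta> p > 0" if "p \<in> {1 + B, 1, - A, 0}" for p
    by (rule band_coord_facts[OF \<alpha>\<beta>(2) poles[OF that]])
  have "log_pot \<rho> x = 1 / c * ((1 - s2) / 2 * (ln_prim (x - 0) - ln_prim (x - 1))
    + 1 / pi * signed (\<lambda>p. log_pot (band_profile \<alpha> \<beta> (band_coord \<alpha> \<beta> p)) x))"
    unfolding log_pot_def using ln_abs_diff_integral[of 0 1 x] by (subst integral_times_\<rho>) auto
  also have "signed (\<lambda>p. log_pot (band_profile \<alpha> \<beta> (band_coord \<alpha> \<beta> p)) x)
    = signed (\<lambda>p. pi / 2 * ln_prim x - (\<integral>t. ln_prim (x - band_point \<alpha> \<beta> (band_coord \<alpha> \<beta> p) t) \<partial>quarter))"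
    by (intro signed_cong log_pot_band_profile \<alpha>\<beta> pos)
  finally show ?thesis by simp
qed

lemma G_log_pot: "G x = - 2 * c * log_pot \<rho> x + ext_field (V_Hahn A B) x"
  unfolding var_deriv_def \<mu>_def using \<rho>_bounds(1)
  by (subst integral_density_measure) (simp_all add: log_pot_def)

lemma ext_field_eq: "ext_field V x = V x + (ln_prim x - ln_prim (x - 1))"
  using ln_abs_diff_integral[of 0 1 x] by (simp add: ext_field_def unit_lborel_def)

text \<open>The contribution of one point p to \<open>G\<close>: a primitive in x of the potential
  of its balayage minus ln |x - p|.\<close>

definition E :: "real \<Rightarrow> real \<Rightarrow> real" where
  "E x p = 2 / pi * (\<integral>t. ln_prim (x - band_point \<alpha> \<beta> (band_coord \<alpha> \<beta> p) t) \<partial>quarter) - ln_prim (x - p)"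

text \<open>V supplies the \<open>ln_prim\<close> terms at - A and 1 + B. The uniform field, the
  constant part of \<rho> and the common term \<open>ln_prim x\<close> of the profiles together
  leave - s4 \<open>ln_prim x\<close> - s2 \<open>ln_prim (x - 1)\<close>, the entries of the signed
  sum at 0 and 1.\<close>

lemma G_eq:
  assumes x: "x \<in> {0..1}"
  shows "G x = A * ln A + (B + 1) * ln (B + 1) - A - B - 1 + signed (E x)"
proof -
  have "V_Hahn A B x = A * ln A + (B + 1) * ln (B + 1) - A - B - 1 - ln_prim (x + A) + ln_prim (x - (1 + B))"
  proof -
    have "\<bar>x + A\<bar> = A + x" "\<bar>x - (1 + B)\<bar> = B + 1 - x" using x A B by auto
    then show ?thesis by (simp add: V_Hahn_def ln_prim_def algebra_simps)
  qed
  moreover define P where "P p = (\<integral>t. ln_prim (x - band_point \<alpha> \<beta> (band_coord \<alpha> \<beta> p) t) \<partial>quarter)" for p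
  moreover define X where "X = 1 / pi * signed (\<lambda>p. pi / 2 * ln_prim x - P p)"
  moreover have "- 2 * c * (1 / c * Y) = - 2 * Y" for Y using c by simp
  ultimately have G: "G x = - 2 * ((1 - s2) / 2 * (ln_prim x - ln_prim (x - 1)) + X)
     + (A * ln A + (B + 1) * ln (B + 1) - A - B - 1 - ln_prim (x + A) + ln_prim (x - (1 + B)) + (ln_prim x - ln_prim (x - 1)))"
    by (simp only: G_log_pot ext_field_eq log_pot_\<rho>)
  define Y where "Y = 1 / pi * signed P"
  have X: "X = (s2 + s4) / 2 * ln_prim x - Y"
    by (simp add: X_def Y_def signed_def field_simps)
  have E: "signed (E x) = 2 * Y + ln_prim (x - (1 + B)) - s2 * ln_prim (x - 1) - ln_prim (x + A) - s4 * ln_prim x"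
    by (simp add: signed_def E_def P_def Y_def algebra_simps)
  show ?thesis unfolding G X E by (simp add: field_simps)
qed

text \<open>The formal derivative of \<open>G\<close>, linked to it through
  \<open>G_increment\<close>.\<close>

definition D :: "real \<Rightarrow> real" where
  "D s = signed (\<lambda>p. 2 / pi * band_ln_pot \<alpha> \<beta> (band_coord \<alpha> \<beta> p) s - ln \<bar>s - p\<bar>)"

lemma G_increment:
  assumes x: "0 \<le> x0" "x0 \<le> x" "x \<le> 1"
  shows "G x - G x0 = (\<integral>s. D s \<partial>lborel_Icc x0 x)" "integrable (lborel_Icc x0 x) D"
proof -
  define d where "d p s = 2 / pi * band_ln_pot \<alpha> \<beta> (band_coord \<alpha> \<beta> p) s - ln \<bar>s - p\<bar>" for p s
  have pos: "band_coord \<alpha> \<beta> p > 0" if "p \<in> {1 + B, 1, - A, 0}" for p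
    by (rule band_coord_facts[OF \<alpha>\<beta>(2) poles[OF that]])
  have l: "integrable (lborel_Icc x0 x) (\<lambda>s. ln \<bar>s - p\<bar>)"
    "(\<integral>s. ln \<bar>s - p\<bar> \<partial>lborel_Icc x0 x) = ln_prim (x - p) - ln_prim (x0 - p)" for p
    using ln_abs_diff_integral[OF x(2), of p] ln_prim_minus[of "x - p"] ln_prim_minus[of "x0 - p"]
    by (simp_all add: abs_minus_commute)
  have i: "integrable (lborel_Icc x0 x) (d p)" if "p \<in> {1 + B, 1, - A, 0}" for p
    unfolding d_def by (intro Bochner_Integration.integrable_diff integrable_mult_right l
        ln_prim_band_point_increment(2)[OF \<alpha>\<beta>(2) pos[OF that] x(2)])
  have d: "E x p - E x0 p = (\<integral>s. d p s \<partial>lborel_Icc x0 x)" if "p \<in> {1 + B, 1, - A, 0}" for p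
  proof -
    note inc = ln_prim_band_point_increment[OF \<alpha>\<beta>(2) pos[OF that] x(2)]
    have "(\<integral>s. d p s \<partial>lborel_Icc x0 x) = 2 / pi * (\<integral>s. band_ln_pot \<alpha> \<beta> (band_coord \<alpha> \<beta> p) s \<partial>lborel_Icc x0 x)
       - (ln_prim (x - p) - ln_prim (x0 - p))"
      unfolding d_def by (simp only: Bochner_Integration.integral_diff[OF integrable_mult_right[OF inc(2)] l(1)]
          integral_mult_right_zero l(2))
    then show ?thesis unfolding inc(1)[symmetric] E_def by (simp add: right_diff_distrib)
  qed
  have i': "integrable (lborel_Icc x0 x) (d (1 + B))" "integrable (lborel_Icc x0 x) (d 1)"
    "integrable (lborel_Icc x0 x) (d (- A))" "integrable (lborel_Icc x0 x) (d 0)"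
    by (rule i; simp)+
  have D: "D = (\<lambda>s. (- 1) * d (1 + B) s + (s2 * d 1 s + (d (- A) s + s4 * d 0 s)))"
    by (simp add: D_def d_def signed_def fun_eq_iff)
  show "integrable (lborel_Icc x0 x) D"
    unfolding D by (intro Bochner_Integration.integrable_add integrable_mult_right i')
  have "(\<integral>s. D s \<partial>lborel_Icc x0 x) = (- 1) * (\<integral>s. d (1 + B) s \<partial>lborel_Icc x0 x) + (s2 * (\<integral>s. d 1 s \<partial>lborel_Icc x0 x)
      + ((\<integral>s. d (- A) s \<partial>lborel_Icc x0 x) + s4 * (\<integral>s. d 0 s \<partial>lborel_Icc x0 x)))"
    unfolding D by (simp only: integral_mult_right_zero Bochner_Integration.integral_add
        Bochner_Integration.integrable_add integrable_mult_right i')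
  then show "G x - G x0 = (\<integral>s. D s \<partial>lborel_Icc x0 x)"
    using x by (simp add: G_eq signed_def d[symmetric] algebra_simps)
qed

section \<open>Sign of the derivative on and off the band\<close>

lemma green_at_infinity: "signed (\<lambda>p. ln \<bar>(1 + band_coord \<alpha> \<beta> p) / (1 - band_coord \<alpha> \<beta> p)\<bar>) = 0"
  using green_sum_sign(1)[OF signs coord_order endpoint] by (simp add: signed_def)

lemma D_inside: 
  assumes "\<alpha> < s" "s < \<beta>"
  shows "D s = 0"
proof -
  have "D s = signed (\<lambda>p. - ln \<bar>(1 + band_coord \<alpha> \<beta> p) / (1 - band_coord \<alpha> \<beta> p)\<bar>)"
    unfolding D_def by (intro signed_cong band_green_inside \<alpha>\<beta> poles assms)
  then show ?thesis using green_at_infinity by (simp add: signed_def)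
qed

lemma D_outside:
  assumes "0 < s" "s < 1" "s < \<alpha> \<or> \<beta> < s"
  shows "D s = signed (\<lambda>p. ln \<bar>(band_coord \<alpha> \<beta> s + band_coord \<alpha> \<beta> p) / (band_coord \<alpha> \<beta> s - band_coord \<alpha> \<beta> p)\<bar>)"
proof -
  have "D s = signed (\<lambda>p. ln \<bar>(band_coord \<alpha> \<beta> s + band_coord \<alpha> \<beta> p) / (band_coord \<alpha> \<beta> s - band_coord \<alpha> \<beta> p)\<bar>
     - ln \<bar>(1 + band_coord \<alpha> \<beta> p) / (1 - band_coord \<alpha> \<beta> p)\<bar>)"
    unfolding D_def by (intro signed_cong band_green_outside \<alpha>\<beta> poles assms) (use assms A B in auto)
  then show ?thesis using green_at_infinity by (simp add: signed_def algebra_simps)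
qed

text \<open>Coordinates decrease along each side of the band, so a point between \<beta> and 1 has a
  coordinate above that of 1, and a point between 0 and \<alpha> one below that of 0: the two ranges
  of \<open>green_sum_sign\<close>.\<close>

lemma D_right: "\<beta> < s \<Longrightarrow> s < 1 \<Longrightarrow> s2 * D s > 0"
  using green_sum_sign(2)[OF signs coord_order endpoint, of "band_coord \<alpha> \<beta> s"]
    band_coord_right_antimono[OF \<alpha>\<beta>(2), of s 1] \<alpha>\<beta> by (simp add: D_outside signed_def)

lemma D_left: "0 < s \<Longrightarrow> s < \<alpha> \<Longrightarrow> s4 * D s > 0"
  using green_sum_sign(3)[OF signs coord_order endpoint, of "band_coord \<alpha> \<beta> s"]
    band_coord_left_antimono[OF \<alpha>\<beta>(2), of 0 s] band_coord_left[OF \<alpha>\<beta>(2), of s] \<alpha>\<beta> by (simp add: D_outside signed_def)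

lemma AE_interior: "AE s in lborel_Icc a b. a < s \<and> s < b"
  by (rule AE_mp[OF AE_lborel_Icc_not_in_finite[of "{a, b}"]], simp) (auto intro!: AE_I2)

lemma G_band:
  assumes "\<alpha> \<le> x" "x \<le> \<beta>"
  shows "G x = G \<beta>"
proof -
  have "G \<beta> - G x = (\<integral>s. D s \<partial>lborel_Icc x \<beta>)" using assms \<alpha>\<beta> by (intro G_increment) auto
  also have "\<dots> = (\<integral>s. 0 \<partial>lborel_Icc x \<beta>)"
  proof (rule integral_cong_AE)
    show "D \<in> borel_measurable (lborel_Icc x \<beta>)"
      using G_increment(2)[of x \<beta>] assms \<alpha>\<beta> by auto
    show "AE s in lborel_Icc x \<beta>. D s = 0"
      using AE_interior[of x \<beta>] by eventually_elim (use assms D_inside in auto)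
  qed simp
  finally show ?thesis by simp
qed

lemma G_right:
  assumes "\<beta> < x" "x \<le> 1"
  shows "s2 * (G x - G \<beta>) > 0"
proof -
  have i: "G x - G \<beta> = (\<integral>s. D s \<partial>lborel_Icc \<beta> x)" "integrable (lborel_Icc \<beta> x) D"
    using assms \<alpha>\<beta> by (auto intro!: G_increment)
  have "(\<integral>s. s2 * D s \<partial>lborel_Icc \<beta> x) > 0"
  proof (rule integral_lborel_Icc_pos)
    show "AE s in lborel_Icc \<beta> x. s2 * D s > 0"
      using AE_interior[of \<beta> x] by eventually_elim (use assms D_right in auto)
  qed (use assms i in auto)
  then show ?thesis by (simp add: i)
qed

lemma G_left:
  assumes "0 \<le> x" "x < \<alpha>"
  shows "s4 * (G \<beta> - G x) > 0"
proof -
  have i: "G \<alpha> - G x = (\<integral>s. D s \<partial>lborel_Icc x \<alpha>)" "integrable (lborel_Icc x \<alpha>) D"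
    using assms \<alpha>\<beta> by (auto intro!: G_increment)
  have "(\<integral>s. s4 * D s \<partial>lborel_Icc x \<alpha>) > 0"
  proof (rule integral_lborel_Icc_pos)
    show "AE s in lborel_Icc x \<alpha>. s4 * D s > 0"
      using AE_interior[of x \<alpha>] by eventually_elim (use assms D_left in auto)
  qed (use assms i in auto)
  moreover have "G \<alpha> = G \<beta>" using \<alpha>\<beta> by (intro G_band) auto
  ultimately show ?thesis by (simp add: i flip: i(1))
qed

lemma unique_minimizer: "is_unique_minimizer (V_Hahn A B) c \<mu>"
proof -
  have V_eq: "ext_field (V_Hahn A B) = (\<lambda>x. V_Hahn A B x + (ln_prim x - ln_prim (x - 1)))"
    by (rule ext) (rule ext_field_eq)
  have [measurable]: "V_Hahn A B \<in> borel_measurable borel"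
    unfolding V_Hahn_def[abs_def] by measurable
  have V: "ext_field (V_Hahn A B) \<in> borel_measurable borel" unfolding V_eq by measurable
  have "continuous_on {0..1} (ext_field (V_Hahn A B))"
    unfolding V_eq unfolding V_Hahn_def using A B by (intro continuous_intros) auto
  then have "bounded (ext_field (V_Hahn A B) ` {0..1})"
    by (intro compact_imp_bounded compact_continuous_image) auto
  then obtain M where "\<forall>x\<in>{0..1}. \<bar>ext_field (V_Hahn A B) x\<bar> \<le> M"
    by (auto simp: bounded_iff)
  then have M: "\<bar>ext_field (V_Hahn A B) x\<bar> \<le> M" if "x \<in> {0..1}" for x
    using that by blast
  have *: "(0 < \<rho> x \<longrightarrow> G x \<le> G \<beta>) \<and> (\<rho> x < 1 / c \<longrightarrow> G \<beta> \<le> G x)" if "x \<in> {0..1}" for x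
  proof -
    consider "x < \<alpha>" | "\<alpha> \<le> x" "x \<le> \<beta>" | "\<beta> < x" by linarith
    then show ?thesis
    proof cases
      case 1
      then show ?thesis using G_left[of x] that signs c by (auto simp: \<rho>_left elim!: band_signs_cases)
    next
      case 2
      then show ?thesis using G_band[of x] by simp
    next
      case 3
      then show ?thesis using G_right[of x] that signs c by (auto simp: \<rho>_right elim!: band_signs_cases)
    qed
  qed
  have 1: "AE x in lborel_Icc 0 1. 0 < \<rho> x \<longrightarrow> - 2 * c * log_pot \<rho> x + ext_field (V_Hahn A B) x \<le> G \<beta>"
    unfolding G_log_pot[symmetric] using * by (intro AE_I2) simp
  have 2: "AE x in lborel_Icc 0 1. \<rho> x < 1 / c \<longrightarrow> G \<beta> \<le> - 2 * c * log_pot \<rho> x + ext_field (V_Hahn A B) x"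
    unfolding G_log_pot[symmetric] using * by (intro AE_I2) simp
  have "is_unique_minimizer (V_Hahn A B) c (density_measure \<rho>)"
    by (rule variational_conditions_sufficient[OF c \<rho>_measurable \<rho>_bounds \<rho>_mass V M 1 2])
  then show ?thesis by (simp only: \<mu>_def)
qed

section \<open>Density and multiplier of the minimizer\<close>

lemma dens_\<mu>: "AE x in unit_lborel. dens \<mu> x = \<rho> x"
proof -
  interpret L: finite_measure unit_lborel
    unfolding unit_lborel_def by (rule finite_measure_lborel_Icc)
  have "AE x in unit_lborel. ennreal (\<rho> x) = RN_deriv unit_lborel \<mu> x"
    by (rule L.RN_deriv_unique) (simp_all add: \<mu>_def unit_lborel_def)
  then show ?thesis
  proof eventually_elim
    case (elim x)
    then show ?case using \<rho>_bounds(1) by (simp add: dens_def flip: elim)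
  qed
qed

text \<open>The open band is itself a possible J and forces the value. Conversely, a witness in J
  excludes every region whose density violates the condition on J, so J lies where \<open>G\<close>
  compares with \<open>G \<beta>\<close> as required.\<close>

lemma multiplier_iff: "is_multiplier (V_Hahn A B) c \<mu> l \<longleftrightarrow> l = G \<beta>"
proof
  assume l: "is_multiplier (V_Hahn A B) c \<mu> l"
  have "open_subinterval {\<alpha><..<\<beta>}"
    unfolding open_subinterval_def using \<alpha>\<beta> by (auto intro!: open_subset is_interval_oo)
  moreover have "AE x in unit_lborel. x \<in> {\<alpha><..<\<beta>} \<longrightarrow> 0 < dens \<mu> x \<and> dens \<mu> x < 1 / c"
    using dens_\<mu> by eventually_elim (use \<rho>_band in auto)
  ultimately have "\<forall>x\<in>{\<alpha><..<\<beta>}. G x = l" using l unfolding is_multiplier_def by blast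
  then have "G ((\<alpha> + \<beta>) / 2) = l" using \<alpha>\<beta> by auto
  then show "l = G \<beta>" using G_band[of "(\<alpha> + \<beta>) / 2"] \<alpha>\<beta> by simp
next
  assume l: "l = G \<beta>"
  show "is_multiplier (V_Hahn A B) c \<mu> l"
    unfolding is_multiplier_def l
  proof (intro allI impI)
    fix J assume "open_subinterval J"
    then have J: "openin (top_of_set {0..1}) J" by (simp add: open_subinterval_def)
    then have J01: "J \<subseteq> {0..1}" by (auto simp: openin_open)
    have left: "\<exists>y. P (dens \<mu> y) \<and> dens \<mu> y = (1 + s4) / 2 / c"
      if P: "AE x in unit_lborel. x \<in> J \<longrightarrow> P (dens \<mu> x)" and x: "x \<in> J" "x < \<alpha>" for P x
    proof -
      from P dens_\<mu> have ae: "AE y in unit_lborel. (y \<in> J \<longrightarrow> P (dens \<mu> y)) \<and> dens \<mu> y = \<rho> y" by eventually_elim auto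
      obtain y where "y \<in> J" "y < \<alpha>" "(y \<in> J \<longrightarrow> P (dens \<mu> y)) \<and> dens \<mu> y = \<rho> y"
        by (rule openin_unit_interval_AE_meets[OF J x(1) _ _ _ _ _ ae, of "0" "\<alpha>"]) (use x J01 \<alpha>\<beta> in auto)
      then show ?thesis using \<rho>_left[of y] by auto
    qed
    have right: "\<exists>y. P (dens \<mu> y) \<and> dens \<mu> y = (1 - s2) / 2 / c"
      if P: "AE x in unit_lborel. x \<in> J \<longrightarrow> P (dens \<mu> x)" and x: "x \<in> J" "\<beta> < x" for P x
    proof -
      from P dens_\<mu> have ae: "AE y in unit_lborel. (y \<in> J \<longrightarrow> P (dens \<mu> y)) \<and> dens \<mu> y = \<rho> y" by eventually_elim auto
      obtain y where "y \<in> J" "\<beta> < y" "(y \<in> J \<longrightarrow> P (dens \<mu> y)) \<and> dens \<mu> y = \<rho> y"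
        by (rule openin_unit_interval_AE_meets[OF J x(1) _ _ _ _ _ ae, of "\<beta>" "1"]) (use x J01 \<alpha>\<beta> in auto)
      then show ?thesis using \<rho>_right[of y] by auto
    qed
    \<comment> \<open>The band is taken closed: at \<alpha> and \<beta> the derivative
      \<open>G\<close> equals the multiplier, so for the strict inequalities J has to avoid these
      points too.\<close>
    have mid: "\<exists>y. P (dens \<mu> y) \<and> 0 < dens \<mu> y \<and> dens \<mu> y < 1 / c"
      if P: "AE x in unit_lborel. x \<in> J \<longrightarrow> P (dens \<mu> x)" and x: "x \<in> J" "\<alpha> \<le> x" "x \<le> \<beta>" for P x
    proof -
      from P dens_\<mu> have ae: "AE y in unit_lborel. (y \<in> J \<longrightarrow> P (dens \<mu> y)) \<and> dens \<mu> y = \<rho> y" by eventually_elim auto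
      obtain y where "y \<in> J" "\<alpha> < y" "y < \<beta>" "(y \<in> J \<longrightarrow> P (dens \<mu> y)) \<and> dens \<mu> y = \<rho> y"
        by (rule openin_unit_interval_AE_meets[OF J x(1) _ _ _ _ _ ae, of "\<alpha>" "\<beta>"]) (use x J01 \<alpha>\<beta> in auto)
      then show ?thesis using \<rho>_band[of y] by auto
    qed
    have pos: "x \<in> J \<Longrightarrow> 0 \<le> x \<and> x \<le> 1" for x using J01 by auto
    show "((AE x in unit_lborel. x \<in> J \<longrightarrow> 0 < dens \<mu> x \<and> dens \<mu> x < 1 / c) \<longrightarrow> (\<forall>x\<in>J. G x = G \<beta>)) \<and>
      ((AE x in unit_lborel. x \<in> J \<longrightarrow> dens \<mu> x = 0) \<longrightarrow> (\<forall>x\<in>J. G x > G \<beta>)) \<and>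
      ((AE x in unit_lborel. x \<in> J \<longrightarrow> dens \<mu> x = 1 / c) \<longrightarrow> (\<forall>x\<in>J. G x < G \<beta>))"
    proof (intro conjI impI ballI)
      fix x assume P: "AE x in unit_lborel. x \<in> J \<longrightarrow> 0 < dens \<mu> x \<and> dens \<mu> x < 1 / c" and x: "x \<in> J"
      have "\<not> x < \<alpha>" using left[OF P x] signs c by (auto elim!: band_signs_cases)
      moreover have "\<not> \<beta> < x" using right[OF P x] signs c by (auto elim!: band_signs_cases)
      ultimately show "G x = G \<beta>" by (intro G_band) auto
    next
      fix x assume P: "AE x in unit_lborel. x \<in> J \<longrightarrow> dens \<mu> x = 0" and x: "x \<in> J"
      have "x < \<alpha> \<or> \<beta> < x" using mid[OF P x] by force
      then show "G x > G \<beta>"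
        using left[OF P x] right[OF P x] G_left[of x] G_right[of x] pos[OF x] signs c by (auto elim!: band_signs_cases)
    next
      fix x assume P: "AE x in unit_lborel. x \<in> J \<longrightarrow> dens \<mu> x = 1 / c" and x: "x \<in> J"
      have "x < \<alpha> \<or> \<beta> < x" using mid[OF P x] by force
      then show "G x < G \<beta>"
        using left[OF P x] right[OF P x] G_left[of x] G_right[of x] pos[OF x] signs c by (auto elim!: band_signs_cases)
    qed
  qed
qed

lemma G_right_end:
  "G \<beta> = ext_field (V_Hahn A B) \<beta> - (1 - s2) * (ln_prim \<beta> - ln_prim (\<beta> - 1)) - (s2 + s4) * ln_prim \<beta>
    + (\<beta> - \<alpha>) * signed (\<lambda>p. let k = band_coord \<alpha> \<beta> p in
       (ln (\<beta> - \<alpha>) - 1) / (1 + k) + (2 * k * ln 2 - 2 * ln (1 + k)) / (1 - k\<^sup>2))"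
proof -
  define q where "q p = (let k = band_coord \<alpha> \<beta> p in
       (ln (\<beta> - \<alpha>) - 1) / (1 + k) + (2 * k * ln 2 - 2 * ln (1 + k)) / (1 - k\<^sup>2))" for p
  have "signed (\<lambda>p. pi / 2 * ln_prim \<beta> - (\<integral>t. ln_prim (\<beta> - band_point \<alpha> \<beta> (band_coord \<alpha> \<beta> p) t) \<partial>quarter))
    = signed (\<lambda>p. pi / 2 * (ln_prim \<beta> - (\<beta> - \<alpha>) * q p))"
  proof (rule signed_cong)
    fix p assume "p \<in> {1 + B, 1, - A, 0}"
    note k = band_coord_facts[OF \<alpha>\<beta>(2) poles[OF this]]
    show "pi / 2 * ln_prim \<beta> - (\<integral>t. ln_prim (\<beta> - band_point \<alpha> \<beta> (band_coord \<alpha> \<beta> p) t) \<partial>quarter)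
      = pi / 2 * (ln_prim \<beta> - (\<beta> - \<alpha>) * q p)"
      unfolding ln_prim_band_point_right_end[OF \<alpha>\<beta>(2) k(1,2)] q_def Let_def by (simp add: right_diff_distrib)
  qed
  also have "\<dots> = pi / 2 * ((s2 + s4) * ln_prim \<beta> - (\<beta> - \<alpha>) * signed q)"
    by (simp add: signed_def algebra_simps)
  finally have sg: "signed (\<lambda>p. pi / 2 * ln_prim \<beta> - (\<integral>t. ln_prim (\<beta> - band_point \<alpha> \<beta> (band_coord \<alpha> \<beta> p) t) \<partial>quarter))
    = pi / 2 * ((s2 + s4) * ln_prim \<beta> - (\<beta> - \<alpha>) * signed q)" .
  have "- 2 * c * (1 / c * Y) = - 2 * Y" for Y using c by simp
  then have "G \<beta> = - 2 * ((1 - s2) / 2 * (ln_prim \<beta> - ln_prim (\<beta> - 1))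
      + 1 / pi * (pi / 2 * ((s2 + s4) * ln_prim \<beta> - (\<beta> - \<alpha>) * signed q))) + ext_field (V_Hahn A B) \<beta>"
    by (simp only: G_log_pot log_pot_\<rho> sg)
  also have "- 2 * ((1 - s2) / 2 * u + 1 / pi * (pi / 2 * (v - w))) + e = e - (1 - s2) * u - v + w" for u v w e
    by (simp add: field_simps)
  finally have "G \<beta> = ext_field (V_Hahn A B) \<beta> - (1 - s2) * (ln_prim \<beta> - ln_prim (\<beta> - 1)) - (s2 + s4) * ln_prim \<beta>
    + (\<beta> - \<alpha>) * signed q" .
  then show ?thesis by (simp only: q_def[abs_def])
qed

end

section \<open>The Hahn parameters\<close>

text \<open>Once both distances are squares, the root of their quotient is rational in X and Y. In
  the mass term what remains is the geometric mean of the distances, |X^2 - Y^2| / d^2, which is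
  rational in X^2 and Y^2.\<close>

lemma band_coord_square_right:
  fixes X Y d :: real
  assumes pos: "X > 0" "Y > 0" "d > 0" "X \<noteq> Y"
    and p: "p - \<alpha> = ((X + Y) / d)\<^sup>2" "p - \<beta> = ((X - Y) / d)\<^sup>2"
  shows "band_coord \<alpha> \<beta> p = (X + Y) / \<bar>X - Y\<bar>"
    and "\<beta> - (\<beta> - \<alpha>) / (1 + band_coord \<alpha> \<beta> p) = p - \<bar>X\<^sup>2 - Y\<^sup>2\<bar> / d\<^sup>2"
proof -
  show k: "band_coord \<alpha> \<beta> p = (X + Y) / \<bar>X - Y\<bar>"
    unfolding band_coord_def p using pos by (simp add: real_sqrt_divide power_divide)
  have ab: "\<beta> - \<alpha> = 4 * X * Y / d\<^sup>2"
    using p pos by (simp add: power_divide field_simps power2_eq_square)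
  have \<beta>: "\<beta> = p - (X - Y)\<^sup>2 / d\<^sup>2" using p by (simp add: power_divide)
  show "\<beta> - (\<beta> - \<alpha>) / (1 + band_coord \<alpha> \<beta> p) = p - \<bar>X\<^sup>2 - Y\<^sup>2\<bar> / d\<^sup>2"
  proof (cases "X > Y")
    case True
    then have k1: "1 + band_coord \<alpha> \<beta> p = 2 * X / (X - Y)" by (simp add: k field_simps)
    have "\<bar>X\<^sup>2 - Y\<^sup>2\<bar> = X\<^sup>2 - Y\<^sup>2" using True pos by (simp add: power_mono)
    moreover have "(\<beta> - \<alpha>) / (2 * X / (X - Y)) = 2 * Y * (X - Y) / d\<^sup>2"
      unfolding ab using True pos by (simp add: field_simps)
    ultimately show ?thesis unfolding k1
      by (simp only: \<beta>) (simp add: power2_eq_square field_simps diff_divide_distrib add_divide_distrib)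
  next
    case False
    then have k1: "1 + band_coord \<alpha> \<beta> p = 2 * Y / (Y - X)" using pos by (simp add: k field_simps)
    have "\<bar>X\<^sup>2 - Y\<^sup>2\<bar> = Y\<^sup>2 - X\<^sup>2" using False pos by (simp add: power_mono)
    moreover have "(\<beta> - \<alpha>) / (2 * Y / (Y - X)) = 2 * X * (Y - X) / d\<^sup>2"
      unfolding ab using False pos by (simp add: field_simps)
    ultimately show ?thesis unfolding k1
      by (simp only: \<beta>) (simp add: power2_eq_square field_simps diff_divide_distrib add_divide_distrib)
  qed
qed

lemma band_coord_square_left:
  fixes X Y d :: real
  assumes pos: "X > 0" "Y > 0" "d > 0" "X \<noteq> Y"
    and p: "\<alpha> - p = ((X - Y) / d)\<^sup>2" "\<beta> - p = ((X + Y) / d)\<^sup>2"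
  shows "band_coord \<alpha> \<beta> p = \<bar>X - Y\<bar> / (X + Y)"
    and "\<beta> - (\<beta> - \<alpha>) / (1 + band_coord \<alpha> \<beta> p) = p + \<bar>X\<^sup>2 - Y\<^sup>2\<bar> / d\<^sup>2"
proof -
  have "(p - \<alpha>) / (p - \<beta>) = (\<alpha> - p) / (\<beta> - p)"
    by (cases "p = \<beta>") (auto simp: field_simps)
  then show k: "band_coord \<alpha> \<beta> p = \<bar>X - Y\<bar> / (X + Y)"
    unfolding band_coord_def p using pos by (simp add: real_sqrt_divide power_divide)
  have ab: "\<beta> - \<alpha> = 4 * X * Y / d\<^sup>2"
    using p pos by (simp add: power_divide field_simps power2_eq_square)
  have \<beta>: "\<beta> = p + (X + Y)\<^sup>2 / d\<^sup>2" using p by (simp add: power_divide)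
  show "\<beta> - (\<beta> - \<alpha>) / (1 + band_coord \<alpha> \<beta> p) = p + \<bar>X\<^sup>2 - Y\<^sup>2\<bar> / d\<^sup>2"
  proof (cases "X > Y")
    case True
    then have k1: "1 + band_coord \<alpha> \<beta> p = 2 * X / (X + Y)" using pos by (simp add: k field_simps)
    have "\<bar>X\<^sup>2 - Y\<^sup>2\<bar> = X\<^sup>2 - Y\<^sup>2" using True pos by (simp add: power_mono)
    moreover have "(\<beta> - \<alpha>) / (2 * X / (X + Y)) = 2 * Y * (X + Y) / d\<^sup>2"
      unfolding ab using True pos by (simp add: field_simps)
    ultimately show ?thesis unfolding k1
      by (simp only: \<beta>) (simp add: power2_eq_square field_simps diff_divide_distrib add_divide_distrib)
  next
    case False
    then have k1: "1 + band_coord \<alpha> \<beta> p = 2 * Y / (X + Y)" using pos by (simp add: k field_simps)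
    have "\<bar>X\<^sup>2 - Y\<^sup>2\<bar> = Y\<^sup>2 - X\<^sup>2" using False pos by (simp add: power_mono)
    moreover have "(\<beta> - \<alpha>) / (2 * Y / (X + Y)) = 2 * X * (X + Y) / d\<^sup>2"
      unfolding ab using False pos by (simp add: field_simps)
    ultimately show ?thesis unfolding k1
      by (simp only: \<beta>) (simp add: power2_eq_square field_simps diff_divide_distrib add_divide_distrib)
  qed
qed

text \<open>The threshold is the positive root of c^2 + S c = P, and completing the square compares
  it with c.\<close>

lemma less_quadratic_root_iff:
  fixes S P c :: real
  assumes "0 \<le> S" "0 < P" "0 < c"
  shows "c < (- S + sqrt (S\<^sup>2 + 4 * P)) / 2 \<longleftrightarrow> c\<^sup>2 + S * c < P"
    and "(- S + sqrt (S\<^sup>2 + 4 * P)) / 2 < c \<longleftrightarrow> P < c\<^sup>2 + S * c"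
proof -
  have sq: "(2 * c + S)\<^sup>2 = S\<^sup>2 + 4 * (c\<^sup>2 + S * c)" by (simp add: power2_eq_square algebra_simps)
  have eq: "sqrt ((2 * c + S)\<^sup>2) = 2 * c + S" using assms by simp
  have "c < (- S + sqrt (S\<^sup>2 + 4 * P)) / 2 \<longleftrightarrow> sqrt ((2 * c + S)\<^sup>2) < sqrt (S\<^sup>2 + 4 * P)"
    unfolding eq by auto
  also have "\<dots> \<longleftrightarrow> c\<^sup>2 + S * c < P" unfolding sq real_sqrt_less_iff by auto
  finally show "c < (- S + sqrt (S\<^sup>2 + 4 * P)) / 2 \<longleftrightarrow> c\<^sup>2 + S * c < P" .
  have "(- S + sqrt (S\<^sup>2 + 4 * P)) / 2 < c \<longleftrightarrow> sqrt (S\<^sup>2 + 4 * P) < sqrt ((2 * c + S)\<^sup>2)"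
    unfolding eq by auto
  also have "\<dots> \<longleftrightarrow> P < c\<^sup>2 + S * c" unfolding sq real_sqrt_less_iff by auto
  finally show "(- S + sqrt (S\<^sup>2 + 4 * P)) / 2 < c \<longleftrightarrow> P < c\<^sup>2 + S * c" .
qed

text \<open>For each \<open>p\<close> among \<open>0, 1, - A, 1 + B\<close> the distances from \<open>p\<close> to the two endpoints are
  \<open>((X \<plusminus> Y) / d)\<^sup>2\<close>, where \<open>X\<^sup>2\<close> and \<open>Y\<^sup>2\<close> are complementary products of the six linear factors of
  \<open>hahn_D\<close>.\<close>

lemma hahn_band_instance:
  fixes A B c :: real
  assumes A: "0 < A" and B: "0 < B" and c: "0 < c" "c < 1"
    and sg: "band_signs s2 s4"
    and s4: "s4 * (c\<^sup>2 + (A + B) * c - A) > 0" and s2: "s2 * (B - (c\<^sup>2 + (A + B) * c)) > 0"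
  shows "hahn_band A B c (hahn_alpha A B c) (hahn_beta A B c) s2 s4"
proof -
  define a b e f g h where "a = sqrt c" "b = sqrt (1 - c)" "e = sqrt (A + c)" "f = sqrt (B + c)"
    "g = sqrt (A + B + c)" "h = sqrt (A + B + c + 1)"
  note defs = this
  have pos: "a > 0" "b > 0" "e > 0" "f > 0" "g > 0" "h > 0" using A B c by (auto simp: defs)
  have sq: "a\<^sup>2 = c" "b\<^sup>2 = 1 - c" "e\<^sup>2 = A + c" "f\<^sup>2 = B + c" "g\<^sup>2 = A + B + c" "h\<^sup>2 = A + B + c + 1"
    using A B c by (auto simp: defs)
  define d where "d = A + B + 2 * c"
  have d: "d > 0" using A B c by (simp add: d_def)
  define \<alpha> \<beta> where "\<alpha> = hahn_alpha A B c" and "\<beta> = hahn_beta A B c"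
  define M where "M = (B - A + 2) * c\<^sup>2 + (A + B) * (B - A + 2) * c + A * (A + B)"
  have sqrtD: "sqrt (hahn_D A B c) = a * b * e * f * g * h"
    unfolding hahn_D_def defs by (simp add: real_sqrt_mult mult_ac)
  have \<alpha>: "\<alpha> = (M - 2 * (a * b * e * f * g * h)) / d\<^sup>2" and \<beta>: "\<beta> = (M + 2 * (a * b * e * f * g * h)) / d\<^sup>2"
    unfolding \<alpha>_def \<beta>_def hahn_alpha_def hahn_beta_def sqrtD M_def d_def by simp_all
  \<comment> \<open>Index 0 belongs to the point 0, the indices 1, 2, 3 to 1 + B, 1, - A. Each
    product of an x with its y is the root of \<open>hahn_D\<close>.\<close>
  define x0 y0 x2 y2 x3 y3 x1 y1 where "x0 = b * e * g" "y0 = a * f * h" "x2 = b * f * g" "y2 = a * e * h"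
    "x3 = e * g * h" "y3 = a * b * f" "x1 = f * g * h" "y1 = a * b * e"
  note xy = this
  have xypos: "x0 > 0" "y0 > 0" "x1 > 0" "y1 > 0" "x2 > 0" "y2 > 0" "x3 > 0" "y3 > 0"
    using pos by (auto simp: xy)
  have prod: "a * b * e * f * g * h = x0 * y0" "a * b * e * f * g * h = x1 * y1"
    "a * b * e * f * g * h = x2 * y2" "a * b * e * f * g * h = x3 * y3"
    by (simp_all add: xy mult_ac)
  have sqs: "x0\<^sup>2 = (1 - c) * (A + c) * (A + B + c)" "y0\<^sup>2 = c * (B + c) * (A + B + c + 1)"
    "x2\<^sup>2 = (1 - c) * (B + c) * (A + B + c)" "y2\<^sup>2 = c * (A + c) * (A + B + c + 1)"
    "x3\<^sup>2 = (A + c) * (A + B + c) * (A + B + c + 1)" "y3\<^sup>2 = c * (1 - c) * (B + c)"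
    "x1\<^sup>2 = (B + c) * (A + B + c) * (A + B + c + 1)" "y1\<^sup>2 = c * (1 - c) * (A + c)"
    by (simp_all add: xy power_mult_distrib sq)
  have M0: "M = x0\<^sup>2 + y0\<^sup>2" unfolding M_def sqs by algebra
  have M1: "(1 + B) * d\<^sup>2 - M = x1\<^sup>2 + y1\<^sup>2" unfolding M_def d_def sqs by algebra
  have M2: "d\<^sup>2 - M = x2\<^sup>2 + y2\<^sup>2" unfolding M_def d_def sqs by algebra
  have M3: "M + A * d\<^sup>2 = x3\<^sup>2 + y3\<^sup>2" unfolding M_def d_def sqs by algebra
  have d2: "d\<^sup>2 > 0" using d by simp
  have p0: "\<alpha> - 0 = ((x0 - y0) / d)\<^sup>2" "\<beta> - 0 = ((x0 + y0) / d)\<^sup>2"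
    unfolding \<alpha> \<beta> prod(1) M0 by (simp_all add: power_divide power2_sum power2_diff)
  have p1: "1 + B - \<alpha> = ((x1 + y1) / d)\<^sup>2" "1 + B - \<beta> = ((x1 - y1) / d)\<^sup>2"
  proof -
    have "1 + B - \<alpha> = ((1 + B) * d\<^sup>2 - M + 2 * (x1 * y1)) / d\<^sup>2" "1 + B - \<beta> = ((1 + B) * d\<^sup>2 - M - 2 * (x1 * y1)) / d\<^sup>2"
      unfolding \<alpha> \<beta> prod(2) using d by (simp_all add: field_simps)
    then show "1 + B - \<alpha> = ((x1 + y1) / d)\<^sup>2" "1 + B - \<beta> = ((x1 - y1) / d)\<^sup>2"
      unfolding M1 by (simp_all add: power_divide power2_sum power2_diff)
  qed
  have p2: "1 - \<alpha> = ((x2 + y2) / d)\<^sup>2" "1 - \<beta> = ((x2 - y2) / d)\<^sup>2"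
  proof -
    have "1 - \<alpha> = (d\<^sup>2 - M + 2 * (x2 * y2)) / d\<^sup>2" "1 - \<beta> = (d\<^sup>2 - M - 2 * (x2 * y2)) / d\<^sup>2"
      unfolding \<alpha> \<beta> prod(3) using d by (simp_all add: field_simps)
    then show "1 - \<alpha> = ((x2 + y2) / d)\<^sup>2" "1 - \<beta> = ((x2 - y2) / d)\<^sup>2"
      unfolding M2 by (simp_all add: power_divide power2_sum power2_diff)
  qed
  have p3: "\<alpha> - (- A) = ((x3 - y3) / d)\<^sup>2" "\<beta> - (- A) = ((x3 + y3) / d)\<^sup>2"
  proof -
    have "\<alpha> - (- A) = (M + A * d\<^sup>2 - 2 * (x3 * y3)) / d\<^sup>2" "\<beta> - (- A) = (M + A * d\<^sup>2 + 2 * (x3 * y3)) / d\<^sup>2"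
      unfolding \<alpha> \<beta> prod(4) using d by (simp_all add: field_simps)
    then show "\<alpha> - (- A) = ((x3 - y3) / d)\<^sup>2" "\<beta> - (- A) = ((x3 + y3) / d)\<^sup>2"
      unfolding M3 by (simp_all add: power_divide power2_sum power2_diff)
  qed
  \<comment> \<open>The order of x0 and y0, and of x2 and y2, is decided by the quadratics whose
    positive roots are c_A and c_B; here the case distinction on c enters.\<close>
  have diff0: "y0\<^sup>2 - x0\<^sup>2 = d * (c\<^sup>2 + (A + B) * c - A)" unfolding sqs d_def by algebra
  have diff2: "x2\<^sup>2 - y2\<^sup>2 = d * (B - (c\<^sup>2 + (A + B) * c))" unfolding sqs d_def by algebra
  have s: "s2 = 1 \<or> s2 = -1" "s4 = 1 \<or> s4 = -1" using sg by (auto simp: band_signs_def)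
  have s4': "s4 * (y0\<^sup>2 - x0\<^sup>2) > 0" and s2': "s2 * (x2\<^sup>2 - y2\<^sup>2) > 0"
    unfolding diff0 diff2 using mult_pos_pos[OF d s4] mult_pos_pos[OF d s2] by (simp_all add: mult_ac)
  have neq0: "x0 \<noteq> y0" and neq2: "x2 \<noteq> y2" using s4' s2' by auto
  have abs0: "\<bar>x0\<^sup>2 - y0\<^sup>2\<bar> = s4 * (y0\<^sup>2 - x0\<^sup>2)" using s4' s by auto
  have abs2: "\<bar>x2\<^sup>2 - y2\<^sup>2\<bar> = s2 * (x2\<^sup>2 - y2\<^sup>2)" using s2' s by auto
  \<comment> \<open>At - A and 1 + B the order of x and y is the same in all three cases.\<close>
  have less3: "y3 < x3"
  proof -
    have "c * (1 - c) * (B + c) < (A + c) * (A + B + c + 1) * (A + B + c)"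
      using A B c by (intro mult_strict_mono mult_strict_mono') auto
    then have "y3\<^sup>2 < x3\<^sup>2" unfolding sqs by (simp add: mult_ac)
    then show ?thesis using xypos by (simp add: power2_less_imp_less)
  qed
  have less1: "y1 < x1"
  proof -
    have "c * (1 - c) * (A + c) < (B + c) * (A + B + c + 1) * (A + B + c)"
      using A B c by (intro mult_strict_mono mult_strict_mono') auto
    then have "y1\<^sup>2 < x1\<^sup>2" unfolding sqs by (simp add: mult_ac)
    then show ?thesis using xypos by (simp add: power2_less_imp_less)
  qed
  have sgn0: "s4 * \<bar>x0 - y0\<bar> = y0 - x0"
  proof -
    have "y0\<^sup>2 - x0\<^sup>2 = (y0 - x0) * (y0 + x0)" by (simp add: power2_eq_square algebra_simps)
    then show ?thesis using s4' s xypos by (auto simp: zero_less_mult_iff mult_less_0_iff)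
  qed
  have sgn2: "s2 * \<bar>x2 - y2\<bar> = x2 - y2"
  proof -
    have "x2\<^sup>2 - y2\<^sup>2 = (x2 - y2) * (x2 + y2)" by (simp add: power2_eq_square algebra_simps)
    then show ?thesis using s2' s xypos by (auto simp: zero_less_mult_iff mult_less_0_iff)
  qed
  note k0 = band_coord_square_left[OF xypos(1,2) d neq0 p0]
  note k1 = band_coord_square_right[OF xypos(3,4) d less_imp_neq[OF less1, symmetric] p1]
  note k2 = band_coord_square_right[OF xypos(5,6) d neq2 p2]
  note k3 = band_coord_square_left[OF xypos(7,8) d less_imp_neq[OF less3, symmetric] p3]
  have sk0: "s4 * band_coord \<alpha> \<beta> 0 = (y0 - x0) / (x0 + y0)"
    unfolding k0(1) times_divide_eq_right sgn0 ..
  have sk2: "s2 * band_coord \<alpha> \<beta> 1 = (x2 + y2) / (x2 - y2)"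
  proof -
    have "\<bar>x2 - y2\<bar> = s2 * (x2 - y2)" using sgn2 s(1) by auto
    then show ?thesis using s(1) by (auto simp: k2(1) divide_simps)
  qed
  have kk1: "band_coord \<alpha> \<beta> (1 + B) = (x1 + y1) / (x1 - y1)" using k1 less1 by simp
  have kk3: "band_coord \<alpha> \<beta> (- A) = (x3 - y3) / (x3 + y3)" using k3 less3 by simp
  show ?thesis
    unfolding \<alpha>_def[symmetric] \<beta>_def[symmetric]
  proof
    show "0 < \<alpha>" using p0(1) neq0 d by simp
    show "\<beta> < 1" using p2(2) neq2 d by (metis diff_gt_0_iff_gt divide_eq_0_iff eq_iff_diff_eq_0 less_irrefl zero_less_power2)
    have "\<beta> - \<alpha> = 4 * (a * b * e * f * g * h) / d\<^sup>2" unfolding \<alpha> \<beta> by (simp add: diff_divide_distrib add_divide_distrib)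
    also have "\<dots> > 0" using pos d by simp
    finally show "\<alpha> < \<beta>" by simp
    show "(1 - band_coord \<alpha> \<beta> (1 + B)) * (1 + s2 * band_coord \<alpha> \<beta> 1) * (1 + band_coord \<alpha> \<beta> (- A)) * (1 + s4 * band_coord \<alpha> \<beta> 0)
      = (1 + band_coord \<alpha> \<beta> (1 + B)) * (1 - s2 * band_coord \<alpha> \<beta> 1) * (1 - band_coord \<alpha> \<beta> (- A)) * (1 - s4 * band_coord \<alpha> \<beta> 0)"
    proof -
      have 1: "1 - band_coord \<alpha> \<beta> (1 + B) = - (2 * y1) / (x1 - y1)" "1 + band_coord \<alpha> \<beta> (1 + B) = 2 * x1 / (x1 - y1)"
        unfolding kk1 using less1 by (auto simp: field_simps)
      have 2: "1 + s2 * band_coord \<alpha> \<beta> 1 = 2 * x2 / (x2 - y2)" "1 - s2 * band_coord \<alpha> \<beta> 1 = - (2 * y2) / (x2 - y2)"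
        unfolding sk2 using neq2 by (auto simp: field_simps)
      have 3: "1 + band_coord \<alpha> \<beta> (- A) = 2 * x3 / (x3 + y3)" "1 - band_coord \<alpha> \<beta> (- A) = 2 * y3 / (x3 + y3)"
        unfolding kk3 using xypos by (auto simp: field_simps)
      have 4: "1 + s4 * band_coord \<alpha> \<beta> 0 = 2 * y0 / (x0 + y0)" "1 - s4 * band_coord \<alpha> \<beta> 0 = 2 * x0 / (x0 + y0)"
        unfolding sk0 using xypos by (auto simp: field_simps)
      \<comment> \<open>Both sides are (a b e f g h)^2: each of the six roots occurs twice.\<close>
      have "y1 * x2 * x3 * y0 = x1 * y2 * y3 * x0" by (simp add: xy mult_ac)
      then show ?thesis unfolding 1 2 3 4 by simp
    qed
    \<comment> \<open>The signed geometric means, scaled by d^2, add up to d^3, so the mass equation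
      reduces to d = A + B + 2 c.\<close>
    have N: "(x1\<^sup>2 - y1\<^sup>2) - (x2\<^sup>2 - y2\<^sup>2) + (x3\<^sup>2 - y3\<^sup>2) + (y0\<^sup>2 - x0\<^sup>2) = d\<^sup>2 * d"
      unfolding sqs d_def by algebra
    have abs1: "\<bar>x1\<^sup>2 - y1\<^sup>2\<bar> = x1\<^sup>2 - y1\<^sup>2" and abs3: "\<bar>x3\<^sup>2 - y3\<^sup>2\<bar> = x3\<^sup>2 - y3\<^sup>2"
      using less1 less3 xypos by (auto simp: power_mono)
    have ss: "s2 * s2 = 1" "s4 * s4 = 1" using s by auto
    have "- (1 + B - (x1\<^sup>2 - y1\<^sup>2) / d\<^sup>2) + s2 * (1 - s2 * (x2\<^sup>2 - y2\<^sup>2) / d\<^sup>2) + (- A + (x3\<^sup>2 - y3\<^sup>2) / d\<^sup>2)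
        + s4 * (0 + s4 * (y0\<^sup>2 - x0\<^sup>2) / d\<^sup>2)
      = s2 - (1 + A + B) + ((x1\<^sup>2 - y1\<^sup>2) - (s2 * s2) * (x2\<^sup>2 - y2\<^sup>2) + (x3\<^sup>2 - y3\<^sup>2) + (s4 * s4) * (y0\<^sup>2 - x0\<^sup>2)) / d\<^sup>2"
      by (simp add: algebra_simps add_divide_distrib diff_divide_distrib)
    also have "\<dots> = s2 - (1 + A + B) + d"
      unfolding ss mult_1_left N using d by simp
    finally have S: "- (1 + B - (x1\<^sup>2 - y1\<^sup>2) / d\<^sup>2) + s2 * (1 - s2 * (x2\<^sup>2 - y2\<^sup>2) / d\<^sup>2) + (- A + (x3\<^sup>2 - y3\<^sup>2) / d\<^sup>2)
        + s4 * (0 + s4 * (y0\<^sup>2 - x0\<^sup>2) / d\<^sup>2) = s2 - (1 + A + B) + d" .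
    show "c = (1 - s2) / 2 + 1 / 2 * (
        - (\<beta> - (\<beta> - \<alpha>) / (1 + band_coord \<alpha> \<beta> (1 + B))) + s2 * (\<beta> - (\<beta> - \<alpha>) / (1 + band_coord \<alpha> \<beta> 1))
        + (\<beta> - (\<beta> - \<alpha>) / (1 + band_coord \<alpha> \<beta> (- A))) + s4 * (\<beta> - (\<beta> - \<alpha>) / (1 + band_coord \<alpha> \<beta> 0)))"
      unfolding k0(2) k1(2) k2(2) k3(2) abs0 abs1 abs2 abs3 S by (simp add: d_def field_simps)
  qed (use A B c sg in auto)
qed

section \<open>The multiplier formula and the three cases\<close>

lemma hahn_k_band_coord:
  "hahn_k1 A B c = band_coord (hahn_alpha A B c) (hahn_beta A B c) (1 + B)"
  "hahn_k2 A B c = band_coord (hahn_alpha A B c) (hahn_beta A B c) 1"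
  "hahn_k3 A B c = band_coord (hahn_alpha A B c) (hahn_beta A B c) (- A)"
  "hahn_k4 A B c = band_coord (hahn_alpha A B c) (hahn_beta A B c) 0"
proof -
  have "(A + \<alpha>) / (A + \<beta>) = (- A - \<alpha>) / (- A - \<beta>)" for \<alpha> \<beta> :: real
    using nonzero_minus_divide_divide[of "A + \<beta>" "A + \<alpha>"] by (cases "A + \<beta> = 0") (simp_all add: algebra_simps)
  then show "hahn_k3 A B c = band_coord (hahn_alpha A B c) (hahn_beta A B c) (- A)"
    by (simp add: hahn_k3_def band_coord_def)
qed (simp_all add: hahn_k1_def hahn_k2_def hahn_k4_def band_coord_def)

text \<open>The signs \<open>\<sigma>\<close> of the multiplier formula are the negatives of the signs of the arctangents.\<close>

lemma (in hahn_band) G_right_end_hahn_ell: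
  assumes "\<alpha> = hahn_alpha A B c" "\<beta> = hahn_beta A B c"
  shows "G \<beta> = hahn_ell A B c (1, - s2, - 1, - s4)
    + (s2 + s4) * ((\<beta> - \<alpha>) * (ln (\<beta> - \<alpha>) - 1) - ln_prim \<beta>) - (1 - s2) * (ln_prim \<beta> - ln_prim (\<beta> - 1))"
proof -
  define k where "k = band_coord \<alpha> \<beta>"
  define L where "L = ln (\<beta> - \<alpha>) - 1"
  have k: "k p > 0" if "p \<in> {1 + B, 1, - A, 0}" for p
    unfolding k_def by (rule band_coord_facts[OF \<alpha>\<beta>(2) poles[OF that]])
  \<comment> \<open>The integrals produce 1 / (1 + k), whereas K^(1) contains k / (1 + k); the
    constants 1 add up to the sum of the signs, which is the origin of the correction with the
    factor s2 + s4.\<close>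
  have one: "k p / (1 + k p) = 1 - 1 / (1 + k p)" if "p \<in> {1 + B, 1, - A, 0}" for p
    using k[OF that] by (simp add: field_simps)
  have q: "(let k = band_coord \<alpha> \<beta> p in (ln (\<beta> - \<alpha>) - 1) / (1 + k) + (2 * k * ln 2 - 2 * ln (1 + k)) / (1 - k\<^sup>2))
      = L * (1 / (1 + k p)) + 2 * ln 2 * (k p / (1 - (k p)\<^sup>2)) - 2 * (ln (1 + k p) / (1 - (k p)\<^sup>2))" for p
    by (simp add: k_def L_def Let_def diff_divide_distrib)
  define S1 S2 S3 where "S1 = signed (\<lambda>p. 1 / (1 + k p))" and "S2 = signed (\<lambda>p. k p / (1 - (k p)\<^sup>2))"
    and "S3 = signed (\<lambda>p. ln (1 + k p) / (1 - (k p)\<^sup>2))"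
  have k_eq: "hahn_k1 A B c = k (1 + B)" "hahn_k2 A B c = k 1" "hahn_k3 A B c = k (- A)" "hahn_k4 A B c = k 0"
    by (simp_all only: hahn_k_band_coord assms k_def)
  have one': "k (1 + B) / (1 + k (1 + B)) = 1 - 1 / (1 + k (1 + B))" "k 1 / (1 + k 1) = 1 - 1 / (1 + k 1)"
    "k (- A) / (1 + k (- A)) = 1 - 1 / (1 + k (- A))" "k 0 / (1 + k 0) = 1 - 1 / (1 + k 0)"
    by (rule one; simp)+
  have K1: "hahn_K1 A B c (1, - s2, - 1, - s4) = - (s2 + s4) + S1"
    unfolding hahn_K1_def signed_sum_def k_eq S1_def signed_def prod.case one'
    by (simp add: right_diff_distrib)
  have K2: "hahn_K2 A B c (1, - s2, - 1, - s4) = - S2"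
    unfolding hahn_K2_def signed_sum_def k_eq S2_def signed_def prod.case by simp
  have K3: "hahn_K3 A B c (1, - s2, - 1, - s4) = - S3"
    unfolding hahn_K3_def signed_sum_def k_eq S3_def signed_def prod.case by simp
  have ell: "hahn_ell A B c (1, - s2, - 1, - s4)
      = (\<beta> - \<alpha>) * (L * (- (s2 + s4) + S1) + 2 * ln 2 * S2 - 2 * S3) + ext_field (V_Hahn A B) \<beta>"
    unfolding hahn_ell_def Let_def K1 K2 K3 assms[symmetric] L_def[symmetric] by simp
  have Q: "signed (\<lambda>p. L * (1 / (1 + k p)) + 2 * ln 2 * (k p / (1 - (k p)\<^sup>2)) - 2 * (ln (1 + k p) / (1 - (k p)\<^sup>2)))
    = L * S1 + 2 * ln 2 * S2 - 2 * S3"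
    unfolding signed_def S1_def S2_def S3_def by algebra
  show ?thesis
    unfolding G_right_end q Q ell unfolding L_def[symmetric] by algebra
qed

lemma cA_cB_iff:
  assumes "0 < A" "A \<le> B" "0 < c"
  shows "c < cA A B \<longleftrightarrow> c\<^sup>2 + (A + B) * c < A" "cA A B < c \<longleftrightarrow> A < c\<^sup>2 + (A + B) * c"
    "c < cB A B \<longleftrightarrow> c\<^sup>2 + (A + B) * c < B" "cB A B < c \<longleftrightarrow> B < c\<^sup>2 + (A + B) * c"
  unfolding cA_def cB_def using assms less_quadratic_root_iff[of "A + B" A c] less_quadratic_root_iff[of "A + B" B c]
  by simp_all

lemma (in hahn_band) dens_regions:
  "AE x in unit_lborel.
    (\<alpha> < x \<and> x < \<beta> \<longrightarrow> dens \<mu> x = (1 - s2) / 2 / c + 1 / (pi * c) * signed (\<lambda>p. arctan (band_coord \<alpha> \<beta> p * sqrt ((\<beta> - x) / (x - \<alpha>))))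
      \<and> 0 < dens \<mu> x \<and> dens \<mu> x < 1 / c) \<and>
    (0 \<le> x \<and> x \<le> \<alpha> \<longrightarrow> dens \<mu> x = (1 + s4) / 2 / c) \<and>
    (\<beta> \<le> x \<and> x \<le> 1 \<longrightarrow> dens \<mu> x = (1 - s2) / 2 / c)"
  using dens_\<mu>
proof eventually_elim
  case (elim x)
  have "\<rho> x = (1 - s2) / 2 / c + 1 / (pi * c) * signed (\<lambda>p. arctan (band_coord \<alpha> \<beta> p * sqrt ((\<beta> - x) / (x - \<alpha>))))"
    if "\<alpha> < x" "x < \<beta>"
    using that c by (simp add: \<rho>_def signed_def band_profile_def field_simps)
  then show ?case unfolding elim using \<rho>_left \<rho>_right \<rho>_band by blast
qed

theorem theorem2p17:
  fixes A B c \<alpha> \<beta> k1 k2 k3 k4 :: real and V T :: "real \<Rightarrow> real"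
  defines "V \<equiv> V_Hahn A B"
    and "\<alpha> \<equiv> hahn_alpha A B c" and "\<beta> \<equiv> hahn_beta A B c"
    and "T \<equiv> hahn_T A B c"
    and "k1 \<equiv> hahn_k1 A B c" and "k2 \<equiv> hahn_k2 A B c"
    and "k3 \<equiv> hahn_k3 A B c" and "k4 \<equiv> hahn_k4 A B c"
  assumes "0 < A" and "A \<le> B" and "0 < c" and "c < 1"
  shows "(c < cA A B \<longrightarrow>
      0 < \<alpha> \<and> \<alpha> < \<beta> \<and> \<beta> < 1 \<and>
      (\<exists>\<mu>. is_unique_minimizer V c \<mu> \<and>
        (AE x in unit_lborel.
          (\<alpha> < x \<and> x < \<beta> \<longrightarrow> dens \<mu> x =
             1 / (pi * c) * (arctan (k2 * T x) + arctan (k3 * T x) - arctan (k1 * T x) - arctan (k4 * T x)) \<and>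
             0 < dens \<mu> x \<and> dens \<mu> x < 1 / c) \<and>
          (0 \<le> x \<and> x \<le> \<alpha> \<longrightarrow> dens \<mu> x = 0) \<and>
          (\<beta> \<le> x \<and> x \<le> 1 \<longrightarrow> dens \<mu> x = 0)) \<and>
        (\<forall>l. is_multiplier V c \<mu> l \<longleftrightarrow> l = hahn_ell A B c (1, -1, -1, 1)))) \<and>
    (cA A B < c \<and> c < cB A B \<longrightarrow>
      0 < \<alpha> \<and> \<alpha> < \<beta> \<and> \<beta> < 1 \<and>
      (\<exists>\<mu>. is_unique_minimizer V c \<mu> \<and>
        (AE x in unit_lborel.
          (\<alpha> < x \<and> x < \<beta> \<longrightarrow> dens \<mu> x =
             1 / (pi * c) * (arctan (k2 * T x) + arctan (k3 * T x) - arctan (k1 * T x) + arctan (k4 * T x)) \<and>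
             0 < dens \<mu> x \<and> dens \<mu> x < 1 / c) \<and>
          (0 \<le> x \<and> x \<le> \<alpha> \<longrightarrow> dens \<mu> x = 1 / c) \<and>
          (\<beta> \<le> x \<and> x \<le> 1 \<longrightarrow> dens \<mu> x = 0)) \<and>
        (\<forall>l. is_multiplier V c \<mu> l \<longleftrightarrow> l = hahn_ell A B c (1, -1, -1, -1)
             + 2 * (\<beta> - \<alpha>) * ln (\<beta> - \<alpha>) + 2 * \<alpha> - 2 * \<beta> * ln \<beta>))) \<and>
    (cB A B < c \<longrightarrow>
      0 < \<alpha> \<and> \<alpha> < \<beta> \<and> \<beta> < 1 \<and>
      (\<exists>\<mu>. is_unique_minimizer V c \<mu> \<and>
        (AE x in unit_lborel.
          (\<alpha> < x \<and> x < \<beta> \<longrightarrow> dens \<mu> x = 1 / c +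
             1 / (pi * c) * (arctan (k3 * T x) + arctan (k4 * T x) - arctan (k1 * T x) - arctan (k2 * T x)) \<and>
             0 < dens \<mu> x \<and> dens \<mu> x < 1 / c) \<and>
          (0 \<le> x \<and> x \<le> \<alpha> \<longrightarrow> dens \<mu> x = 1 / c) \<and>
          (\<beta> \<le> x \<and> x \<le> 1 \<longrightarrow> dens \<mu> x = 1 / c)) \<and>
        (\<forall>l. is_multiplier V c \<mu> l \<longleftrightarrow> l = hahn_ell A B c (1, 1, -1, -1)
             + 2 - 2 * \<beta> * ln \<beta> - 2 * (1 - \<beta>) * ln (1 - \<beta>))))"
proof -
  note k_eqs = k1_def k2_def k3_def k4_def hahn_k_band_coord \<alpha>_def[symmetric] \<beta>_def[symmetric]
  have T: "T x = sqrt ((\<beta> - x) / (x - \<alpha>))" for x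
    by (simp add: T_def hahn_T_def \<alpha>_def \<beta>_def)
  have B: "0 < B" using assms(9,10) by simp
  note A_le = assms(10)
  note iff = cA_cB_iff[OF assms(9,10,11)]
  have inst: "hahn_band A B c \<alpha> \<beta> s2 s4"
    if "band_signs s2 s4" "s4 * (c\<^sup>2 + (A + B) * c - A) > 0" "s2 * (B - (c\<^sup>2 + (A + B) * c)) > 0" for s2 s4
    unfolding \<alpha>_def \<beta>_def by (rule hahn_band_instance[OF assms(9) B assms(11,12) that])
  have weights: "(1 - 1) / 2 / c = 0" "(1 + - 1) / 2 / c = 0" "(1 + 1) / 2 / c = 1 / c" "(1 - - 1) / 2 / c = 1 / c" "0 + y = y"
    for y :: real by simp_all
  show ?thesis
  proof ((rule conjI; (rule conjI)?; rule impI), goal_cases)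
    case 1
    interpret H: hahn_band A B c \<alpha> \<beta> "1" "-1"
      using 1 A_le by (intro inst) (auto simp: band_signs_def iff)
    have arc: "H.signed (\<lambda>p. arctan (band_coord \<alpha> \<beta> p * sqrt ((\<beta> - x) / (x - \<alpha>)))) = arctan (k2 * T x) + arctan (k3 * T x) - arctan (k1 * T x) - arctan (k4 * T x)" for x
      by (simp add: H.signed_def k_eqs T)
    show ?case
      unfolding V_def
    proof (intro conjI exI[of _ H.\<mu>] H.\<alpha>\<beta> H.unique_minimizer, goal_cases)
      case 1
      show ?case
        using H.dens_regions unfolding arc weights .
    next
      case 2
      \<comment> \<open>Here s2 + s4 = 0 and 1 - s2 = 0, so neither correction survives.\<close>
      show ?case
        unfolding H.multiplier_iff H.G_right_end_hahn_ell[OF \<alpha>_def[THEN meta_eq_to_obj_eq] \<beta>_def[THEN meta_eq_to_obj_eq]]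
        by simp
    qed
  next
    case 2
    interpret H: hahn_band A B c \<alpha> \<beta> "1" "1"
      using 2 A_le by (intro inst) (auto simp: band_signs_def iff)
    have arc: "H.signed (\<lambda>p. arctan (band_coord \<alpha> \<beta> p * sqrt ((\<beta> - x) / (x - \<alpha>)))) = arctan (k2 * T x) + arctan (k3 * T x) - arctan (k1 * T x) + arctan (k4 * T x)" for x
      by (simp add: H.signed_def k_eqs T)
    show ?case
      unfolding V_def
    proof (intro conjI exI[of _ H.\<mu>] H.\<alpha>\<beta> H.unique_minimizer, goal_cases)
      case 1
      show ?case
        using H.dens_regions unfolding arc weights .
    next
      case 2
      \<comment> \<open>The surviving correction is the one with s2 + s4 = 2.\<close>
      show ?case
        unfolding H.multiplier_iff H.G_right_end_hahn_ell[OF \<alpha>_def[THEN meta_eq_to_obj_eq] \<beta>_def[THEN meta_eq_to_obj_eq]]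
        using H.\<alpha>\<beta> by (simp add: ln_prim_def algebra_simps)
    qed
  next
    case 3
    interpret H: hahn_band A B c \<alpha> \<beta> "-1" "1"
      using 3 A_le by (intro inst) (auto simp: band_signs_def iff)
    have arc: "H.signed (\<lambda>p. arctan (band_coord \<alpha> \<beta> p * sqrt ((\<beta> - x) / (x - \<alpha>)))) = arctan (k3 * T x) + arctan (k4 * T x) - arctan (k1 * T x) - arctan (k2 * T x)" for x
      by (simp add: H.signed_def k_eqs T)
    show ?case
      unfolding V_def
    proof (intro conjI exI[of _ H.\<mu>] H.\<alpha>\<beta> H.unique_minimizer, goal_cases)
      case 1
      show ?case
        using H.dens_regions unfolding arc weights .
    next
      case 2
      \<comment> \<open>The surviving correction is the one with 1 - s2 = 2; its term
        \<open>ln_prim (\<beta> - 1)\<close> yields the logarithm of 1 - \<beta>.\<close>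
      show ?case
        unfolding H.multiplier_iff H.G_right_end_hahn_ell[OF \<alpha>_def[THEN meta_eq_to_obj_eq] \<beta>_def[THEN meta_eq_to_obj_eq]]
        using H.\<alpha>\<beta> by (simp add: ln_prim_def algebra_simps)
    qed
  qed
qed

end
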